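(* Let $\Sigma$ be a linear compartment model with graph $G$, let $A=A(G)$, let $\partial$ denote the differentiation operator, and let $M_{ji}$ be the submatrix of $\partial I-A$ obtained by deleting the $j$-th row and the $i$-th column. For $i\in\mathrm{Out}$ consider the differential polynomial $$h_i:=\det(\partial I-A)(y_i)-c_i(\bm{\mu})\sum_{j\in\mathrm{In}}(-1)^{i+j}\det(M_{ji})\bigl(b_j(\bm{\mu})u_j\bigr),$$ which vanishes on every solution of $\Sigma$. If $G$ is strongly connected and the model has at least one input ($\mathrm{In}\neq\varnothing$), then the coefficients of the differential polynomials $h_i$, $i\in\mathrm{Out}$, with respect to the $y$'s and $u$'s (and their derivatives) generate, over $\mathbb{C}$, the field of identifiable functions of $\Sigma$.
   Context: **Linear compartment models.** Let $G$ be a simple directed graph with vertex set $V=\{1,\ldots,n\}$ and edge set $E$, and let $\mathrm{In},\mathrm{Out},\mathrm{Leak}\subset V$ with, without loss of generality, $\mathrm{Out}=\{1,\ldots,m\}$, $m\ge1$. The parameters $\bm{\mu}=(\mu_1,\ldots,\mu_\lambda)$ are indeterminates consisting of all $a_{ji}$ for edges $i\to j$ in $E$, all $a_{0i}$ for $i\in\mathrm{Leak}$, and possibly some additional parameters. Let $b_i\in\mathbb{C}(\bm{\mu})\setminus\{0\}$ for $i\in\mathrm{In}$ and $c_i\in\mathbb{C}(\bm{\mu})\setminus\{0\}$ for $i\in\mathrm{Out}$. The matrix $A(G)$ is the $n\times n$ matrix with $A(G)_{ii}=-a_{0i}-\sum_{k:\,i\to k\in E}a_{ki}$ if $i\in\mathrm{Leak}$,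 $A(G)_{ii}=-\sum_{k:\,i\to k\in E}a_{ki}$ if $i\notin\mathrm{Leak}$, $A(G)_{ij}=a_{ij}$ if $j\to i\in E$, and $A(G)_{ij}=0$ otherwise. The associated *linear compartment model* is the system $\Sigma$: $\mathbf{x}'=A(G)\mathbf{x}+\mathbf{v}$, $y_i=c_i(\bm{\mu})x_i$ for $i\in\mathrm{Out}$, $\mathbf{x}(0)=\mathbf{x}^\ast$, where $\mathbf{v}$ is the column whose $i$-th entry is $b_i(\bm{\mu})u_i$ if $i\in\mathrm{In}$ and $0$ otherwise. So the states are $\mathbf{x}=(x_1,\ldots,x_n)$, outputs $\mathbf{y}=(y_1,\ldots,y_m)$, inputs $\mathbf{u}=(u_i\mid i\in\mathrm{In})$, $\kappa=|\mathrm{In}|$. Elements of $\mathbb{C}(\bm{\mu})$ are constants for $\partial$. **Identifiability.** $\mathbb{C}^\infty(0)$ is the set of all functions complex analytic in some neighborhood of $t=0$. $\Omega\subset\mathbb{C}^\lambda$ is the complement of the set where at least one of the denominators of the coefficients (in $\mathbb{C}(\bm{\mu})$) of $\Sigma$ vanishes. For $h\in\mathbb{C}(\bm{\mu})$ put $\Omega_h:=\mathbb{C}^n\times\{\hat{\bm{\mu}}\in\Omega\mid h(\hat{\bm{\mu}})\text{ well-defined}\}\times(\mathbb{C}^\infty(0))^\kappa$. For $(\hat{\mathbf{x}}^\ast,\hat{\bm{\mu}},\hat{\mathbf{u}})$ with $\hat{\bm{\mu}}\in\Omega$, $Y(\hat{\mathbf{x}}^\ast,\hat{\bm{\mu}},\hat{\mathbf{u}})$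 denotes the $\mathbf{y}$-component of the unique solution over $\mathbb{C}^\infty(0)$ of $\Sigma$ with $\mathbf{x}^\ast=\hat{\mathbf{x}}^\ast$, $\bm{\mu}=\hat{\bm{\mu}}$, $\mathbf{u}=\hat{\mathbf{u}}$. A subset of $\mathbb{C}^s$ is Zariski open if it is the complement of the zero set of some polynomial $P$ on $\mathbb{C}^s$; a subset $U\subset(\mathbb{C}^\infty(0))^s$ is Zariski open if there is a polynomial $P$ in $z_1,\ldots,z_s$ and their derivatives with $U=\{\hat{\mathbf z}\in(\mathbb{C}^\infty(0))^s\mid P(\hat{\mathbf z})|_{t=0}\neq0\}$. $\tau(X)$ denotes the set of nonempty Zariski open subsets of $X$. A function $h\in\mathbb{C}(\bm{\mu})$ is *identifiable* if there exist $\Theta\in\tau(\mathbb{C}^n\times\mathbb{C}^\lambda)$ and $U\in\tau((\mathbb{C}^\infty(0))^\kappa)$ such that for all $(\hat{\mathbf{x}}^\ast,\hat{\bm{\mu}},\hat{\mathbf{u}})\in(\Theta\times U)\cap\Omega_h$ one has $|S_h(\hat{\mathbf{x}}^\ast,\hat{\bm{\mu}},\hat{\mathbf{u}})|=1$, where $$S_h(\hat{\mathbf{x}}^\ast,\hat{\bm{\mu}},\hat{\mathbf{u}})=\{h(\tilde{\bm{\mu}})\mid\exists(\tilde{\mathbf{x}}^\ast,\tilde{\bm{\mu}},\hat{\mathbf{u}})\in\Omega_h\text{ with }Y(\hat{\mathbf{x}}^\ast,\hat{\bm{\mu}},\hat{\mathbf{u}})=Y(\tilde{\mathbf{x}}^\ast,\tilde{\bm{\mu}},\hat{\mathbf{u}})\}.$$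 The *field of identifiable functions* is $\{h\in\mathbb{C}(\bm{\mu})\mid h\text{ is identifiable}\}$. *)

theory Defs
  imports
    "HOL-Complex_Analysis.Complex_Analysis"
    "HOL-Library.Poly_Mapping"
    "HOL-Library.FuncSet"
    "HOL-Computational_Algebra.Fraction_Field"
    "HOL-Algebra.Generated_Fields"
    "Jordan_Normal_Form.Char_Poly"
    "Jordan_Normal_Form.VS_Connect"
    "Graph_Theory.Digraph_Component"
begin

section \<open>Multivariate polynomials and rational functions\<close>

text \<open>
  A polynomial maps exponent vectors (finitely supported maps from variables to exponents) to
  coefficients; the ring structure is the convolution product of \<open>Poly_Mapping\<close>.
\<close>

type_synonym ('v, 'a) mpoly = "('v \<Rightarrow>\<^sub>0 nat) \<Rightarrow>\<^sub>0 'a"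

type_synonym ratfun = "(nat, complex) mpoly fract"

definition mp_var :: "'v \<Rightarrow> ('v, 'a :: comm_semiring_1) mpoly" where
  "mp_var v = Poly_Mapping.single (Poly_Mapping.single v 1) 1"

definition mp_const :: "'a :: comm_semiring_1 \<Rightarrow> ('v, 'a) mpoly" where
  "mp_const c = Poly_Mapping.single 0 c"

definition mp_vars :: "('v, 'a :: comm_semiring_1) mpoly \<Rightarrow> 'v set" where
  "mp_vars p = (\<Union>m\<in>Poly_Mapping.keys p. Poly_Mapping.keys m)"

definition mp_eval :: "('v \<Rightarrow> 'a) \<Rightarrow> ('v, 'a :: comm_semiring_1) mpoly \<Rightarrow> 'a" where
  "mp_eval z p = (\<Sum>m\<in>Poly_Mapping.keys p.
     Poly_Mapping.lookup p m * (\<Prod>v\<in>Poly_Mapping.keys m. z v ^ Poly_Mapping.lookup m v))"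

definition rf_var :: "nat \<Rightarrow> ratfun" where
  "rf_var k = Fract (mp_var k) 1"

definition rf_const :: "complex \<Rightarrow> ratfun" where
  "rf_const c = Fract (mp_const c) 1"

text \<open>
  The type \<^typ>\<open>ratfun\<close> has infinitely many indeterminates; \<open>rational_functions X\<close> is the subfield
  of rational functions in the indeterminates with index in \<open>X\<close>.
\<close>

definition rational_functions :: "nat set \<Rightarrow> ratfun set" where
  "rational_functions X =
     {Fract p q | p q. mp_vars p \<subseteq> X \<and> mp_vars q \<subseteq> X \<and> q \<noteq> 0}"

text \<open>
  \<open>h\<close> is well-defined at \<open>\<mu>\<close> if some way of writing it as a fraction has a denominator that does
  not vanish at \<open>\<mu>\<close>; by unique factorization this says that the denominator in lowest terms does
  not vanish there.
\<close>

definition rf_value :: "nat set \<Rightarrow> ratfun \<Rightarrow> (nat \<Rightarrow> complex) \<Rightarrow> complex \<Rightarrow> bool" where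
  "rf_value X h \<mu> w \<longleftrightarrow>
     (\<exists>p q. mp_vars p \<subseteq> X \<and> mp_vars q \<subseteq> X \<and> q \<noteq> 0 \<and> h = Fract p q \<and>
            mp_eval \<mu> q \<noteq> 0 \<and> w = mp_eval \<mu> p / mp_eval \<mu> q)"

definition rf_defined :: "nat set \<Rightarrow> ratfun \<Rightarrow> (nat \<Rightarrow> complex) \<Rightarrow> bool" where
  "rf_defined X h \<mu> \<longleftrightarrow> (\<exists>w. rf_value X h \<mu> w)"

definition rf_eval :: "nat set \<Rightarrow> ratfun \<Rightarrow> (nat \<Rightarrow> complex) \<Rightarrow> complex" where
  "rf_eval X h \<mu> = (THE w. rf_value X h \<mu> w)"

section \<open>Differential polynomials\<close>

text \<open>
  The variable \<open>(z, k)\<close> stands for the \<open>k\<close>-th derivative of the differential indeterminate \<open>z\<close>.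
\<close>

type_synonym ('z, 'a) diffpoly = "('z \<times> nat, 'a) mpoly"

text \<open>The derivation that sends \<open>(z, k)\<close> to \<open>(z, k + 1)\<close> and kills the coefficients.\<close>

definition dp_deriv :: "('z, 'a :: comm_semiring_1) diffpoly \<Rightarrow> ('z, 'a) diffpoly" where
  "dp_deriv p = (\<Sum>m\<in>Poly_Mapping.keys p. \<Sum>(z, k)\<in>Poly_Mapping.keys m.
     Poly_Mapping.single
       (m - Poly_Mapping.single (z, k) 1 + Poly_Mapping.single (z, Suc k) 1)
       (Poly_Mapping.lookup p m * of_nat (Poly_Mapping.lookup m (z, k))))"

text \<open>The action of a differential operator, given as a polynomial in the derivation symbol.\<close>

definition dp_apply ::
    "'a :: comm_semiring_1 poly \<Rightarrow> ('z, 'a) diffpoly \<Rightarrow> ('z, 'a) diffpoly" where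
  "dp_apply L p = (\<Sum>k\<le>Polynomial.degree L. mp_const (Polynomial.coeff L k) * (dp_deriv ^^ k) p)"

definition dp_coeffs :: "('z, 'a :: comm_semiring_1) diffpoly \<Rightarrow> 'a set" where
  "dp_coeffs p = Poly_Mapping.lookup p ` Poly_Mapping.keys p"

definition dp_eval ::
    "('z \<Rightarrow> complex \<Rightarrow> complex) \<Rightarrow> ('z, complex) diffpoly \<Rightarrow> complex \<Rightarrow> complex" where
  "dp_eval z p t = mp_eval (\<lambda>(i, k). (deriv ^^ k) (z i) t) p"

section \<open>Zariski open sets\<close>

definition cspace :: "'v set \<Rightarrow> ('v \<Rightarrow> complex) set" where
  "cspace I = (I \<rightarrow>\<^sub>E UNIV)"

text \<open>
  Functions analytic near \<open>0\<close> are total functions here; two of them are the same element of the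
  ring of analytic functions at \<open>0\<close> iff they agree near \<open>0\<close>.
\<close>

definition analytic_at_0 :: "(complex \<Rightarrow> complex) set" where
  "analytic_at_0 = {f. f analytic_on {0}}"

definition germ_eq :: "(complex \<Rightarrow> complex) \<Rightarrow> (complex \<Rightarrow> complex) \<Rightarrow> bool" where
  "germ_eq f g \<longleftrightarrow> (\<forall>\<^sub>F t in nhds 0. f t = g t)"

definition analytic_tuples :: "'v set \<Rightarrow> ('v \<Rightarrow> complex \<Rightarrow> complex) set" where
  "analytic_tuples I = (I \<rightarrow>\<^sub>E analytic_at_0)"

definition zariski_open :: "'v set \<Rightarrow> ('v \<Rightarrow> complex) set \<Rightarrow> bool" where
  "zariski_open I \<Theta> \<longleftrightarrow>
     (\<exists>P. mp_vars P \<subseteq> I \<and> \<Theta> = {z \<in> cspace I. mp_eval z P \<noteq> 0})"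

definition zariski_open_analytic :: "'v set \<Rightarrow> ('v \<Rightarrow> complex \<Rightarrow> complex) set \<Rightarrow> bool" where
  "zariski_open_analytic I U \<longleftrightarrow>
     (\<exists>P. mp_vars P \<subseteq> I \<times> UNIV \<and> U = {z \<in> analytic_tuples I. dp_eval z P 0 \<noteq> 0})"

section \<open>Linear compartment models\<close>

text \<open>
  The parameters are the indeterminates \<open>rf_var 1\<close>, ..., \<open>rf_var (num_params M)\<close>.
  \<open>rate_index M j i\<close> is the index of the parameter \<open>a\<^sub>j\<^sub>i\<close>, attached to the edge from \<open>i\<close> to \<open>j\<close>;
  \<open>rate_index M 0 i\<close> is that of the leak parameter \<open>a\<^sub>0\<^sub>i\<close>. Indices that are not used as rates are
  the additional parameters.
\<close>

record compartment_model =
  graph :: "nat pair_pre_digraph"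
  num_states :: nat
  num_outputs :: nat
  inputs :: "nat set"
  leaks :: "nat set"
  num_params :: nat
  rate_index :: "nat \<Rightarrow> nat \<Rightarrow> nat"
  input_coeff :: "nat \<Rightarrow> ratfun"
  output_coeff :: "nat \<Rightarrow> ratfun"

definition states :: "compartment_model \<Rightarrow> nat set" where
  "states M = {1..num_states M}"

definition outputs :: "compartment_model \<Rightarrow> nat set" where
  "outputs M = {1..num_outputs M}"

definition params :: "compartment_model \<Rightarrow> nat set" where
  "params M = {1..num_params M}"

definition rates :: "compartment_model \<Rightarrow> (nat \<times> nat) set" where
  "rates M = {(j, i) | i j. (i, j) \<in> parcs (graph M)} \<union> {(0, i) | i. i \<in> leaks M}"

definition linear_compartment_model :: "compartment_model \<Rightarrow> bool" where
  "linear_compartment_model M \<longleftrightarrow>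
     pair_digraph (graph M) \<and> pverts (graph M) = states M \<and>
     inputs M \<subseteq> states M \<and> leaks M \<subseteq> states M \<and> outputs M \<subseteq> states M \<and>
     1 \<le> num_outputs M \<and>
     inj_on (\<lambda>(j, i). rate_index M j i) (rates M) \<and>
     (\<lambda>(j, i). rate_index M j i) ` rates M \<subseteq> params M \<and>
     (\<forall>i\<in>inputs M. input_coeff M i \<in> rational_functions (params M) - {0}) \<and>
     (\<forall>i\<in>outputs M. output_coeff M i \<in> rational_functions (params M) - {0})"

definition rate :: "compartment_model \<Rightarrow> nat \<Rightarrow> nat \<Rightarrow> ratfun" where
  "rate M j i = rf_var (rate_index M j i)"

definition compartment_entry :: "compartment_model \<Rightarrow> nat \<Rightarrow> nat \<Rightarrow> ratfun" where
  "compartment_entry M i j =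
     (if i = j then
        - (if i \<in> leaks M then rate M 0 i else 0)
        - (\<Sum>k | (i, k) \<in> parcs (graph M). rate M k i)
      else if (j, i) \<in> parcs (graph M) then rate M i j
      else 0)"

text \<open>
  Vertices are numbered from \<open>1\<close>, matrix rows and columns from \<open>0\<close>.
\<close>

definition compartment_matrix :: "compartment_model \<Rightarrow> ratfun mat" where
  "compartment_matrix M =
     Matrix.mat (num_states M) (num_states M) (\<lambda>(r, s). compartment_entry M (Suc r) (Suc s))"

text \<open>
  The constants commute with the derivation, so the operators with constant coefficients form the
  polynomial ring \<^typ>\<open>ratfun poly\<close>, the derivation being \<open>[:0, 1:]\<close>, and
  \<open>char_poly_matrix A\<close> is the matrix obtained by subtracting \<open>A\<close> from the derivation times the
  identity.
\<close>

definition io_minor :: "compartment_model \<Rightarrow> nat \<Rightarrow> nat \<Rightarrow> ratfun poly mat" where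
  "io_minor M j i = mat_delete (char_poly_matrix (compartment_matrix M)) (j - 1) (i - 1)"

text \<open>
  \<open>Inl i\<close> is the differential indeterminate \<open>y\<^sub>i\<close> and \<open>Inr j\<close> is \<open>u\<^sub>j\<close>.
\<close>

definition io_equation :: "compartment_model \<Rightarrow> nat \<Rightarrow> (nat + nat, ratfun) diffpoly" where
  "io_equation M i =
     dp_apply (Determinant.det (char_poly_matrix (compartment_matrix M))) (mp_var (Inl i, 0))
     - mp_const (output_coeff M i) *
       (\<Sum>j\<in>inputs M. (- 1) ^ (i + j) *
          dp_apply (Determinant.det (io_minor M j i))
            (mp_const (input_coeff M j) * mp_var (Inr j, 0)))"

definition io_coefficients :: "compartment_model \<Rightarrow> ratfun set" where
  "io_coefficients M = (\<Union>i\<in>outputs M. dp_coeffs (io_equation M i))"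

section \<open>Solutions and identifiability\<close>

definition param_domain :: "compartment_model \<Rightarrow> (nat \<Rightarrow> complex) set" where
  "param_domain M = {\<mu> \<in> cspace (params M).
     (\<forall>i\<in>states M. \<forall>j\<in>states M. rf_defined (params M) (compartment_entry M i j) \<mu>) \<and>
     (\<forall>i\<in>inputs M. rf_defined (params M) (input_coeff M i) \<mu>) \<and>
     (\<forall>i\<in>outputs M. rf_defined (params M) (output_coeff M i) \<mu>)}"

definition is_solution ::
    "compartment_model \<Rightarrow> (nat \<Rightarrow> complex) \<Rightarrow> (nat \<Rightarrow> complex) \<Rightarrow>
     (nat \<Rightarrow> complex \<Rightarrow> complex) \<Rightarrow> (nat \<Rightarrow> complex \<Rightarrow> complex) \<Rightarrow> bool" where
  "is_solution M x0 \<mu> u x \<longleftrightarrow>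
     x \<in> analytic_tuples (states M) \<and>
     (\<forall>i\<in>states M. x i 0 = x0 i \<and>
        germ_eq (deriv (x i))
          (\<lambda>t. (\<Sum>j\<in>states M. rf_eval (params M) (compartment_entry M i j) \<mu> * x j t)
               + (if i \<in> inputs M then rf_eval (params M) (input_coeff M i) \<mu> * u i t else 0)))"

definition output_of ::
    "compartment_model \<Rightarrow> (nat \<Rightarrow> complex) \<Rightarrow> (nat \<Rightarrow> complex \<Rightarrow> complex) \<Rightarrow>
     nat \<Rightarrow> complex \<Rightarrow> complex" where
  "output_of M \<mu> x i t = rf_eval (params M) (output_coeff M i) \<mu> * x i t"

text \<open>
  The solution is unique only up to equality near \<open>0\<close>, whence the choice operator; outputs are
  compared below by \<open>germ_eq\<close>, which does not depend on the choice.
\<close>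

definition response ::
    "compartment_model \<Rightarrow> (nat \<Rightarrow> complex) \<Rightarrow> (nat \<Rightarrow> complex) \<Rightarrow>
     (nat \<Rightarrow> complex \<Rightarrow> complex) \<Rightarrow> nat \<Rightarrow> complex \<Rightarrow> complex" where
  "response M x0 \<mu> u = output_of M \<mu> (SOME x. is_solution M x0 \<mu> u x)"

definition admissible ::
    "compartment_model \<Rightarrow> ratfun \<Rightarrow>
     ((nat \<Rightarrow> complex) \<times> (nat \<Rightarrow> complex) \<times> (nat \<Rightarrow> complex \<Rightarrow> complex)) set" where
  "admissible M h = cspace (states M) \<times>
     {\<mu> \<in> param_domain M. rf_defined (params M) h \<mu>} \<times> analytic_tuples (inputs M)"

definition indistinguishable_values ::
    "compartment_model \<Rightarrow> ratfun \<Rightarrow> (nat \<Rightarrow> complex) \<Rightarrow> (nat \<Rightarrow> complex) \<Rightarrow>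
     (nat \<Rightarrow> complex \<Rightarrow> complex) \<Rightarrow> complex set" where
  "indistinguishable_values M h x0 \<mu> u =
     {rf_eval (params M) h \<mu>' | x0' \<mu>'. (x0', \<mu>', u) \<in> admissible M h \<and>
        (\<forall>i\<in>outputs M. germ_eq (response M x0 \<mu> u i) (response M x0' \<mu>' u i))}"

text \<open>
  A pair \<open>(x0, \<mu>)\<close> is identified with the point \<open>case_sum x0 \<mu>\<close>.
\<close>

definition identifiable :: "compartment_model \<Rightarrow> ratfun \<Rightarrow> bool" where
  "identifiable M h \<longleftrightarrow>
     (\<exists>\<Theta> U. zariski_open (states M <+> params M) \<Theta> \<and> \<Theta> \<noteq> {} \<and>
            zariski_open_analytic (inputs M) U \<and> U \<noteq> {} \<and>
            (\<forall>(x0, \<mu>, u) \<in> admissible M h. case_sum x0 \<mu> \<in> \<Theta> \<and> u \<in> U \<longrightarrow>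
               card (indistinguishable_values M h x0 \<mu> u) = 1))"

definition identifiable_functions :: "compartment_model \<Rightarrow> ratfun set" where
  "identifiable_functions M = {h \<in> rational_functions (params M). identifiable M h}"

text \<open>
  \<open>specialize M \<mu>\<close> evaluates the coefficients of a differential polynomial at \<open>\<mu>\<close>.
\<close>

definition specialize ::
    "compartment_model \<Rightarrow> (nat \<Rightarrow> complex) \<Rightarrow> ('z, ratfun) diffpoly \<Rightarrow> ('z, complex) diffpoly" where
  "specialize M \<mu> p = Poly_Mapping.map (\<lambda>c. rf_eval (params M) c \<mu>) p"

definition vanishes_on_solutions ::
    "compartment_model \<Rightarrow> (nat + nat, ratfun) diffpoly \<Rightarrow> bool" where
  "vanishes_on_solutions M p \<longleftrightarrow>
     (\<forall>x0 \<in> cspace (states M). \<forall>\<mu> \<in> param_domain M. \<forall>u \<in> analytic_tuples (inputs M).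
      \<forall>x. is_solution M x0 \<mu> u x \<longrightarrow>
        germ_eq (dp_eval (case_sum (output_of M \<mu> x) u) (specialize M \<mu> p)) (\<lambda>_. 0))"

definition generated_field :: "ratfun set \<Rightarrow> ratfun set" where
  "generated_field S = generate_field class_ring (range rf_const \<union> S)"

end

theory Submission
  imports Defs
begin

text \<open>Analytic functions enter only through their derivatives at 0. Differentiation becomes
  the index shift on sequences, and uniqueness of solutions, input-output equations and coprimality
  turn into statements about linear recurrences. Independence of the input derivatives is required
  up to order 2n because comparing two equations of order n leaves operators of degree below 2n.
  Transposition does not exchange observability and controllability within the class: the columns of
  a compartmental matrix without leaks sum to zero, those of its transpose need not. Conjugation by
  an equilibrium repairs this, and since the equilibrium must have no zero entry, positive rates on
  all edges are used there. In the converse, the set \<Theta> comes with a polynomial that also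
  involves the initial values. Hence initial value and input are fixed first, and \<mu> then avoids
  the zeros of countably many functions, one of them from \<Theta>. The isomorphism is not
  continuous, and \<mu>' may lie far from \<mu> and outside \<Theta>; what has to survive is that
  finitely many polynomials do not vanish, which the isomorphism preserves.\<close>

text \<open>
  For strongly connected graphs the model is generically observable from every output (put distinct
  weights on the edges of a spanning tree directed towards the output) and controllable from every
  input (reverse time, i.e. conjugate the transpose of the reversed system by its positive
  equilibrium). Hence numerators and denominators of the transfer functions are coprime, and if
  finitely many derivatives of the inputs are linearly independent, then a solution satisfies only
  one system of input-output equations of this shape, so the output determines their coefficients.

  Conversely, suppose that \<open>h\<close> is not in the field \<open>F\<close> generated by the coefficients. Choose a generic
  parameter \<open>\<mu>\<close> over a countable ring of constants. Some isomorphism between countable subfields of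
  the complex numbers fixes the values at \<open>\<mu>\<close> of the elements of \<open>F\<close>, but moves \<open>h \<mu>\<close>, and it
  extends to the coordinates of \<open>\<mu>\<close>. Their images form a parameter \<open>\<mu>'\<close> with \<open>h \<mu>' \<noteq> h \<mu>\<close> and the
  same transfer functions. Both models being minimal realizations, they are similar, so suitable
  initial values give the same output for every input, and \<open>h\<close> is not identifiable.
\<close>

section \<open>Relations compatible with ring operations\<close>

text \<open>A relation instead of a homomorphism, because evaluation of rational functions is
  partial. Evaluation, bounds on the occurring variables and partial field isomorphisms are all
  instances, so determinants and matrix powers are transported once for all of them.\<close>

locale ring_rel =
  fixes R :: "'a :: comm_ring_1 \<Rightarrow> 'b :: comm_ring_1 \<Rightarrow> bool"
  assumes zero: "R 0 0" and one: "R 1 1"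
    and add: "R a b \<Longrightarrow> R c d \<Longrightarrow> R (a + c) (b + d)"
    and mult: "R a b \<Longrightarrow> R c d \<Longrightarrow> R (a * c) (b * d)"
    and uminus: "R a b \<Longrightarrow> R (- a) (- b)"
begin

lemma diff: "R a b \<Longrightarrow> R c d \<Longrightarrow> R (a - c) (b - d)"
  using add[OF _ uminus, of a b c d] by simp

lemma sum: "(\<And>x. x \<in> S \<Longrightarrow> R (f x) (g x)) \<Longrightarrow> R (sum f S) (sum g S)"
  by (induction S rule: infinite_finite_induct) (auto intro: zero add)

lemma prod: "(\<And>x. x \<in> S \<Longrightarrow> R (f x) (g x)) \<Longrightarrow> R (prod f S) (prod g S)"
  by (induction S rule: infinite_finite_induct) (auto intro: one mult)

lemma power: "R a b \<Longrightarrow> R (a ^ n) (b ^ n)"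
  by (induction n) (auto intro: one mult)

lemma det:
  assumes "A \<in> carrier_mat n n" "B \<in> carrier_mat n n"
    and "\<And>i j. i < n \<Longrightarrow> j < n \<Longrightarrow> R (A $$ (i, j)) (B $$ (i, j))"
  shows "R (Determinant.det A) (Determinant.det B)"
proof -
  have s: "R (signof p) (signof p)" for p
    by (auto simp: sign_def intro: one uminus)
  have "R (\<Sum>p | p permutes {0..<n}. signof p * (\<Prod>i = 0..<n. A $$ (i, p i)))
          (\<Sum>p | p permutes {0..<n}. signof p * (\<Prod>i = 0..<n. B $$ (i, p i)))"
    by (intro sum mult s prod) (auto intro!: assms(3) simp: permutes_in_image)
  then show ?thesis using assms(1,2) by (simp add: det_def')
qed

end

definition poly_rel :: "('a :: zero \<Rightarrow> 'b :: zero \<Rightarrow> bool) \<Rightarrow> 'a poly \<Rightarrow> 'b poly \<Rightarrow> bool" where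
  "poly_rel R f g \<longleftrightarrow> (\<forall>k. R (Polynomial.coeff f k) (Polynomial.coeff g k))"

lemma (in ring_rel) ring_rel_poly: "ring_rel (poly_rel R)"
proof
  show "poly_rel R 1 1" by (auto simp: poly_rel_def one_pCons coeff_pCons zero one split: nat.splits)
  show "poly_rel R (a * c) (b * d)" if "poly_rel R a b" "poly_rel R c d" for a b c d
    using that by (auto simp: poly_rel_def coeff_mult intro!: sum mult)
qed (auto simp: poly_rel_def zero intro: add uminus)

lemma (in ring_rel) char_poly_matrix_rel:
  assumes "A \<in> carrier_mat n n" "B \<in> carrier_mat n n"
    and "\<And>i j. i < n \<Longrightarrow> j < n \<Longrightarrow> R (A $$ (i, j)) (B $$ (i, j))"
    and "i < n" "j < n"
  shows "poly_rel R (char_poly_matrix A $$ (i, j)) (char_poly_matrix B $$ (i, j))"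
proof -
  note [simp] = carrier_matD[OF assms(1)] carrier_matD[OF assms(2)]
  have "R (- A $$ (i, j)) (- B $$ (i, j))" using assms by (intro uminus) auto
  then show ?thesis using assms(4,5)
    by (auto simp: char_poly_matrix_def poly_rel_def coeff_pCons zero one split: nat.splits)
qed

section \<open>Evaluation of multivariate polynomials\<close>

lemma poly_mapping_eq_sum_single:
  "p = (\<Sum>m\<in>Poly_Mapping.keys p. Poly_Mapping.single m (Poly_Mapping.lookup p m))"
  by (rule poly_mapping_eqI)
    (auto simp: lookup_sum lookup_single when_def in_keys_iff cong: if_cong)

lemma mp_eval_eq_sum:
  assumes "finite S" "Poly_Mapping.keys p \<subseteq> S"
  shows "mp_eval z p = (\<Sum>m\<in>S. Poly_Mapping.lookup p m *
           (\<Prod>v\<in>Poly_Mapping.keys m. z v ^ Poly_Mapping.lookup m v))"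
  unfolding mp_eval_def using assms by (intro sum.mono_neutral_left) (auto simp: in_keys_iff)

lemma monomial_value_eq_prod:
  fixes z :: "'v \<Rightarrow> 'a :: comm_semiring_1"
  assumes "finite S" "Poly_Mapping.keys m \<subseteq> S"
  shows "(\<Prod>v\<in>Poly_Mapping.keys m. z v ^ Poly_Mapping.lookup m v) =
         (\<Prod>v\<in>S. z v ^ Poly_Mapping.lookup m v)"
  using assms by (intro prod.mono_neutral_left) (auto simp: in_keys_iff)

lemma monomial_value_add:
  fixes z :: "'v \<Rightarrow> 'a :: comm_semiring_1"
  shows "(\<Prod>v\<in>Poly_Mapping.keys (m + m'). z v ^ Poly_Mapping.lookup (m + m') v) =
   (\<Prod>v\<in>Poly_Mapping.keys m. z v ^ Poly_Mapping.lookup m v) *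
   (\<Prod>v\<in>Poly_Mapping.keys m'. z v ^ Poly_Mapping.lookup m' v)"
proof -
  let ?S = "Poly_Mapping.keys m \<union> Poly_Mapping.keys m'"
  have "Poly_Mapping.keys (m + m') \<subseteq> ?S" by (rule Poly_Mapping.keys_add)
  then show ?thesis
    by (subst (1 2 3) monomial_value_eq_prod[of ?S])
      (auto simp: lookup_add power_add prod.distrib)
qed

lemma mp_eval_0 [simp]: "mp_eval z 0 = 0"
  by (simp add: mp_eval_def)

lemma mp_eval_single: "mp_eval z (Poly_Mapping.single m c) =
   c * (\<Prod>v\<in>Poly_Mapping.keys m. z v ^ Poly_Mapping.lookup m v)"
  by (subst mp_eval_eq_sum[of "{m}"]) auto

lemma mp_eval_add [simp]: "mp_eval z (p + q) = mp_eval z p + mp_eval z q"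
proof -
  let ?S = "Poly_Mapping.keys p \<union> Poly_Mapping.keys q"
  have "Poly_Mapping.keys (p + q) \<subseteq> ?S" by (rule Poly_Mapping.keys_add)
  then show ?thesis
    by (subst (1 2 3) mp_eval_eq_sum[of ?S]) (auto simp: lookup_add algebra_simps sum.distrib)
qed

lemma mp_eval_sum [simp]: "mp_eval z (sum f S) = (\<Sum>x\<in>S. mp_eval z (f x))"
  by (induction S rule: infinite_finite_induct) auto

lemma mp_eval_mult [simp]: "mp_eval z (p * q) = mp_eval z p * mp_eval z q"
proof -
  have "mp_eval z (p * q) =
      mp_eval z ((\<Sum>m\<in>Poly_Mapping.keys p. Poly_Mapping.single m (Poly_Mapping.lookup p m)) *
                 (\<Sum>m\<in>Poly_Mapping.keys q. Poly_Mapping.single m (Poly_Mapping.lookup q m)))"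
    by (simp flip: poly_mapping_eq_sum_single)
  also have "\<dots> = mp_eval z p * mp_eval z q"
    unfolding sum_product mp_eval_sum mult_single mp_eval_single monomial_value_add
    by (simp add: mp_eval_def sum_product mult_ac)
  finally show ?thesis .
qed

lemma mp_eval_const [simp]: "mp_eval z (mp_const c) = c"
  by (simp add: mp_const_def mp_eval_single)

lemma mp_eval_1 [simp]: "mp_eval z 1 = 1"
  using mp_eval_const[of z 1] by (simp add: mp_const_def)

lemma mp_eval_var [simp]: "mp_eval z (mp_var v) = z v"
  by (simp add: mp_var_def mp_eval_single)

lemma mp_eval_uminus [simp]: "mp_eval z (- p) = - mp_eval z (p :: ('v, 'a :: comm_ring_1) mpoly)"
  by (simp add: mp_eval_def sum_negf)

lemma mp_eval_diff [simp]:
  "mp_eval z (p - q) = mp_eval z p - mp_eval z (q :: ('v, 'a :: comm_ring_1) mpoly)"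
  using mp_eval_add[of z p "- q"] by simp

lemma mp_eval_power [simp]: "mp_eval z (p ^ n) = mp_eval z p ^ n"
  by (induction n) auto

lemma mp_eval_prod [simp]: "mp_eval z (prod f S) = (\<Prod>x\<in>S. mp_eval z (f x))"
  by (induction S rule: infinite_finite_induct) auto

lemma ring_rel_mp_eval: "ring_rel (\<lambda>f w. w = mp_eval z (f :: ('v, 'a :: comm_ring_1) mpoly))"
  by unfold_locales auto

lemma mp_eval_cong:
  assumes "\<And>v. v \<in> mp_vars p \<Longrightarrow> z v = z' v"
  shows "mp_eval z p = mp_eval z' p"
  unfolding mp_eval_def
  by (intro sum.cong arg_cong[where f = "\<lambda>x. _ * x"] prod.cong refl)
    (use assms in \<open>force simp: mp_vars_def\<close>)

lemma mp_vars_0 [simp]: "mp_vars 0 = {}"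
  and mp_vars_1 [simp]: "mp_vars 1 = {}"
  and mp_vars_const [simp]: "mp_vars (mp_const c) = {}"
  and mp_vars_var [simp]: "mp_vars (mp_var v :: ('v, 'a :: comm_semiring_1) mpoly) = {v}"
  and mp_vars_uminus [simp]: "mp_vars (- p :: ('v, 'b :: comm_ring_1) mpoly) = mp_vars p"
  by (auto simp: mp_vars_def mp_const_def mp_var_def keys_single in_keys_iff split: if_splits)

lemma mp_vars_add_subset: "mp_vars (p + q) \<subseteq> mp_vars p \<union> mp_vars q"
  using Poly_Mapping.keys_add[of p q] by (auto simp: mp_vars_def)

lemma mp_vars_mult_subset: "mp_vars (p * q) \<subseteq> mp_vars p \<union> mp_vars q"
proof
  fix v assume "v \<in> mp_vars (p * q)"
  then obtain m where m: "m \<in> Poly_Mapping.keys (p * q)" "v \<in> Poly_Mapping.keys m"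
    by (auto simp: mp_vars_def)
  then obtain a b where "m = a + b" "a \<in> Poly_Mapping.keys p" "b \<in> Poly_Mapping.keys q"
    using keys_mult[of p q] by blast
  with m(2) Poly_Mapping.keys_add[of a b] show "v \<in> mp_vars p \<union> mp_vars q"
    by (auto simp: mp_vars_def)
qed

text \<open>A subring is encoded as the diagonal relation on it. In this way \<open>det\<close>,
  \<open>sum\<close> and \<open>prod\<close> of \<open>ring_rel\<close> also serve as closure
  properties.\<close>

lemma ring_rel_mp_vars:
  "ring_rel (\<lambda>f g. mp_vars (f :: ('v, 'a :: comm_ring_1) mpoly) \<subseteq> X \<and> f = g)"
proof
  fix a b c d :: "('v, 'a) mpoly"
  assume "mp_vars a \<subseteq> X \<and> a = b" "mp_vars c \<subseteq> X \<and> c = d"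
  then show "mp_vars (a + c) \<subseteq> X \<and> a + c = b + d" "mp_vars (a * c) \<subseteq> X \<and> a * c = b * d"
    using mp_vars_add_subset[of a c] mp_vars_mult_subset[of a c] by auto
qed auto

lemma mp_eq_sum_monomials:
  "(p :: ('v, 'a :: comm_semiring_1) mpoly) = (\<Sum>m\<in>Poly_Mapping.keys p. mp_const (Poly_Mapping.lookup p m) *
      (\<Prod>v\<in>Poly_Mapping.keys m. mp_var v ^ Poly_Mapping.lookup m v))"
proof -
  have pow: "mp_var v ^ k = (Poly_Mapping.single (Poly_Mapping.single v k) 1 :: ('v, 'a) mpoly)" for v k
    by (induction k) (auto simp: mp_var_def mult_single simp flip: single_add)
  have "(\<Prod>v\<in>S. mp_var v ^ Poly_Mapping.lookup m v) =
     (Poly_Mapping.single (\<Sum>v\<in>S. Poly_Mapping.single v (Poly_Mapping.lookup m v)) 1 :: ('v, 'a) mpoly)"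
    if "finite S" for S m
    using that by (induction S) (auto simp: pow mult_single)
  note * = this[OF finite_keys]
  have "mp_const c * (\<Prod>v\<in>Poly_Mapping.keys m. mp_var v ^ Poly_Mapping.lookup m v) =
      (Poly_Mapping.single m c :: ('v, 'a) mpoly)" for m c
    unfolding mp_const_def * by (simp add: mult_single flip: poly_mapping_eq_sum_single)
  then show ?thesis by (simp flip: poly_mapping_eq_sum_single)
qed

lemma mp_eval_line:
  fixes p :: "('v, 'a :: comm_ring_1) mpoly"
  shows "\<exists>Q. \<forall>t. mp_eval (z(v := t)) p = poly Q t"
proof (intro exI allI)
  fix t
  have *: "poly ((if w = v then [:0, 1:] else [:z w:]) ^ k) t = (z(v := t)) w ^ k" for w k
    by (simp add: poly_power)
  have "poly (\<Sum>m\<in>Poly_Mapping.keys p. [:Poly_Mapping.lookup p m:] *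
     (\<Prod>w\<in>Poly_Mapping.keys m. (if w = v then [:0, 1:] else [:z w:]) ^ Poly_Mapping.lookup m w)) t
     = (\<Sum>m\<in>Poly_Mapping.keys p. Poly_Mapping.lookup p m *
     (\<Prod>w\<in>Poly_Mapping.keys m. (z(v := t)) w ^ Poly_Mapping.lookup m w))"
    unfolding poly_sum poly_mult poly_prod * by (simp del: fun_upd_apply)
  then show "mp_eval (z(v := t)) p = poly (\<Sum>m\<in>Poly_Mapping.keys p. [:Poly_Mapping.lookup p m:] *
     (\<Prod>w\<in>Poly_Mapping.keys m. (if w = v then [:0, 1:] else [:z w:]) ^ Poly_Mapping.lookup m w)) t"
    by (simp only: mp_eval_def)
qed

text \<open>
  Doubling one coordinate multiplies two monomials that differ in that coordinate by different
  powers of \<open>2\<close>, so a suitable combination of \<open>f\<close> and the doubled \<open>f\<close> has fewer monomials.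
\<close>

lemma mp_eval_nonzero_at_positive:
  fixes f :: "('v, complex) mpoly"
  assumes "f \<noteq> 0"
  shows "\<exists>z :: 'v \<Rightarrow> real. (\<forall>v. z v > 0) \<and> mp_eval (\<lambda>v. of_real (z v)) f \<noteq> 0"
  using assms
proof (induction "card (Poly_Mapping.keys f)" arbitrary: f rule: less_induct)
  case less
  then obtain m where m: "m \<in> Poly_Mapping.keys f"
    by (metis lookup_zero not_in_keys_iff_lookup_eq_zero poly_mapping_eqI)
  show ?case
  proof (cases "Poly_Mapping.keys f = {m}")
    case True
    then have "mp_eval (\<lambda>v. of_real 1) f \<noteq> 0"
      by (auto simp: mp_eval_def in_keys_iff)
    then show ?thesis by (intro exI[of _ "\<lambda>_. 1"]) auto
  next
    case False
    then obtain m' where m': "m' \<in> Poly_Mapping.keys f" "m' \<noteq> m" using m by auto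
    then obtain v where v: "Poly_Mapping.lookup m' v \<noteq> Poly_Mapping.lookup m v"
      by (meson poly_mapping_eqI)
    define c where "c k = (2 :: complex) ^ Poly_Mapping.lookup k v - 2 ^ Poly_Mapping.lookup m v"
      for k :: "'v \<Rightarrow>\<^sub>0 nat"
    \<comment> \<open>\<open>g\<close> stands for f with coordinate v doubled, minus
      \<open>2 ^ lookup m v\<close> times f. The monomial m cancels, while m' survives because its
      factor \<open>c m'\<close> is nonzero.\<close>
    define g where "g = (\<Sum>k\<in>Poly_Mapping.keys f - {m}. Poly_Mapping.single k (Poly_Mapping.lookup f k * c k))"
    have lg: "Poly_Mapping.lookup g k = (if k \<in> Poly_Mapping.keys f - {m} then Poly_Mapping.lookup f k * c k else 0)" for k
      by (auto simp: g_def lookup_sum lookup_single when_def cong: if_cong)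
    have kg: "Poly_Mapping.keys g \<subseteq> Poly_Mapping.keys f - {m}"
      by (auto simp: in_keys_iff lg)
    then have "card (Poly_Mapping.keys g) < card (Poly_Mapping.keys f)"
      using m by (intro psubset_card_mono) auto
    moreover have "c m' \<noteq> 0"
    proof
      assume "c m' = 0"
      then have "norm ((2 :: complex) ^ Poly_Mapping.lookup m' v) = norm ((2 :: complex) ^ Poly_Mapping.lookup m v)"
        by (simp add: c_def)
      then show False using v by (simp add: norm_power)
    qed
    then have "Poly_Mapping.lookup g m' \<noteq> 0" using m' by (auto simp: lg in_keys_iff)
    then have "g \<noteq> 0" by auto
    ultimately obtain z :: "'v \<Rightarrow> real" where z: "\<And>v. z v > 0" "mp_eval (\<lambda>v. of_real (z v)) g \<noteq> 0"
      using less.hyps by blast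
    let ?z = "\<lambda>w. complex_of_real (z w)" and ?z2 = "\<lambda>w. complex_of_real ((z(v := 2 * z v)) w)"
    have mono: "(\<Prod>w\<in>Poly_Mapping.keys k. ?z2 w ^ Poly_Mapping.lookup k w) =
        2 ^ Poly_Mapping.lookup k v * (\<Prod>w\<in>Poly_Mapping.keys k. ?z w ^ Poly_Mapping.lookup k w)" for k
    proof -
      have "(\<Prod>w\<in>Poly_Mapping.keys k. ?z2 w ^ Poly_Mapping.lookup k w) =
        (\<Prod>w\<in>Poly_Mapping.keys k. (if w = v then 2 ^ Poly_Mapping.lookup k v else 1) * ?z w ^ Poly_Mapping.lookup k w)"
        by (intro prod.cong) (auto simp: power_mult_distrib)
      also have "\<dots> = 2 ^ Poly_Mapping.lookup k v * (\<Prod>w\<in>Poly_Mapping.keys k. ?z w ^ Poly_Mapping.lookup k w)"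
        by (subst prod.distrib) (auto simp: in_keys_iff)
      finally show ?thesis .
    qed
    have "mp_eval ?z g = (\<Sum>k\<in>Poly_Mapping.keys f - {m}. Poly_Mapping.lookup f k * c k *
        (\<Prod>w\<in>Poly_Mapping.keys k. ?z w ^ Poly_Mapping.lookup k w))"
      by (subst mp_eval_eq_sum[OF _ kg]) (auto simp: lg)
    also have "\<dots> = (\<Sum>k\<in>Poly_Mapping.keys f. Poly_Mapping.lookup f k * c k *
        (\<Prod>w\<in>Poly_Mapping.keys k. ?z w ^ Poly_Mapping.lookup k w))"
      by (intro sum.mono_neutral_left) (auto simp: c_def)
    also have "\<dots> = mp_eval ?z2 f - 2 ^ Poly_Mapping.lookup m v * mp_eval ?z f"
      unfolding mp_eval_def mono by (simp add: c_def algebra_simps sum_subtractf sum_distrib_left)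
    finally have "mp_eval ?z2 f \<noteq> 0 \<or> mp_eval ?z f \<noteq> 0" using z(2) by auto
    then show ?thesis
    proof
      assume "mp_eval ?z2 f \<noteq> 0"
      then show ?thesis using z(1) by (intro exI[of _ "z(v := 2 * z v)"]) auto
    qed (use z(1) in auto)
  qed
qed

text \<open>The coordinates of the common point are chosen one after the other.\<close>

lemma common_nonzero_point:
  fixes F :: "(('v \<Rightarrow> complex) \<Rightarrow> complex) set"
  assumes "countable F" "finite X"
    and line: "\<And>f z v. f \<in> F \<Longrightarrow> \<exists>Q. \<forall>t. f (z(v := t)) = poly Q t"
    and nz: "\<And>f. f \<in> F \<Longrightarrow> \<exists>z. (\<forall>v. v \<notin> X \<longrightarrow> z v = z0 v) \<and> f z \<noteq> 0"
  shows "\<exists>z. (\<forall>v. v \<notin> X \<longrightarrow> z v = z0 v) \<and> (\<forall>f\<in>F. f z \<noteq> 0)"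
  using assms(2) nz
proof (induction X arbitrary: z0 rule: finite_induct)
  case empty
  then have "f z0 \<noteq> 0" if "f \<in> F" for f using empty(1)[OF that] by (metis empty_iff ext)
  then show ?case by blast
next
  case (insert x X)
  obtain Z where Z: "\<And>f. f \<in> F \<Longrightarrow> (\<forall>v. v \<notin> insert x X \<longrightarrow> Z f v = z0 v) \<and> f (Z f) \<noteq> 0"
    using insert.prems by metis
  \<comment> \<open>Each f has its own witness \<open>Z f\<close>. On the line through it in
    direction x, f is a nonzero univariate polynomial, so only finitely many t are bad for f and
    some t is good for all f at once.\<close>
  have "countable {t. f ((Z f)(x := t)) = 0}" if f: "f \<in> F" for f
  proof -
    obtain Q where Q: "\<And>t. f ((Z f)(x := t)) = poly Q t"
      using line[OF f, of "Z f" x] by auto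
    have "poly Q (Z f x) \<noteq> 0" using Z[OF f] Q[of "Z f x"] by simp
    then have "Q \<noteq> 0" by auto
    then have "finite {t. poly Q t = 0}" by (rule poly_roots_finite)
    then show ?thesis by (simp add: Q countable_finite)
  qed
  then have "countable (\<Union>f\<in>F. {t. f ((Z f)(x := t)) = 0})" using assms(1) by blast
  then have "(\<Union>f\<in>F. {t. f ((Z f)(x := t)) = 0}) \<noteq> UNIV"
    using uncountable_UNIV_complex by force
  then obtain t where t: "\<And>f. f \<in> F \<Longrightarrow> f ((Z f)(x := t)) \<noteq> 0" by blast
  have "\<exists>z. (\<forall>v. v \<notin> X \<longrightarrow> z v = (z0(x := t)) v) \<and> f z \<noteq> 0" if "f \<in> F" for f
    using t[OF that] Z[OF that] by (intro exI[of _ "(Z f)(x := t)"]) auto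
  from insert.IH[OF this] obtain z where "\<forall>v. v \<notin> X \<longrightarrow> z v = (z0(x := t)) v" "\<forall>f\<in>F. f z \<noteq> 0"
    by blast
  then show ?case using insert.hyps by (intro exI[of _ z]) auto
qed

section \<open>Evaluation of rational functions\<close>

lemma rf_value_unique:
  assumes "rf_value X h \<mu> w" "rf_value X h \<mu> w'"
  shows "w = w'"
proof -
  obtain p q where pq: "q \<noteq> 0" "h = Fract p q" "mp_eval \<mu> q \<noteq> 0" "w = mp_eval \<mu> p / mp_eval \<mu> q"
    using assms(1) by (auto simp: rf_value_def)
  obtain p' q' where pq': "q' \<noteq> 0" "h = Fract p' q'" "mp_eval \<mu> q' \<noteq> 0" "w' = mp_eval \<mu> p' / mp_eval \<mu> q'"
    using assms(2) by (auto simp: rf_value_def)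
  have "p * q' = p' * q" using pq pq' by (simp add: eq_fract)
  then have "mp_eval \<mu> p * mp_eval \<mu> q' = mp_eval \<mu> p' * mp_eval \<mu> q"
    by (simp flip: mp_eval_mult)
  then show ?thesis using pq(3,4) pq'(3,4) by (simp add: frac_eq_eq)
qed

lemma rf_eval_eqI: "rf_value X h \<mu> w \<Longrightarrow> rf_eval X h \<mu> = w"
  unfolding rf_eval_def using rf_value_unique by blast

lemma rf_value_rf_eval: "rf_defined X h \<mu> \<Longrightarrow> rf_value X h \<mu> (rf_eval X h \<mu>)"
  by (metis rf_defined_def rf_eval_eqI)

lemma rf_value_FractI:
  assumes "mp_vars p \<subseteq> X" "mp_vars q \<subseteq> X" "mp_eval \<mu> q \<noteq> 0"
  shows "rf_value X (Fract p q) \<mu> (mp_eval \<mu> p / mp_eval \<mu> q)"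
  using assms unfolding rf_value_def by (metis mp_eval_0)

lemma ring_rel_rf_value: "ring_rel (\<lambda>h w. rf_value X h \<mu> w)"
proof
  show "rf_value X 0 \<mu> 0"
    using rf_value_FractI[of 0 X 1 \<mu>] by (simp add: fract_collapse)
  show "rf_value X 1 \<mu> 1"
    using rf_value_FractI[of 1 X 1 \<mu>] by (simp add: One_fract_def)
next
  fix a b c d assume "rf_value X a \<mu> b" "rf_value X c \<mu> d"
  then obtain p q p' q' where
    pq: "mp_vars p \<subseteq> X" "mp_vars q \<subseteq> X" "q \<noteq> 0" "a = Fract p q" "mp_eval \<mu> q \<noteq> 0"
        "b = mp_eval \<mu> p / mp_eval \<mu> q" and
    pq': "mp_vars p' \<subseteq> X" "mp_vars q' \<subseteq> X" "q' \<noteq> 0" "c = Fract p' q'" "mp_eval \<mu> q' \<noteq> 0"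
        "d = mp_eval \<mu> p' / mp_eval \<mu> q'"
    unfolding rf_value_def by blast
  interpret V: ring_rel "\<lambda>f g. mp_vars (f :: (nat, complex) mpoly) \<subseteq> X \<and> f = g"
    by (rule ring_rel_mp_vars)
  have v: "mp_vars (q * q') \<subseteq> X" "mp_vars (p * q' + p' * q) \<subseteq> X" "mp_vars (p * p') \<subseteq> X"
    using V.mult[of q q q' q'] V.mult[of p p p' p'] V.add[OF V.mult[of p p q' q'] V.mult[of p' p' q q]]
      pq pq' by blast+
  show "rf_value X (a + c) \<mu> (b + d)"
    using rf_value_FractI[OF v(2,1), of \<mu>] pq pq' by (simp add: add_frac_eq)
  show "rf_value X (a * c) \<mu> (b * d)"
    using rf_value_FractI[OF v(3,1), of \<mu>] pq pq' by simp
next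
  fix a b assume "rf_value X a \<mu> b"
  then obtain p q where
    pq: "mp_vars p \<subseteq> X" "mp_vars q \<subseteq> X" "q \<noteq> 0" "a = Fract p q" "mp_eval \<mu> q \<noteq> 0"
        "b = mp_eval \<mu> p / mp_eval \<mu> q" unfolding rf_value_def by blast
  then show "rf_value X (- a) \<mu> (- b)" using rf_value_FractI[of "- p" X q \<mu>] by simp
qed

interpretation rfv: ring_rel "\<lambda>h w. rf_value X h \<mu> w" for X \<mu>
  by (rule ring_rel_rf_value)

interpretation rfvp: ring_rel "poly_rel (\<lambda>h w. rf_value X h \<mu> w)" for X \<mu>
  by (rule rfv.ring_rel_poly)

lemma rf_value_const: "rf_value X (rf_const c) \<mu> c"
  using rf_value_FractI[of "mp_const c" X 1 \<mu>] by (simp add: rf_const_def)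

lemma rf_value_var: "v \<in> X \<Longrightarrow> rf_value X (rf_var v) \<mu> (\<mu> v)"
  using rf_value_FractI[of "mp_var v" X 1 \<mu>] by (simp add: rf_var_def)

lemma rf_eval_0 [simp]: "rf_eval X 0 \<mu> = 0"
  by (rule rf_eval_eqI) (rule rfv.zero)

text \<open>Subfields as plain subsets of a type, closed under the total inverse with
  \<open>inverse 0 = 0\<close>. This keeps the record-based algebra of
  \<open>generated_field\<close> out of the arguments.\<close>

definition field_closed :: "'a :: field set \<Rightarrow> bool" where
  "field_closed K \<longleftrightarrow> 1 \<in> K \<and> (\<forall>a\<in>K. - a \<in> K \<and> inverse a \<in> K \<and> (\<forall>b\<in>K. a + b \<in> K \<and> a * b \<in> K))"

lemma field_closed_zero: "field_closed K \<Longrightarrow> 0 \<in> K"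
  unfolding field_closed_def by (metis add.right_inverse)

lemma rational_functionsE:
  assumes "h \<in> rational_functions X"
  obtains p q where "mp_vars p \<subseteq> X" "mp_vars q \<subseteq> X" "q \<noteq> 0" "h = Fract p q"
  using assms unfolding rational_functions_def by blast

lemma field_closed_rational_functions: "field_closed (rational_functions X)"
proof -
  interpret V: ring_rel "\<lambda>f g. mp_vars (f :: (nat, complex) mpoly) \<subseteq> X \<and> f = g"
    by (rule ring_rel_mp_vars)
  have I: "Fract p q \<in> rational_functions X" if "mp_vars p \<subseteq> X" "mp_vars q \<subseteq> X" "q \<noteq> 0" for p q
    using that unfolding rational_functions_def by blast
  show ?thesis unfolding field_closed_def
  proof (intro conjI ballI)
    show "1 \<in> rational_functions X" using I[of 1 1] by (simp add: One_fract_def)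
    fix a assume "a \<in> rational_functions X"
    then obtain p q where pq: "mp_vars p \<subseteq> X" "mp_vars q \<subseteq> X" "q \<noteq> 0" "a = Fract p q"
      by (rule rational_functionsE)
    show "- a \<in> rational_functions X" using I[of "- p" q] pq by simp
    show "inverse a \<in> rational_functions X"
    proof (cases "p = 0")
      case True
      then have "inverse a = Fract 0 1" using pq by (simp add: fract_collapse)
      then show ?thesis using I[of 0 1] by simp
    next
      case False
      then show ?thesis using I[of q p] pq by simp
    qed
    fix b assume "b \<in> rational_functions X"
    then obtain p' q' where pq': "mp_vars p' \<subseteq> X" "mp_vars q' \<subseteq> X" "q' \<noteq> 0" "b = Fract p' q'"
      by (rule rational_functionsE)
    have v: "mp_vars (q * q') \<subseteq> X" "mp_vars (p * q' + p' * q) \<subseteq> X" "mp_vars (p * p') \<subseteq> X"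
      using V.mult[of q q q' q'] V.mult[of p p p' p'] V.add[OF V.mult[of p p q' q'] V.mult[of p' p' q q]]
        pq pq' by blast+
    show "a + b \<in> rational_functions X" using I[OF v(2,1)] pq pq' by simp
    show "a * b \<in> rational_functions X" using I[OF v(3,1)] pq pq' by simp
  qed
qed

lemma rf_defined_rational_function:
  assumes "rf_defined X h \<mu>" shows "h \<in> rational_functions X"
  using assms unfolding rf_defined_def rf_value_def rational_functions_def by blast

text \<open>P is the numerator of one chosen fraction. The value w may come from another fraction
  p'/q', but cross multiplication forces p' to be nonzero wherever P and q' are.\<close>

lemma rf_nonzero_numerator:
  assumes "h \<in> rational_functions X" "h \<noteq> 0"
  shows "\<exists>P. P \<noteq> 0 \<and> mp_vars P \<subseteq> X \<and> (\<forall>\<mu> w. mp_eval \<mu> P \<noteq> 0 \<longrightarrow> rf_value X h \<mu> w \<longrightarrow> w \<noteq> 0)"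
proof -
  obtain p q where pq: "mp_vars p \<subseteq> X" "mp_vars q \<subseteq> X" "q \<noteq> 0" "h = Fract p q"
    using assms(1) by (rule rational_functionsE)
  have "p \<noteq> 0" using pq assms(2) by (auto simp: fract_collapse)
  moreover have "w \<noteq> 0" if P: "mp_eval \<mu> p \<noteq> 0" and w: "rf_value X h \<mu> w" for \<mu> w
  proof -
    obtain p' q' where pq': "q' \<noteq> 0" "h = Fract p' q'" "mp_eval \<mu> q' \<noteq> 0" "w = mp_eval \<mu> p' / mp_eval \<mu> q'"
      using w by (auto simp: rf_value_def)
    have "p * q' = p' * q" using pq pq' by (simp add: eq_fract)
    then have "mp_eval \<mu> p * mp_eval \<mu> q' = mp_eval \<mu> p' * mp_eval \<mu> q"
      by (simp flip: mp_eval_mult)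
    then show ?thesis using P pq' by auto
  qed
  ultimately show ?thesis using pq(1) by blast
qed

lemma rf_nonzero_numerators:
  assumes "finite D" "D \<subseteq> rational_functions X - {0}"
  shows "\<exists>P. P \<noteq> 0 \<and> mp_vars P \<subseteq> X \<and>
     (\<forall>h\<in>D. \<forall>\<mu> w. mp_eval \<mu> P \<noteq> 0 \<longrightarrow> rf_value X h \<mu> w \<longrightarrow> w \<noteq> 0)"
  using assms
proof (induction D rule: finite_induct)
  case empty
  then show ?case by (intro exI[of _ 1]) auto
next
  case (insert h D)
  then obtain P where P: "P \<noteq> 0" "mp_vars P \<subseteq> X"
     "\<forall>h\<in>D. \<forall>\<mu> w. mp_eval \<mu> P \<noteq> 0 \<longrightarrow> rf_value X h \<mu> w \<longrightarrow> w \<noteq> 0" by auto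
  from insert obtain Q where Q: "Q \<noteq> 0" "mp_vars Q \<subseteq> X"
     "\<forall>\<mu> w. mp_eval \<mu> Q \<noteq> 0 \<longrightarrow> rf_value X h \<mu> w \<longrightarrow> w \<noteq> 0"
    using rf_nonzero_numerator[of h X] by auto
  show ?case
  proof (intro exI[of _ "P * Q"] conjI ballI allI impI)
    show "mp_vars (P * Q) \<subseteq> X" using mp_vars_mult_subset[of P Q] P(2) Q(2) by blast
    show "w \<noteq> 0" if "g \<in> insert h D" "mp_eval \<mu> (P * Q) \<noteq> 0" "rf_value X g \<mu> w" for g \<mu> w
      using that P(3) Q(3) by auto
  qed (use P Q in auto)
qed

section \<open>Generated subfields\<close>

lemma class_ring_inv:
  fixes h :: "'a :: field"
  assumes "h \<noteq> 0" shows "inv\<^bsub>class_ring\<^esub> h = inverse h"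
proof -
  have "(THE y. h * y = 1 \<and> y * h = 1) = inverse h"
    using assms by (intro the_equality) (auto simp: field_simps)
  then show ?thesis by (simp add: m_inv_def class_ring_simps)
qed

lemma class_ring_minus: "\<ominus>\<^bsub>class_ring\<^esub> (h :: 'a :: field) = - h"
proof -
  have "(THE y. h + y = 0 \<and> y + h = 0) = - h"
    by (intro the_equality) (auto simp: eq_neg_iff_add_eq_0)
  then show ?thesis by (simp add: a_inv_def m_inv_def class_ring_simps)
qed

lemma field_closed_generated_field: "field_closed (generated_field S)"
proof -
  let ?G = "generate_field class_ring (range rf_const \<union> S)"
  have "1 \<in> ?G" using generate_field.one[of class_ring "range rf_const \<union> S"] by (simp add: class_ring_simps)
  moreover have minus: "- a \<in> ?G" if "a \<in> ?G" for a
    using generate_field.a_inv[OF that] by (simp add: class_ring_minus)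
  moreover have add: "a + b \<in> ?G" if "a \<in> ?G" "b \<in> ?G" for a b
    using generate_field.eng_add[OF that] by (simp add: class_ring_simps)
  moreover have "a * b \<in> ?G" if "a \<in> ?G" "b \<in> ?G" for a b
    using generate_field.eng_mult[OF that] by (simp add: class_ring_simps)
  moreover have "inverse a \<in> ?G" if "a \<in> ?G" for a
  proof (cases "a = 0")
    case False
    then show ?thesis using generate_field.m_inv[OF that] by (simp add: class_ring_simps class_ring_inv)
  qed (use that in simp)
  ultimately show ?thesis unfolding field_closed_def generated_field_def by (intro conjI ballI)
qed

lemma generated_field_gen: "h \<in> S \<Longrightarrow> h \<in> generated_field S"
  unfolding generated_field_def by (intro generate_field.incl) auto

lemma generated_field_const: "rf_const c \<in> generated_field S"
  unfolding generated_field_def by (intro generate_field.incl) auto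

lemma generated_field_minimal:
  assumes T: "field_closed T" and "range rf_const \<subseteq> T" "S \<subseteq> T"
  shows "generated_field S \<subseteq> T"
proof
  fix h assume "h \<in> generated_field S"
  then have "h \<in> generate_field class_ring (range rf_const \<union> S)" by (simp add: generated_field_def)
  then show "h \<in> T"
    by (induction rule: generate_field.induct)
      (use assms in \<open>auto simp: class_ring_simps class_ring_inv class_ring_minus field_closed_def\<close>)
qed

section \<open>Extending partial isomorphisms of countable subfields of the complex numbers\<close>

text \<open>
  A partial isomorphism between subfields is represented by its graph, so that its extension to
  polynomials is the coefficientwise relation.
\<close>

locale field_corr = ring_rel R for R :: "'a :: field \<Rightarrow> 'b :: field \<Rightarrow> bool" +
  assumes inverse: "R a b \<Longrightarrow> R (inverse a) (inverse b)"
    and zero_iff: "R a b \<Longrightarrow> a = 0 \<longleftrightarrow> b = 0"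
begin

lemma divide: "R a b \<Longrightarrow> R c d \<Longrightarrow> R (a / c) (b / d)"
  unfolding divide_inverse by (intro mult inverse)

text \<open>Applied to differences, \<open>zero_iff\<close> makes the relation single-valued;
  through \<open>field_corr_conversep\<close> it is injective as well.\<close>

lemma functional: "R a b \<Longrightarrow> R a b' \<Longrightarrow> b = b'"
  using zero_iff[OF diff, of a b a b'] by simp

lemma field_corr_conversep: "field_corr R\<inverse>\<inverse>"
  by unfold_locales (auto intro: zero one add mult uminus inverse simp: zero_iff)

sublocale P: ring_rel "poly_rel R" by (rule ring_rel_poly)

lemma poly_rel_coeff_zero_iff:
  "poly_rel R f g \<Longrightarrow> Polynomial.coeff f k = 0 \<longleftrightarrow> Polynomial.coeff g k = 0"
  using zero_iff unfolding poly_rel_def by blast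

lemma poly_rel_degree: "poly_rel R f g \<Longrightarrow> degree f = degree g"
  unfolding Polynomial.degree_def using poly_rel_coeff_zero_iff by simp

lemma poly_rel_zero_iff: "poly_rel R f g \<Longrightarrow> f = 0 \<longleftrightarrow> g = 0"
  using poly_rel_coeff_zero_iff by (simp add: poly_eq_iff)

lemma poly_rel_const: "R a b \<Longrightarrow> poly_rel R [:a:] [:b:]"
  by (auto simp: poly_rel_def coeff_pCons zero split: nat.split)

lemma poly_rel_monom: "R a b \<Longrightarrow> poly_rel R (Polynomial.monom a n) (Polynomial.monom b n)"
  by (auto simp: poly_rel_def zero)

lemma poly_rel_X: "poly_rel R [:0, 1:] [:0, 1:]"
  by (auto simp: poly_rel_def coeff_pCons zero one split: nat.split)

text \<open>Long division carried out on both sides in parallel: each step uses only field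
  operations on coefficients, so quotients and remainders stay related.\<close>

lemma poly_rel_division:
  assumes f: "poly_rel R f f'" "f \<noteq> 0" and g: "poly_rel R g g'"
  shows "\<exists>q q' r r'. poly_rel R q q' \<and> poly_rel R r r' \<and> g = q * f + r \<and> g' = q' * f' + r' \<and>
           (r = 0 \<or> degree r < degree f)"
  using g
proof (induction "degree g" arbitrary: g g' rule: less_induct)
  case less
  show ?case
  proof (cases "g = 0 \<or> degree g < degree f")
    case True
    then show ?thesis using less.prems
      by (intro exI[of _ 0] exI[of _ 0] exI[of _ g] exI[of _ g']) (auto intro: P.zero)
  next
    case False
    then have g0: "g \<noteq> 0" and deg: "degree f \<le> degree g" by auto
    define c where "c = lead_coeff g / lead_coeff f"
    define c' where "c' = lead_coeff g' / lead_coeff f'"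
    define k where "k = degree g - degree f"
    define m where "m = Polynomial.monom c k"
    define m' where "m' = Polynomial.monom c' k"
    have c: "R c c'"
      unfolding c_def c'_def using f g less.prems poly_rel_degree unfolding poly_rel_def
      by (metis divide)
    then have m: "poly_rel R m m'" unfolding m_def m'_def by (rule poly_rel_monom)
    define h where "h = g - m * f"
    define h' where "h' = g' - m' * f'"
    have h: "poly_rel R h h'"
      unfolding h_def h'_def by (intro P.diff P.mult less.prems m f)
    have c0: "c \<noteq> 0" using g0 f(2) by (simp add: c_def)
    have dm: "degree (m * f) = degree g"
      using c0 f(2) deg by (simp add: m_def k_def degree_mult_eq degree_monom_eq)
    have lm: "Polynomial.coeff (m * f) (degree g) = lead_coeff g"
      using lead_coeff_mult[of m f] c0 f(2) unfolding dm by (simp add: m_def c_def lead_coeff_monom degree_monom_eq)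
    have "h = 0 \<or> degree h < degree g"
    proof (cases "h = 0")
      case False
      have "degree h \<le> degree g" unfolding h_def using dm by (simp add: degree_diff_le)
      moreover have "Polynomial.coeff h (degree g) = 0" by (simp add: h_def lm)
      ultimately show ?thesis using False leading_coeff_0_iff[of h] le_neq_implies_less by metis
    qed auto
    then obtain q q' r r' where q: "poly_rel R q q'" "poly_rel R r r'" "h = q * f + r" "h' = q' * f' + r'"
        "r = 0 \<or> degree r < degree f"
    proof
      assume "h = 0"
      then have "h' = 0" using poly_rel_zero_iff[OF h] by simp
      then show ?thesis using that[of 0 0 0 0] \<open>h = 0\<close> P.zero by simp
    next
      assume "degree h < degree g"
      from less.hyps[OF this h] show ?thesis using that by blast
    qed
    have "g = (q + m) * f + r" "g' = (q' + m') * f' + r'"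
      using q(3,4) unfolding h_def h'_def by (simp_all add: algebra_simps)
    then show ?thesis using q P.add[OF q(1) m] by blast
  qed
qed

text \<open>The extension of R to the field generated by a, sending a to b. Only the denominator at
  a is required to be nonzero; under \<open>same_type\<close> the one at b follows.\<close>

definition adjoin :: "'a \<Rightarrow> 'b \<Rightarrow> 'a \<Rightarrow> 'b \<Rightarrow> bool" where
  "adjoin a b x y \<longleftrightarrow> (\<exists>f f' g g'. poly_rel R f f' \<and> poly_rel R g g' \<and> poly g a \<noteq> 0 \<and>
     x = poly f a / poly g a \<and> y = poly f' b / poly g' b)"

text \<open>Exactly what makes \<open>adjoin\<close> well defined and injective: a and b satisfy
  corresponding polynomial equations over the two fields.\<close>

definition same_type :: "'a \<Rightarrow> 'b \<Rightarrow> bool" where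
  "same_type a b \<longleftrightarrow> (\<forall>f f'. poly_rel R f f' \<longrightarrow> (poly f a = 0 \<longleftrightarrow> poly f' b = 0))"

lemma adjoinI:
  "poly_rel R f f' \<Longrightarrow> poly_rel R g g' \<Longrightarrow> poly g a \<noteq> 0 \<Longrightarrow>
   x = poly f a / poly g a \<Longrightarrow> y = poly f' b / poly g' b \<Longrightarrow> adjoin a b x y"
  unfolding adjoin_def by blast

lemma adjoin_extends: "R x y \<Longrightarrow> adjoin a b x y"
  by (rule adjoinI[OF poly_rel_const P.one]) auto

lemma adjoin_new: "adjoin a b a b"
  by (rule adjoinI[OF poly_rel_X P.one]) auto

lemma field_corr_adjoin:
  assumes "same_type a b" shows "field_corr (adjoin a b)"
proof -
  have st: "poly f a = 0 \<longleftrightarrow> poly f' b = 0" if "poly_rel R f f'" for f f'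
    using assms that unfolding same_type_def by blast
  show ?thesis
  proof
    show "adjoin a b 0 0" "adjoin a b 1 1" by (intro adjoin_extends zero one)+
    fix x y z w assume "adjoin a b x y" "adjoin a b z w"
    then obtain f f' g g' h h' k k' where *: "poly_rel R f f'" "poly_rel R g g'" "poly g a \<noteq> 0"
       "x = poly f a / poly g a" "y = poly f' b / poly g' b"
       "poly_rel R h h'" "poly_rel R k k'" "poly k a \<noteq> 0"
       "z = poly h a / poly k a" "w = poly h' b / poly k' b"
      unfolding adjoin_def by blast
    have nz: "poly g' b \<noteq> 0" "poly k' b \<noteq> 0" using st[OF *(2)] st[OF *(7)] *(3,8) by auto
    show "adjoin a b (x + z) (y + w)"
      by (rule adjoinI[OF P.add[OF P.mult[OF *(1,7)] P.mult[OF *(6,2)]] P.mult[OF *(2,7)]])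
        (use * nz in \<open>auto simp: add_frac_eq\<close>)
    show "adjoin a b (x * z) (y * w)"
      by (rule adjoinI[OF P.mult[OF *(1,6)] P.mult[OF *(2,7)]]) (use * nz in auto)
  next
    fix x y assume "adjoin a b x y"
    then obtain f f' g g' where *: "poly_rel R f f'" "poly_rel R g g'" "poly g a \<noteq> 0"
       "x = poly f a / poly g a" "y = poly f' b / poly g' b"
      unfolding adjoin_def by blast
    have nz: "poly g' b \<noteq> 0" using st[OF *(2)] *(3) by auto
    show "adjoin a b (- x) (- y)"
      by (rule adjoinI[OF P.uminus[OF *(1)] *(2)]) (use * in auto)
    show z: "x = 0 \<longleftrightarrow> y = 0" using * nz st[OF *(1)] by simp
    show "adjoin a b (inverse x) (inverse y)"
    proof (cases "x = 0")
      case True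
      then show ?thesis using z by (auto intro: adjoin_extends zero)
    next
      case False
      then show ?thesis by (intro adjoinI[OF *(2,1)]) (use * in auto)
    qed
  qed
qed

lemma countable_poly_rel:
  assumes "countable {(x, y). R x y}"
  shows "countable {(f, f'). poly_rel R f f'}"
proof -
  let ?L = "lists {(x, y). R x y}"
  have "{(f, f'). poly_rel R f f'} \<subseteq> (\<lambda>l. (Poly (map fst l), Poly (map snd l))) ` ?L"
  proof clarify
    fix f f' assume ff: "poly_rel R f f'"
    let ?l = "map (\<lambda>k. (Polynomial.coeff f k, Polynomial.coeff f' k)) [0..<Suc (degree f)]"
    have "h = Poly (map (Polynomial.coeff h) [0..<Suc (degree h)])" for h :: "'c :: zero poly"
      by (rule poly_eqI) (auto simp: coeff_Poly_eq nth_default_def coeff_eq_0 simp del: upt_Suc)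
    from this[of f] this[of f'] have "(f, f') = (Poly (map fst ?l), Poly (map snd ?l))"
      using poly_rel_degree[OF ff] by (simp add: comp_def del: upt_Suc)
    moreover have "?l \<in> ?L" using ff by (auto simp: poly_rel_def)
    ultimately show "(f, f') \<in> (\<lambda>l. (Poly (map fst l), Poly (map snd l))) ` ?L" by (rule image_eqI)
  qed
  then show ?thesis by (rule countable_subset) (intro countable_image countable_lists assms)
qed

lemma countable_adjoin:
  assumes "countable {(x, y). R x y}"
  shows "countable {(x, y). adjoin a b x y}"
proof -
  let ?S = "{(f, f'). poly_rel R f f'}"
  have "{(x, y). adjoin a b x y} \<subseteq>
     (\<lambda>((f, f'), (g, g')). (poly f a / poly g a, poly f' b / poly g' b)) ` (?S \<times> ?S)"
  proof clarify
    fix x y assume "adjoin a b x y"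
    then obtain f f' g g' where *: "poly_rel R f f'" "poly_rel R g g'"
       "x = poly f a / poly g a" "y = poly f' b / poly g' b"
      unfolding adjoin_def by blast
    show "(x, y) \<in> (\<lambda>((f, f'), (g, g')). (poly f a / poly g a, poly f' b / poly g' b)) ` (?S \<times> ?S)"
      by (rule image_eqI[where x = "((f, f'), (g, g'))"]) (use * in auto)
  qed
  then show ?thesis
    by (rule countable_subset) (intro countable_image countable_SIGMA countable_poly_rel assms)
qed

text \<open>The minimal polynomial of a over the domain of R, up to a scalar, together with its
  image f'.\<close>

definition minimal_annihilator :: "'a \<Rightarrow> 'a poly \<Rightarrow> 'b poly \<Rightarrow> bool" where
  "minimal_annihilator a f f' \<longleftrightarrow> poly_rel R f f' \<and> f \<noteq> 0 \<and> poly f a = 0 \<and>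
     (\<forall>g g'. poly_rel R g g' \<longrightarrow> g \<noteq> 0 \<longrightarrow> poly g a = 0 \<longrightarrow> degree f \<le> degree g)"

lemma minimal_annihilator_exists:
  assumes "poly_rel R f f'" "f \<noteq> 0" "poly f a = 0"
  shows "\<exists>f f'. minimal_annihilator a f f'"
proof -
  let ?Q = "\<lambda>p. poly_rel R (fst p) (snd p) \<and> fst p \<noteq> 0 \<and> poly (fst p) a = 0"
  have "?Q (f, f')" using assms by simp
  from arg_min_nat_lemma[of ?Q, OF this, of "\<lambda>p. degree (fst p)"]
  show ?thesis unfolding minimal_annihilator_def
    by (metis (no_types, lifting) fst_conv snd_conv)
qed

text \<open>Division by f carries equations of a over to b. Conversely, let r' be minimal for b and
  r its counterpart; r divides every polynomial whose image vanishes at b, in particular f. If r did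
  not vanish at a, the cofactor f/r would, so by minimality r would be constant and r' could not
  have the root b. Hence r vanishes at a, and so do all its multiples.\<close>

lemma same_type_root:
  assumes f: "minimal_annihilator a f f'" and b: "poly f' b = 0"
  shows "same_type a b"
proof -
  have fR: "poly_rel R f f'" "f \<noteq> 0" "poly f a = 0"
    and fmin: "\<And>g g'. poly_rel R g g' \<Longrightarrow> g \<noteq> 0 \<Longrightarrow> poly g a = 0 \<Longrightarrow> degree f \<le> degree g"
    using f unfolding minimal_annihilator_def by blast+
  have fwd: "poly g' b = 0" if g: "poly_rel R g g'" "poly g a = 0" for g g'
  proof -
    obtain q q' r r' where q: "poly_rel R q q'" "poly_rel R r r'" "g = q * f + r" "g' = q' * f' + r'"
        "r = 0 \<or> degree r < degree f"
      using poly_rel_division[OF fR(1,2) g(1)] by blast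
    have "poly r a = 0" using q(3) g(2) fR(3) by simp
    then have "r = 0" using q(5) fmin[OF q(2)] by force
    then have "r' = 0" using poly_rel_zero_iff[OF q(2)] by simp
    then show ?thesis using q(4) b by simp
  qed
  interpret C: field_corr "R\<inverse>\<inverse>" by (rule field_corr_conversep)
  have conv: "poly_rel R\<inverse>\<inverse> g' g \<longleftrightarrow> poly_rel R g g'" for g g' by (simp add: poly_rel_def)
  have f'0: "f' \<noteq> 0" using poly_rel_zero_iff[OF fR(1)] fR(2) by simp
  then obtain r' r where r: "C.minimal_annihilator b r' r"
    using C.minimal_annihilator_exists[of f' f b] b fR(1) conv by blast
  then have rR: "poly_rel R r r'" "r' \<noteq> 0" "poly r' b = 0"
    and rmin: "\<And>g g'. poly_rel R g g' \<Longrightarrow> g' \<noteq> 0 \<Longrightarrow> poly g' b = 0 \<Longrightarrow> degree r' \<le> degree g'"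
    unfolding C.minimal_annihilator_def conv by blast+
  have r0: "r \<noteq> 0" using poly_rel_zero_iff[OF rR(1)] rR(2) by simp
  have divr: "\<exists>q q'. poly_rel R q q' \<and> g = q * r \<and> g' = q' * r'" if g: "poly_rel R g g'" "poly g' b = 0" for g g'
  proof -
    obtain q q' s s' where q: "poly_rel R q q'" "poly_rel R s s'" "g = q * r + s" "g' = q' * r' + s'"
        "s = 0 \<or> degree s < degree r"
      using poly_rel_division[OF rR(1) r0 g(1)] by blast
    have "poly s' b = 0" using q(4) g(2) rR(3) by simp
    then have "s' = 0" using q(5) rmin[OF q(2)] poly_rel_degree[OF rR(1)] poly_rel_degree[OF q(2)]
        poly_rel_zero_iff[OF q(2)] by force
    then have "s = 0" using poly_rel_zero_iff[OF q(2)] by simp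
    then show ?thesis using q \<open>s' = 0\<close> by auto
  qed
  have ra: "poly r a = 0"
  proof (rule ccontr)
    assume ra: "poly r a \<noteq> 0"
    obtain q q' where q: "poly_rel R q q'" "f = q * r" using divr[OF fR(1) b] by blast
    then have "q \<noteq> 0" "poly q a = 0" using fR ra by auto
    then have "degree f \<le> degree q" using fmin[OF q(1)] by simp
    moreover have "degree f = degree q + degree r"
      using q(2) \<open>q \<noteq> 0\<close> r0 by (simp add: degree_mult_eq)
    ultimately have "degree r' = 0" using poly_rel_degree[OF rR(1)] by simp
    then show False using rR(2,3) degree_0_id[of r'] by (metis degree_eq_zeroE pCons_0_0 poly_0 poly_pCons mult_zero_right add.right_neutral)
  qed
  have "poly g a = 0" if "poly_rel R g g'" "poly g' b = 0" for g g'
    using divr[OF that] ra by auto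
  then show ?thesis using fwd unfolding same_type_def by blast
qed

end

lemma (in field_corr) degree_minimal_annihilator:
  assumes "minimal_annihilator a f f'" shows "degree f > 0"
proof (rule ccontr)
  assume "\<not> ?thesis"
  then obtain c where "f = [:c:]" by (metis degree_eq_zeroE gr_zeroI)
  then show False using assms by (auto simp: minimal_annihilator_def)
qed

locale countable_corr = field_corr R for R :: "complex \<Rightarrow> complex \<Rightarrow> bool" +
  assumes countable: "countable {(x, y). R x y}"
begin

lemma countable_corr_adjoin: "same_type a b \<Longrightarrow> countable_corr (adjoin a b)"
  by (intro countable_corr.intro field_corr_adjoin countable_corr_axioms.intro countable_adjoin countable)

text \<open>Here a is transcendental over the domain, so every b transcendental over the countable
  range has the same type. All but countably many b qualify, which leaves room to avoid the
  prescribed e; with e = a this moves a.\<close>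

lemma same_type_transcendental:
  assumes "\<nexists>f f'. minimal_annihilator a f f'"
  shows "\<exists>b. b \<noteq> e \<and> same_type a b"
proof -
  let ?B = "insert e (\<Union>f'\<in>snd ` {(f, f'). poly_rel R f f'} - {0}. {b. poly f' b = 0})"
  have "countable (snd ` {(f, f'). poly_rel R f f'} - {0})"
    by (intro countable_Diff countable_image countable_poly_rel countable)
  then have "countable ?B"
    by (intro countable_insert countable_UN) (auto intro: countable_finite poly_roots_finite)
  then have "?B \<noteq> UNIV" using uncountable_UNIV_complex by metis
  then obtain b where b: "b \<notin> ?B" by blast
  have "poly f a = 0 \<longleftrightarrow> poly f' b = 0" if f: "poly_rel R f f'" for f f'
  proof (cases "f = 0")
    case True
    then show ?thesis using poly_rel_zero_iff[OF f] by simp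
  next
    case False
    then have "poly f a \<noteq> 0" using minimal_annihilator_exists[OF f] assms by blast
    moreover have "poly f' b \<noteq> 0" using b f False poly_rel_zero_iff[OF f] by force
    ultimately show ?thesis by simp
  qed
  then show ?thesis using b unfolding same_type_def by blast
qed

text \<open>The codomain offers enough elements: it contains a root of the transported minimal
  polynomial in the algebraic case, and elements transcendental over any countable subfield
  otherwise.\<close>

lemma extend_one: "\<exists>R' b. countable_corr R' \<and> (\<forall>x y. R x y \<longrightarrow> R' x y) \<and> R' a b"
proof -
  have "\<exists>b. same_type a b"
  proof (cases "\<exists>f f'. minimal_annihilator a f f'")
    case True
    then obtain f f' where f: "minimal_annihilator a f f'" by blast
    then have "degree f' \<noteq> 0"
      using degree_minimal_annihilator[OF f] poly_rel_degree[of f f'] by (simp add: minimal_annihilator_def)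
    then obtain b where "poly f' b = 0"
      using fundamental_theorem_of_algebra[of f'] by (auto simp: constant_degree)
    then show ?thesis using same_type_root[OF f] by blast
  qed (use same_type_transcendental in blast)
  then show ?thesis using countable_corr_adjoin adjoin_extends adjoin_new by blast
qed

end

lemma extend_finite:
  assumes "finite X" "countable_corr R"
  shows "\<exists>R' w. countable_corr R' \<and> (\<forall>x y. R x y \<longrightarrow> R' x y) \<and> (\<forall>v\<in>X. R' (z v) (w v))"
  using assms
proof (induction X arbitrary: R rule: finite_induct)
  case (insert v X)
  obtain R1 b where R1: "countable_corr R1" "\<forall>x y. R x y \<longrightarrow> R1 x y" "R1 (z v) b"
    using countable_corr.extend_one[OF insert.prems] by blast
  obtain R' w where R': "countable_corr R'" "\<forall>x y. R1 x y \<longrightarrow> R' x y" "\<forall>v\<in>X. R' (z v) (w v)"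
    using insert.IH[OF R1(1)] by blast
  show ?case
    by (rule exI[of _ R'], rule exI[of _ "w(v := b)"]) (use R1 R' insert.hyps in auto)
qed auto

lemma countable_corr_diagonal:
  assumes K: "field_closed K" "countable K"
  shows "countable_corr (\<lambda>x y. x \<in> K \<and> x = y)"
proof -
  have "{(x, y). x \<in> K \<and> x = y} = (\<lambda>x. (x, x)) ` K" by auto
  then have "countable {(x, y). x \<in> K \<and> x = y}" using K(2) by simp
  then show ?thesis
    by unfold_locales (use K(1) field_closed_zero[OF K(1)] in \<open>auto simp: field_closed_def\<close>)
qed

text \<open>
  In the algebraic case, the minimal polynomial is separable, so it has a second root unless it is
  linear.
\<close>

lemma extend_moving:
  assumes K: "field_closed K" "countable K" and a: "a \<notin> K"
  shows "\<exists>R b. countable_corr R \<and> (\<forall>x\<in>K. R x x) \<and> R a b \<and> b \<noteq> a"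
proof -
  let ?R = "\<lambda>x y. x \<in> K \<and> x = (y :: complex)"
  interpret D: countable_corr ?R by (rule countable_corr_diagonal[OF K])
  have diag: "poly_rel ?R f f' \<longleftrightarrow> f = f' \<and> (\<forall>k. Polynomial.coeff f k \<in> K)" for f f'
    by (auto simp: poly_rel_def poly_eq_iff)
  have "\<exists>b. b \<noteq> a \<and> D.same_type a b"
  proof (cases "\<exists>f f'. D.minimal_annihilator a f f'")
    case True
    then obtain f f' where f: "D.minimal_annihilator a f f'" by blast
    then have fR: "f' = f" "\<And>k. Polynomial.coeff f k \<in> K" "f \<noteq> 0" "poly f a = 0"
      and fmin: "\<And>g. (\<forall>k. Polynomial.coeff g k \<in> K) \<Longrightarrow> g \<noteq> 0 \<Longrightarrow> poly g a = 0 \<Longrightarrow>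
          degree f \<le> degree g"
      unfolding D.minimal_annihilator_def diag by blast+
    obtain q where q: "f = [:- a, 1:] * q" using fR(4) by (metis dvdE poly_eq_0_iff_dvd)
    have "degree q \<noteq> 0"
    proof
      assume "degree q = 0"
      then obtain c where c: "q = [:c:]" by (metis degree_eq_zeroE)
      then have f_eq: "f = [:- a * c, c:]" using q by simp
      have c0: "c \<noteq> 0" using f_eq fR(3) by auto
      have "- a * c \<in> K" "c \<in> K" using fR(2)[of 0] fR(2)[of 1] by (auto simp: f_eq)
      then have "- (- a * c * inverse c) \<in> K" using K(1) unfolding field_closed_def by blast
      then show False using a c0 by (simp add: field_simps)
    qed
    then obtain b where b: "poly q b = 0"
      using fundamental_theorem_of_algebra[of q] by (auto simp: constant_degree)
    have "b \<noteq> a"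
    proof
      assume "b = a"
      then have "poly (pderiv f) a = 0" using b unfolding q pderiv_mult by (simp add: pderiv_pCons)
      moreover have "Polynomial.coeff (pderiv f) k \<in> K" for k
      proof -
        have "of_nat m \<in> K" for m
          by (induction m) (use K(1) field_closed_zero[OF K(1)] in \<open>auto simp: field_closed_def\<close>)
        then have "of_nat (Suc k) * Polynomial.coeff f (Suc k) \<in> K"
          using K(1) fR(2) unfolding field_closed_def by blast
        then show ?thesis by (simp add: coeff_pderiv)
      qed
      moreover have dpos: "degree f > 0" using D.degree_minimal_annihilator[OF f] .
      then have "pderiv f \<noteq> 0" by (simp add: pderiv_eq_0_iff)
      ultimately have "degree f \<le> degree (pderiv f)" using fmin by blast
      then show False using dpos by (simp add: degree_pderiv)
    qed
    moreover have "poly f' b = 0" using b by (simp add: fR(1) q)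
    then have "D.same_type a b" by (rule D.same_type_root[OF f])
    ultimately show ?thesis by blast
  qed (use D.same_type_transcendental in blast)
  then obtain b where b: "b \<noteq> a" "D.same_type a b" by blast
  have "\<forall>x\<in>K. D.adjoin a b x x" using D.adjoin_extends by blast
  then show ?thesis using D.countable_corr_adjoin[OF b(2)] D.adjoin_new b(1) by blast
qed

section \<open>Difference operators and linear recurrences\<close>

text \<open>The operator L(S) for the index shift S. On the sequence of derivatives at 0 it is the
  action of the differential operator L.\<close>

definition shift_op :: "'a :: comm_ring_1 poly \<Rightarrow> (nat \<Rightarrow> 'a) \<Rightarrow> nat \<Rightarrow> 'a" where
  "shift_op L f r = (\<Sum>k\<le>degree L. Polynomial.coeff L k * f (r + k))"

lemma shift_op_eq_sum:
  "degree L \<le> N \<Longrightarrow> shift_op L f r = (\<Sum>k\<le>N. Polynomial.coeff L k * f (r + k))"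
  unfolding shift_op_def by (intro sum.mono_neutral_left) (auto simp: coeff_eq_0)

lemma shift_op_0 [simp]: "shift_op 0 f r = 0"
  by (simp add: shift_op_def)

lemma shift_op_pCons: "shift_op (pCons a L) f r = a * f r + shift_op L f (Suc r)"
proof -
  have "shift_op (pCons a L) f r = (\<Sum>k\<le>Suc (degree L). Polynomial.coeff (pCons a L) k * f (r + k))"
    by (rule shift_op_eq_sum) (rule degree_pCons_le)
  also have "\<dots> = a * f r + shift_op L f (Suc r)"
    by (subst sum.atMost_Suc_shift) (simp add: shift_op_def)
  finally show ?thesis .
qed

lemma shift_op_1 [simp]: "shift_op 1 f r = f r"
  by (simp add: one_pCons shift_op_pCons)

lemma shift_op_add: "shift_op (L + L') f r = shift_op L f r + shift_op L' f r"
  using shift_op_eq_sum[of "L + L'" "max (degree L) (degree L')" f r]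
    shift_op_eq_sum[of L "max (degree L) (degree L')" f r]
    shift_op_eq_sum[of L' "max (degree L) (degree L')" f r]
  by (simp add: degree_add_le_max distrib_right sum.distrib)

lemma shift_op_smult: "shift_op (Polynomial.smult c L) f r = c * shift_op L f r"
  using shift_op_eq_sum[of "Polynomial.smult c L" "degree L" f r]
  by (simp add: shift_op_def sum_distrib_left mult.assoc degree_smult_le)

lemma shift_op_uminus: "shift_op (- L) f r = - shift_op L f r"
  by (simp add: shift_op_def sum_negf)

lemma shift_op_diff: "shift_op (L - L') f r = shift_op L f r - shift_op L' f r"
  using shift_op_add[of L "- L'"] by (simp add: shift_op_uminus)

lemma shift_op_sum: "shift_op (\<Sum>x\<in>S. L x) f r = (\<Sum>x\<in>S. shift_op (L x) f r)"
  by (induction S rule: infinite_finite_induct) (auto simp: shift_op_add)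

lemma shift_op_mult: "shift_op (L * L') f r = shift_op L (shift_op L' f) r"
proof (induction L arbitrary: r)
  case (pCons a L)
  have "shift_op (pCons a L * L') f r = a * shift_op L' f r + shift_op (L * L') f (Suc r)"
    by (simp add: shift_op_add shift_op_smult shift_op_pCons)
  then show ?case by (simp add: pCons.IH shift_op_pCons)
qed simp

lemma shift_op_scale_fun: "shift_op L (\<lambda>r. c * f r) r = c * shift_op L f r"
  by (simp add: shift_op_def sum_distrib_left mult.left_commute)

lemma shift_op_sum_fun: "shift_op L (\<lambda>r. \<Sum>x\<in>S. f x r) r = (\<Sum>x\<in>S. shift_op L (f x) r)"
  unfolding shift_op_def by (simp add: sum_distrib_left sum.swap[of _ S])

lemma shift_op_zero_fun [simp]: "shift_op L (\<lambda>r. 0) r = 0"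
  by (simp add: shift_op_def)

lemma shift_op_Suc: "shift_op L (\<lambda>r. f (r + k)) r = shift_op L f (r + k)"
  by (simp add: shift_op_def add_ac)

text \<open>The monic leading term expresses entry r + n through the n entries before it. Most
  identities between sequences below are reduced to n initial values in this way.\<close>

lemma monic_recurrence_unique:
  fixes f g :: "nat \<Rightarrow> 'a :: comm_ring_1"
  assumes p: "lead_coeff p = 1" "degree p = n"
    and eq: "\<And>r. shift_op p f r = shift_op p g r" and init: "\<And>r. r < n \<Longrightarrow> f r = g r"
  shows "f r = g r"
proof (induction r rule: less_induct)
  case (less r)
  show ?case
  proof (cases "r < n")
    case False
    define s where "s = r - n"
    have r: "r = s + n" using False by (simp add: s_def)
    have *: "shift_op p h s = h (s + n) + (\<Sum>k<n. Polynomial.coeff p k * h (s + k))" for h :: "nat \<Rightarrow> 'a"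
      unfolding shift_op_def p(2) using p by (simp add: lessThan_Suc_atMost[symmetric])
    have "(\<Sum>k<n. Polynomial.coeff p k * f (s + k)) = (\<Sum>k<n. Polynomial.coeff p k * g (s + k))"
      using less.IH r by (intro sum.cong) auto
    then show ?thesis using eq[of s] unfolding * r by simp
  qed (use init in simp)
qed

text \<open>Cramer's rule over the ring of difference operators.\<close>

lemma shift_op_char_poly:
  fixes A :: "'a :: comm_ring_1 mat"
  assumes A: "A \<in> carrier_mat n n"
    and rec: "\<And>i r. i < n \<Longrightarrow> V i (Suc r) = (\<Sum>j<n. A $$ (i, j) * V j r) + W i r"
    and i: "i < n"
  shows "shift_op (char_poly A) (V i) r =
    (\<Sum>j<n. shift_op (adj_mat (char_poly_matrix A) $$ (i, j)) (W j) r)"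
proof -
  let ?C = "char_poly_matrix A" and ?N = "adj_mat (char_poly_matrix A)"
  have C: "?C \<in> carrier_mat n n" using A by simp
  note N = adj_mat[OF C]
  have row: "(\<Sum>j<n. shift_op (?C $$ (k, j)) (V j) r) = W k r" if k: "k < n" for k r
  proof -
    have "(\<Sum>j<n. shift_op (?C $$ (k, j)) (V j) r) =
        (\<Sum>j<n. (if j = k then V k (Suc r) else 0) - A $$ (k, j) * V j r)"
      using k A by (intro sum.cong refl)
        (auto simp: char_poly_matrix_def shift_op_pCons shift_op_uminus)
    also have "\<dots> = W k r" using k by (simp add: sum_subtractf rec[OF k])
    finally show ?thesis .
  qed
  have "(\<Sum>k<n. shift_op (?N $$ (i, k)) (W k) r) =
      (\<Sum>k<n. shift_op (?N $$ (i, k)) (\<lambda>r. \<Sum>j<n. shift_op (?C $$ (k, j)) (V j) r) r)"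
    using row by (intro sum.cong refl) auto
  also have "\<dots> = (\<Sum>j<n. shift_op (\<Sum>k<n. ?N $$ (i, k) * ?C $$ (k, j)) (V j) r)"
    by (simp add: shift_op_sum_fun shift_op_sum shift_op_mult) (rule sum.swap)
  also have "\<dots> = (\<Sum>j<n. shift_op ((?N * ?C) $$ (i, j)) (V j) r)"
    using i C N(1) by (intro sum.cong refl) (auto simp: scalar_prod_def lessThan_atLeast0)
  also have "\<dots> = (\<Sum>j<n. if j = i then shift_op (char_poly A) (V i) r else 0)"
    unfolding N(3) using i by (intro sum.cong refl) (auto simp: char_poly_def)
  also have "\<dots> = shift_op (char_poly A) (V i) r" using i by simp
  finally show ?thesis by simp
qed

text \<open>An adjugate entry is a signed minor of size n - 1 with entries of degree at most 1. In
  systems language, the transfer functions are strictly proper.\<close>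

lemma degree_adj_char_poly_matrix:
  fixes A :: "'a :: comm_ring_1 mat"
  assumes A: "A \<in> carrier_mat n n" and "i < n" "j < n"
  shows "degree (adj_mat (char_poly_matrix A) $$ (i, j)) < n"
proof -
  let ?D = "mat_delete (char_poly_matrix A) j i"
  have C: "char_poly_matrix A \<in> carrier_mat n n" using A by simp
  have "?D \<in> carrier_mat (n - 1) (n - 1)" using mat_delete_carrier[OF C] .
  moreover have "degree (?D $$ (k, l)) \<le> 1" if "k < n - 1" "l < n - 1" for k l
    using that assms by (auto simp: mat_delete_def char_poly_matrix_def intro!: degree_add_le)
  ultimately have "degree (Determinant.det ?D) \<le> 1 * (n - 1)"
    by (intro degree_det_le) auto
  moreover have "(- 1 :: 'a poly) ^ k = [:(- 1) ^ k:]" for k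
    by (induction k) (auto simp: one_pCons)
  ultimately have "degree (cofactor (char_poly_matrix A) j i) \<le> n - 1"
    unfolding cofactor_def by (simp) (metis degree_smult_le order_trans)
  then show ?thesis using assms(2,3) carrier_matD[OF C] by (simp add: adj_mat_def)
qed

section \<open>Observability, controllability and realizations\<close>

lemma det_nonzero_iff:
  fixes B :: "'a :: field mat"
  assumes B: "B \<in> carrier_mat n n"
  shows "Determinant.det B \<noteq> 0 \<longleftrightarrow>
    (\<forall>v. (\<forall>r<n. (\<Sum>k<n. B $$ (r, k) * v k) = 0) \<longrightarrow> (\<forall>k<n. v k = 0))"
proof -
  have mv: "B *\<^sub>v vec n v = 0\<^sub>v n \<longleftrightarrow> (\<forall>r<n. (\<Sum>k<n. B $$ (r, k) * v k) = 0)" for v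
    using B by (auto simp: vec_eq_iff scalar_prod_def lessThan_atLeast0)
  have v0: "vec n v = 0\<^sub>v n \<longleftrightarrow> (\<forall>k<n. v k = 0)" for v :: "nat \<Rightarrow> 'a"
    by (auto simp: vec_eq_iff)
  have "w = vec n (\<lambda>k. w $ k)" if "w \<in> carrier_vec n" for w :: "'a Matrix.vec"
    using that by auto
  then have "(\<exists>w. w \<in> carrier_vec n \<and> w \<noteq> 0\<^sub>v n \<and> B *\<^sub>v w = 0\<^sub>v n) \<longleftrightarrow>
     (\<exists>v. vec n v \<noteq> 0\<^sub>v n \<and> B *\<^sub>v vec n v = 0\<^sub>v n)"
    by (metis vec_carrier)
  then have "Determinant.det B = 0 \<longleftrightarrow>
      (\<exists>v. \<not> (\<forall>k<n. v k = 0) \<and> (\<forall>r<n. (\<Sum>k<n. B $$ (r, k) * v k) = 0))"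
    unfolding det_0_iff_vec_prod_zero_field[OF B] mv v0 .
  then show ?thesis by blast
qed

lemma det_nonzero_solve:
  fixes R :: "'a :: field mat"
  assumes R: "R \<in> carrier_mat n n" "Determinant.det R \<noteq> 0"
  shows "\<exists>T. \<forall>k. \<forall>r<n. (\<Sum>l<n. T k l * R $$ (l, r)) = S k r"
proof -
  define T where "T k l = (\<Sum>s<n. S k s * adj_mat R $$ (s, l)) / Determinant.det R" for k l
  have "(\<Sum>l<n. T k l * R $$ (l, r)) = S k r" if r: "r < n" for k r
  proof -
    have "(\<Sum>l<n. T k l * R $$ (l, r)) =
        (\<Sum>s<n. S k s * (\<Sum>l<n. adj_mat R $$ (s, l) * R $$ (l, r))) / Determinant.det R"
      unfolding T_def by (simp add: sum_divide_distrib sum_distrib_left sum_distrib_right mult_ac)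
        (subst sum.swap, simp)
    also have "\<dots> = (\<Sum>s<n. S k s * (adj_mat R * R) $$ (s, r)) / Determinant.det R"
      using r R(1) adj_mat(1)[OF R(1)]
      by (intro arg_cong2[where f = "(/)"] sum.cong refl) (auto simp: scalar_prod_def lessThan_atLeast0)
    also have "\<dots> = (\<Sum>s<n. if s = r then S k r * Determinant.det R else 0) / Determinant.det R"
      unfolding adj_mat(3)[OF R(1)] using r by (intro arg_cong2[where f = "(/)"] sum.cong refl) auto
    also have "\<dots> = S k r" using r R(2) by simp
    finally show ?thesis .
  qed
  then show ?thesis by blast
qed

definition power_entry :: "'a :: comm_ring_1 mat \<Rightarrow> nat \<Rightarrow> nat \<Rightarrow> nat \<Rightarrow> 'a" where
  "power_entry A r i j = (A ^\<^sub>m r) $$ (i, j)"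

lemma power_entry_0: "A \<in> carrier_mat n n \<Longrightarrow> i < n \<Longrightarrow> j < n \<Longrightarrow> power_entry A 0 i j = (if i = j then 1 else 0)"
  by (simp add: power_entry_def)

lemma power_entry_add:
  assumes A: "A \<in> carrier_mat n n" and "i < n" "j < n"
  shows "power_entry A (r + s) i j = (\<Sum>k<n. power_entry A r i k * power_entry A s k j)"
proof -
  have "A ^\<^sub>m (r + s) = A ^\<^sub>m r * A ^\<^sub>m s"
  proof (induction s)
    case (Suc s)
    then show ?case using A by (simp add: assoc_mult_mat[of _ n n _ n _ n] pow_carrier_mat)
  qed (use A in \<open>simp add: pow_carrier_mat\<close>)
  then show ?thesis
    using assms pow_carrier_mat[OF A] by (auto simp: power_entry_def scalar_prod_def lessThan_atLeast0)
qed

lemma power_entry_1: "A \<in> carrier_mat n n \<Longrightarrow> power_entry A 1 i j = A $$ (i, j)"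
  by (simp add: power_entry_def)

lemma power_entry_Suc:
  assumes "A \<in> carrier_mat n n" "i < n" "j < n"
  shows "power_entry A (Suc r) i j = (\<Sum>k<n. A $$ (i, k) * power_entry A r k j)"
  using power_entry_add[OF assms, of 1 r] power_entry_1[OF assms(1)] by simp

lemma power_entry_Suc2:
  assumes "A \<in> carrier_mat n n" "i < n" "j < n"
  shows "power_entry A (Suc r) i j = (\<Sum>k<n. power_entry A r i k * A $$ (k, j))"
  using power_entry_add[OF assms, of r 1] power_entry_1[OF assms(1)] by simp

text \<open>Kalman's observability matrix for the single output coordinate i;
  \<open>controllability_mat\<close> is the reachability matrix for the single input coordinate
  j.\<close>

definition observability_mat :: "'a :: comm_ring_1 mat \<Rightarrow> nat \<Rightarrow> 'a mat" where
  "observability_mat A i = Matrix.mat (dim_row A) (dim_row A) (\<lambda>(r, k). power_entry A r i k)"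

definition controllability_mat :: "'a :: comm_ring_1 mat \<Rightarrow> nat \<Rightarrow> 'a mat" where
  "controllability_mat A j = Matrix.mat (dim_row A) (dim_row A) (\<lambda>(k, r). power_entry A r k j)"

lemma observability_mat_carrier: "A \<in> carrier_mat n n \<Longrightarrow> observability_mat A i \<in> carrier_mat n n"
  and controllability_mat_carrier: "A \<in> carrier_mat n n \<Longrightarrow> controllability_mat A i \<in> carrier_mat n n"
  by (auto simp: observability_mat_def controllability_mat_def)

lemma observableD:
  fixes A :: "'a :: field mat"
  assumes A: "A \<in> carrier_mat n n" and "Determinant.det (observability_mat A i) \<noteq> 0"
    and "\<And>r. (\<Sum>k<n. power_entry A r i k * v k) = 0" "k < n"
  shows "v k = 0"
proof -
  have "(\<Sum>k<n. observability_mat A i $$ (r, k) * v k) = 0" if "r < n" for r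
    using assms(3)[of r] A that by (simp add: observability_mat_def)
  then show ?thesis
    using iffD1[OF det_nonzero_iff[OF observability_mat_carrier[OF A]] assms(2), rule_format, of v k] assms(4)
    by blast
qed

lemma controllableD:
  fixes A :: "'a :: field mat"
  assumes A: "A \<in> carrier_mat n n" and "Determinant.det (controllability_mat A j) \<noteq> 0"
    and "\<And>k. k < n \<Longrightarrow> (\<Sum>r<n. power_entry A r k j * v r) = 0" "r < n"
  shows "v r = 0"
proof -
  have "(\<Sum>r<n. controllability_mat A j $$ (k, r) * v r) = 0" if "k < n" for k
    using assms(3)[OF that] A that by (simp add: controllability_mat_def)
  then show ?thesis
    using iffD1[OF det_nonzero_iff[OF controllability_mat_carrier[OF A]] assms(2), rule_format, of v r] assms(4)
    by blast
qed

definition impulse :: "nat \<Rightarrow> 'a :: zero \<Rightarrow> nat \<Rightarrow> 'a" where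
  "impulse N b r = (if Suc r = N then b else 0)"

text \<open>Applied to an impulse, an operator lists its own coefficients in reverse order and is
  zero from index N on. This links polynomials to values of sequences.\<close>

lemma shift_op_impulse:
  "shift_op L (impulse N b) r = (if r < N then Polynomial.coeff L (N - Suc r) * b else 0)"
proof -
  let ?M = "max (degree L) N"
  have "shift_op L (impulse N b) r = (\<Sum>k\<le>?M. if k = N - Suc r \<and> r < N then Polynomial.coeff L (N - Suc r) * b else 0)"
    unfolding shift_op_eq_sum[of L ?M, OF max.cobounded1]
    by (intro sum.cong) (auto simp: impulse_def)
  then show ?thesis by (auto simp: sum.delta' sum.delta)
qed

text \<open>
  The zero state response to an impulse at time \<open>N - 1\<close>; its values before time \<open>N\<close> turn the
  coefficients of the numerator of the transfer function into values of the sequence.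
\<close>

definition impulse_response :: "'a :: comm_ring_1 mat \<Rightarrow> nat \<Rightarrow> nat \<Rightarrow> nat \<Rightarrow> nat \<Rightarrow> 'a" where
  "impulse_response A N j i r = (if r < N then 0 else power_entry A (r - N) i j)"

text \<open>The impulse at index N - 1 puts the system into state \<open>e_j\<close> at time N, and
  from then on the state is \<open>A^(r - N) e_j\<close>. The claim is Cramer's rule for this
  inhomogeneous recurrence.\<close>

lemma shift_op_impulse_response:
  assumes A: "A \<in> carrier_mat n n" and ij: "i < n" "j < n" and N: "N > 0"
  shows "shift_op (char_poly A) (impulse_response A N j i) r =
     shift_op (adj_mat (char_poly_matrix A) $$ (i, j)) (impulse N 1) r"
proof -
  let ?W = "\<lambda>i r. if i = j then impulse N 1 r else (0 :: 'a)"
  have "impulse_response A N j i (Suc r) = (\<Sum>k<n. A $$ (i, k) * impulse_response A N j k r) + ?W i r"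
    if i: "i < n" for i r
  proof -
    consider "Suc r < N" | "Suc r = N" | "N \<le> r" by linarith
    then show ?thesis
    proof cases
      case 3
      then show ?thesis using power_entry_Suc[OF A i ij(2), of "r - N"]
        by (auto simp: impulse_response_def impulse_def Suc_diff_le)
    qed (use power_entry_0[OF A i ij(2)] in \<open>auto simp: impulse_response_def impulse_def\<close>)
  qed
  then have "shift_op (char_poly A) (impulse_response A N j i) r =
     (\<Sum>k<n. shift_op (adj_mat (char_poly_matrix A) $$ (i, k)) (?W k) r)"
    by (intro shift_op_char_poly[OF A _ ij(1), of "impulse_response A N j" ?W]) auto
  also have "\<dots> = (\<Sum>k<n. if k = j then shift_op (adj_mat (char_poly_matrix A) $$ (i, j)) (impulse N 1) r else 0)"
    by (intro sum.cong) auto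
  also have "\<dots> = shift_op (adj_mat (char_poly_matrix A) $$ (i, j)) (impulse N 1) r"
    using ij by simp
  finally show ?thesis .
qed

text \<open>
  For a controllable and observable system, numerator and denominator of the transfer function are
  coprime.
\<close>

lemma char_poly_dvd_imp_zero:
  fixes A :: "'a :: field mat"
  assumes A: "A \<in> carrier_mat n n" and ij: "i < n" "j < n"
    and obs: "Determinant.det (observability_mat A i) \<noteq> 0"
    and ctr: "Determinant.det (controllability_mat A j) \<noteq> 0"
    and L: "degree L < n"
    and dvd: "char_poly A dvd L * adj_mat (char_poly_matrix A) $$ (i, j)"
  shows "L = 0"
proof -
  define p where "p = char_poly A"
  define q where "q = adj_mat (char_poly_matrix A) $$ (i, j)"
  have p: "lead_coeff p = 1" "degree p = n"
    using degree_monic_char_poly[OF A] by (auto simp: p_def)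
  have q: "degree q < n" unfolding q_def by (rule degree_adj_char_poly_matrix[OF A ij])
  obtain L' where L': "L * q = p * L'" using dvd unfolding p_def q_def by (rule dvdE)
  have dL': "degree L' < n"
  proof (cases "L' = 0")
    case False
    have "p \<noteq> 0" using p(1) by auto
    then have "n + degree L' = degree (L * q)" using False p L' by (simp add: degree_mult_eq)
    also have "\<dots> \<le> degree L + degree q" by (rule degree_mult_le)
    finally show ?thesis using L q by linarith
  qed (use L in simp)
  \<comment> \<open>The impulse comes so late that the first n entries of both sides of
    \<open>eq\<close> vanish: \<open>L ?m\<close> there involves only entries of index below 2n, and
    \<open>L' ?d\<close> only coefficients of L' of index at least n.\<close>
  let ?m = "impulse_response A (2 * n) j i" and ?d = "impulse (2 * n) (1 :: 'a)"
  have n0: "2 * n > 0" using ij by simp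
  have pm: "shift_op p ?m = shift_op q ?d"
    unfolding p_def q_def by (rule ext) (rule shift_op_impulse_response[OF A ij n0])
  have eq: "shift_op L ?m r = shift_op L' ?d r" for r
  proof (rule monic_recurrence_unique[OF p])
    fix r
    have "shift_op p (shift_op L ?m) r = shift_op L (shift_op p ?m) r"
      by (simp flip: shift_op_mult add: mult.commute)
    also have "\<dots> = shift_op p (shift_op L' ?d) r"
      unfolding pm by (simp flip: shift_op_mult add: L')
    finally show "shift_op p (shift_op L ?m) r = shift_op p (shift_op L' ?d) r" .
  next
    fix r assume r: "r < n"
    have "shift_op L ?m r = 0"
      unfolding shift_op_def using r L by (intro sum.neutral) (auto simp: impulse_response_def)
    moreover have "shift_op L' ?d r = 0"
      using r dL' by (simp add: shift_op_impulse coeff_eq_0)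
    ultimately show "shift_op L ?m r = shift_op L' ?d r" by simp
  qed
  have Lsum: "(\<Sum>k<n. Polynomial.coeff L k * f (r + k)) = shift_op L f r" for f :: "nat \<Rightarrow> 'a" and r
    unfolding shift_op_def using L by (intro sum.mono_neutral_right) (auto simp: coeff_eq_0)
  \<comment> \<open>From index 2n on the impulse is over, so \<open>e_i^T A^r L(A) e_j = 0\<close>
    for every r. Observability gives \<open>L(A) e_j = 0\<close>, and controllability makes the
    vectors \<open>A^k e_j\<close> with k < n independent.\<close>
  have "(\<Sum>k<n. power_entry A k l j * Polynomial.coeff L k) = 0" if l: "l < n" for l
  proof (rule observableD[OF A obs _ l])
    fix r
    have "(\<Sum>l<n. power_entry A r i l * (\<Sum>k<n. power_entry A k l j * Polynomial.coeff L k)) =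
       (\<Sum>k<n. Polynomial.coeff L k * power_entry A (r + k) i j)"
      unfolding power_entry_add[OF A ij] by (simp add: sum_distrib_left mult_ac) (rule sum.swap)
    also have "\<dots> = (\<Sum>k<n. Polynomial.coeff L k * ?m ((2 * n + r) + k))"
      by (intro sum.cong refl) (auto simp: impulse_response_def add.assoc)
    also have "\<dots> = shift_op L' ?d (2 * n + r)" by (simp only: Lsum eq)
    also have "\<dots> = 0" by (simp add: shift_op_impulse)
    finally show "(\<Sum>l<n. power_entry A r i l * (\<Sum>k<n. power_entry A k l j * Polynomial.coeff L k)) = 0" .
  qed
  from controllableD[OF A ctr this] have "Polynomial.coeff L k = 0" if "k < n" for k using that by blast
  then have "Polynomial.coeff L k = 0" for k using L coeff_eq_0[of L k] by (cases "k < n") auto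
  then show ?thesis by (simp add: poly_eq_iff)
qed

text \<open>Subtracting the equations gives L y = sum of \<open>R j\<close> applied to
  \<open>U j\<close>, with deg L < n because both p and p' are monic. Applying p to this and L to
  the first equation eliminates y; the resulting operators \<open>L * q j - p * R j\<close> have
  degree below 2n and vanish by independence of the inputs. Then p divides \<open>L * q j0\<close>,
  so L = 0 by coprimality.\<close>

lemma io_equation_determined:
  fixes p p' :: "'a :: field poly"
  assumes n: "n > 0" and J: "finite J" "j0 \<in> J"
    and p: "lead_coeff p = 1" "degree p = n"
    and p': "lead_coeff p' = 1" "degree p' = n"
    and q: "\<And>j. j \<in> J \<Longrightarrow> degree (q j) < n"
    and q': "\<And>j. j \<in> J \<Longrightarrow> degree (q' j) < n"
    and coprime: "\<And>L. degree L < n \<Longrightarrow> p dvd L * q j0 \<Longrightarrow> L = 0"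
    and U: "\<And>D. (\<And>j. j \<in> J \<Longrightarrow> degree (D j) < 2 * n) \<Longrightarrow>
        (\<And>r. (\<Sum>j\<in>J. shift_op (D j) (U j) r) = 0) \<Longrightarrow> \<forall>j\<in>J. D j = 0"
    and y: "\<And>r. shift_op p y r = (\<Sum>j\<in>J. shift_op (q j) (U j) r)"
    and y': "\<And>r. shift_op p' y r = (\<Sum>j\<in>J. shift_op (q' j) (U j) r)"
  shows "p = p' \<and> (\<forall>j\<in>J. q j = q' j)"
proof -
  define L where "L = p - p'"
  define R where "R j = q j - q' j" for j
  have dL: "degree L < n"
  proof (rule ccontr)
    assume "\<not> ?thesis"
    moreover have "degree L \<le> n" unfolding L_def using p p' by (intro degree_diff_le) auto
    ultimately have "degree L = n" by simp
    moreover have "Polynomial.coeff L n = 0" using p p' by (simp add: L_def)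
    ultimately show False using n leading_coeff_0_iff[of L] by auto
  qed
  have dR: "degree (R j) < n" if "j \<in> J" for j
    unfolding R_def using q[OF that] q'[OF that] by (rule degree_diff_less)
  have Ly: "shift_op L y r = (\<Sum>j\<in>J. shift_op (R j) (U j) r)" for r
    by (simp add: L_def R_def shift_op_diff y y' sum_subtractf)
  have "\<forall>j\<in>J. L * q j - p * R j = 0"
  proof (rule U)
    fix j assume j: "j \<in> J"
    have "degree (L * q j) \<le> degree L + degree (q j)" by (rule degree_mult_le)
    moreover have "degree (p * R j) \<le> degree p + degree (R j)" by (rule degree_mult_le)
    ultimately show "degree (L * q j - p * R j) < 2 * n"
      using dL q[OF j] dR[OF j] p by (intro degree_diff_less) auto
  next
    fix r
    have "(\<Sum>j\<in>J. shift_op (L * q j) (U j) r) = shift_op L (shift_op p y) r"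
      unfolding y[abs_def] by (simp add: shift_op_mult shift_op_sum_fun)
    also have "\<dots> = shift_op p (shift_op L y) r" by (simp flip: shift_op_mult add: mult.commute)
    also have "\<dots> = (\<Sum>j\<in>J. shift_op (p * R j) (U j) r)"
      unfolding Ly[abs_def] by (simp add: shift_op_mult shift_op_sum_fun)
    finally show "(\<Sum>j\<in>J. shift_op (L * q j - p * R j) (U j) r) = 0"
      by (simp add: shift_op_diff sum_subtractf)
  qed
  then have LR: "L * q j = p * R j" if "j \<in> J" for j using that by simp
  then have "p dvd L * q j0" using J(2) by simp
  then have "L = 0" using coprime dL by blast
  moreover have "R j = 0" if "j \<in> J" for j
    using LR[OF that] \<open>L = 0\<close> p(1) by auto
  ultimately show ?thesis by (simp add: L_def R_def)
qed

section \<open>Transport of the Kalman determinants, and similarity of realizations\<close>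

context ring_rel
begin

lemma power_entry_rel:
  assumes A: "A \<in> carrier_mat n n" and B: "B \<in> carrier_mat n n"
    and rel: "\<And>i j. i < n \<Longrightarrow> j < n \<Longrightarrow> R (A $$ (i, j)) (B $$ (i, j))"
    and "i < n" "j < n"
  shows "R (power_entry A r i j) (power_entry B r i j)"
  using assms(4,5)
proof (induction r arbitrary: i)
  case 0
  then show ?case by (simp add: power_entry_0[OF A] power_entry_0[OF B] zero one)
next
  case (Suc r)
  then show ?case
    unfolding power_entry_Suc[OF A Suc.prems] power_entry_Suc[OF B Suc.prems]
    by (intro sum mult rel) auto
qed

lemma det_observability_rel:
  assumes A: "A \<in> carrier_mat n n" and B: "B \<in> carrier_mat n n"
    and rel: "\<And>i j. i < n \<Longrightarrow> j < n \<Longrightarrow> R (A $$ (i, j)) (B $$ (i, j))" and i: "i < n"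
  shows "R (Determinant.det (observability_mat A i)) (Determinant.det (observability_mat B i))"
  using carrier_matD[OF A] carrier_matD[OF B] i
  by (intro det[of _ n] observability_mat_carrier A B)
    (auto simp: observability_mat_def intro: power_entry_rel[OF A B rel])

lemma det_controllability_rel:
  assumes A: "A \<in> carrier_mat n n" and B: "B \<in> carrier_mat n n"
    and rel: "\<And>i j. i < n \<Longrightarrow> j < n \<Longrightarrow> R (A $$ (i, j)) (B $$ (i, j))" and j: "j < n"
  shows "R (Determinant.det (controllability_mat A j)) (Determinant.det (controllability_mat B j))"
  using carrier_matD[OF A] carrier_matD[OF B] j
  by (intro det[of _ n] controllability_mat_carrier A B)
    (auto simp: controllability_mat_def intro: power_entry_rel[OF A B rel])

end

lemma observability_rowsD:
  fixes A :: "'a :: field mat"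
  assumes A: "A \<in> carrier_mat n n" and "Determinant.det (observability_mat A i) \<noteq> 0"
    and "\<And>k. k < n \<Longrightarrow> (\<Sum>r<n. power_entry A r i k * v r) = 0" "r < n"
  shows "v r = 0"
proof -
  have O: "observability_mat A i \<in> carrier_mat n n" by (rule observability_mat_carrier[OF A])
  then have T: "transpose_mat (observability_mat A i) \<in> carrier_mat n n" by simp
  have "(\<Sum>r<n. transpose_mat (observability_mat A i) $$ (k, r) * v r) = 0" if "k < n" for k
    using assms(3)[OF that] that A O by (simp add: observability_mat_def)
  moreover have "Determinant.det (transpose_mat (observability_mat A i)) \<noteq> 0"
    using assms(2) by (simp add: det_transpose[OF O])
  ultimately show ?thesis
    using iffD1[OF det_nonzero_iff[OF T], rule_format, of v r] assms(4) by blast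
qed

lemma controllability_rowsD:
  fixes A :: "'a :: field mat"
  assumes A: "A \<in> carrier_mat n n" and "Determinant.det (controllability_mat A j) \<noteq> 0"
    and "\<And>r. r < n \<Longrightarrow> (\<Sum>l<n. w l * power_entry A r l j) = 0" "l < n"
  shows "w l = 0"
proof -
  have O: "controllability_mat A j \<in> carrier_mat n n" by (rule controllability_mat_carrier[OF A])
  then have T: "transpose_mat (controllability_mat A j) \<in> carrier_mat n n" by simp
  have "(\<Sum>l<n. transpose_mat (controllability_mat A j) $$ (r, l) * w l) = 0" if "r < n" for r
    using assms(3)[OF that] that A O by (simp add: controllability_mat_def mult.commute)
  moreover have "Determinant.det (transpose_mat (controllability_mat A j)) \<noteq> 0"
    using assms(2) by (simp add: det_transpose[OF O])
  ultimately show ?thesis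
    using iffD1[OF det_nonzero_iff[OF T], rule_format, of w l] assms(4) by blast
qed

text \<open>Cramer's rule for the homogeneous recurrence satisfied by the columns of the matrix
  powers.\<close>

lemma Cayley_Hamilton_entry:
  fixes A :: "'a :: comm_ring_1 mat"
  assumes A: "A \<in> carrier_mat n n" and "i < n" "j < n"
  shows "shift_op (char_poly A) (\<lambda>r. power_entry A r i j) r = 0"
  using shift_op_char_poly[OF A, of "\<lambda>i r. power_entry A r i j" "\<lambda>_ _. 0" i r]
    power_entry_Suc[OF A _ assms(3)] assms(2) by simp

lemma sum_minus_delta:
  fixes f g :: "nat \<Rightarrow> 'a :: comm_ring_1"
  assumes "i < n"
  shows "(\<Sum>l<n. (f l - (if l = i then c else 0)) * g l) = (\<Sum>l<n. f l * g l) - c * g i"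
proof -
  have "(f l - (if l = i then c else 0)) * g l = f l * g l - (if l = i then c * g i else 0)" for l
    by (simp add: left_diff_distrib)
  then show ?thesis using assms by (simp add: sum_subtractf)
qed

text \<open>
  \<open>T\<close> carries the reachability matrix of the first realization to that of the second.
\<close>

lemma realizations_similar:
  fixes A A' :: "'a :: field mat"
  assumes A: "A \<in> carrier_mat n n" and A': "A' \<in> carrier_mat n n"
    and i0: "i0 \<in> I" "I \<subseteq> {..<n}" and j0: "j0 \<in> J" "J \<subseteq> {..<n}"
    and ctr: "Determinant.det (controllability_mat A j0) \<noteq> 0" "b j0 \<noteq> 0"
    and obs: "Determinant.det (observability_mat A' i0) \<noteq> 0" "c' i0 \<noteq> 0"
    and p: "char_poly A = char_poly A'"
    and q: "\<And>i j. i \<in> I \<Longrightarrow> j \<in> J \<Longrightarrow>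
       Polynomial.smult (c i * b j) (adj_mat (char_poly_matrix A) $$ (i, j)) =
       Polynomial.smult (c' i * b' j) (adj_mat (char_poly_matrix A') $$ (i, j))"
  shows "\<exists>T. (\<forall>k<n. \<forall>l<n. (\<Sum>m<n. T k m * A $$ (m, l)) = (\<Sum>m<n. A' $$ (k, m) * T m l)) \<and>
     (\<forall>j\<in>J. \<forall>k<n. T k j * b j = (if k = j then b' j else 0)) \<and>
     (\<forall>i\<in>I. \<forall>l<n. c' i * T i l = (if l = i then c i else 0))"
proof -
  note monic = conjunct2[OF degree_monic_char_poly[OF A]] conjunct1[OF degree_monic_char_poly[OF A]]
  have lead: "lead_coeff (char_poly A) = 1" using monic by simp
  have n0: "n > 0" using i0 by auto
  have lt: "i < n" "j < n" if "i \<in> I" "j \<in> J" for i j using that i0 j0 by auto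
  \<comment> \<open>Equal transfer functions have equal Markov parameters: both scaled impulse
    responses satisfy the same monic recurrence and vanish before index n.\<close>
  have markov: "c i * b j * power_entry A r i j = c' i * b' j * power_entry A' r i j"
    if "i \<in> I" "j \<in> J" for i j r
  proof -
    let ?f = "\<lambda>r. c i * b j * impulse_response A n j i r"
      and ?g = "\<lambda>r. c' i * b' j * impulse_response A' n j i r"
    have "?f (n + r) = ?g (n + r)"
    proof (rule monic_recurrence_unique[OF lead monic(2), of ?f ?g])
      fix r
      have "shift_op (char_poly A) ?f r =
          shift_op (Polynomial.smult (c i * b j) (adj_mat (char_poly_matrix A) $$ (i, j))) (impulse n 1) r"
        by (simp add: shift_op_scale_fun shift_op_smult shift_op_impulse_response[OF A lt[OF that] n0])
      moreover have "shift_op (char_poly A) ?g r =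
          shift_op (Polynomial.smult (c' i * b' j) (adj_mat (char_poly_matrix A') $$ (i, j))) (impulse n 1) r"
        unfolding p by (simp add: shift_op_scale_fun shift_op_smult shift_op_impulse_response[OF A' lt[OF that] n0])
      ultimately show "shift_op (char_poly A) ?f r = shift_op (char_poly A) ?g r"
        using q[OF that] by simp
    qed (simp add: impulse_response_def)
    then show ?thesis by (simp add: impulse_response_def)
  qed
  \<comment> \<open>The factor \<open>b' j0 / b j0\<close> makes T carry the first input vector
    \<open>b j0 e_j0\<close> to \<open>b' j0 e_j0\<close>. The first n columns determine T;
    Cayley-Hamilton on both sides, with the common characteristic polynomial, gives the remaining
    ones in \<open>TS\<close>.\<close>
  define S where "S k r = b' j0 / b j0 * power_entry A' r k j0" for k r
  obtain T where T: "\<And>k r. r < n \<Longrightarrow> (\<Sum>l<n. T k l * controllability_mat A j0 $$ (l, r)) = S k r"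
    using det_nonzero_solve[OF controllability_mat_carrier[OF A] ctr(1), of S] by metis
  have j0n: "j0 < n" and i0n: "i0 < n" using i0 j0 by auto
  have TS: "(\<Sum>l<n. T k l * power_entry A r l j0) = S k r" if k: "k < n" for k r
  proof (rule monic_recurrence_unique[OF lead monic(2), of _ "S k"])
    show "shift_op (char_poly A) (\<lambda>r. \<Sum>l<n. T k l * power_entry A r l j0) r =
          shift_op (char_poly A) (S k) r" for r
      unfolding S_def[abs_def] shift_op_sum_fun shift_op_scale_fun
      using Cayley_Hamilton_entry[OF A _ j0n] Cayley_Hamilton_entry[OF A' k j0n] by (simp add: p)
    show "(\<Sum>l<n. T k l * power_entry A r l j0) = S k r" if "r < n" for r
      using T[OF that, of k] A that by (simp add: controllability_mat_def)
  qed
  \<comment> \<open>A row vector that annihilates all \<open>A^r e_j0\<close> is zero, so this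
    identity and the output identity \<open>C\<close> may be tested on the reachable vectors
    alone.\<close>
  have TA: "(\<Sum>m<n. T k m * A $$ (m, l)) = (\<Sum>m<n. A' $$ (k, m) * T m l)" if k: "k < n" and l: "l < n" for k l
  proof -
    let ?w = "\<lambda>l. (\<Sum>m<n. T k m * A $$ (m, l)) - (\<Sum>m<n. A' $$ (k, m) * T m l)"
    have "?w l = 0"
    proof (rule controllability_rowsD[OF A ctr(1) _ l])
      fix r
      have "(\<Sum>l<n. (\<Sum>m<n. T k m * A $$ (m, l)) * power_entry A r l j0) =
          (\<Sum>m<n. T k m * power_entry A (Suc r) m j0)"
        using power_entry_Suc[OF A _ j0n]
        by (simp add: sum_distrib_left sum_distrib_right mult_ac) (rule sum.swap)
      also have "\<dots> = S k (Suc r)" by (rule TS[OF k])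
      also have "\<dots> = (\<Sum>m<n. A' $$ (k, m) * S m r)"
        unfolding S_def power_entry_Suc[OF A' k j0n] by (simp add: sum_distrib_left mult_ac)
      also have "\<dots> = (\<Sum>m<n. A' $$ (k, m) * (\<Sum>l<n. T m l * power_entry A r l j0))"
        using TS by simp
      also have "\<dots> = (\<Sum>l<n. (\<Sum>m<n. A' $$ (k, m) * T m l) * power_entry A r l j0)"
        by (simp add: sum_distrib_left sum_distrib_right mult_ac) (rule sum.swap)
      finally show "(\<Sum>l<n. ?w l * power_entry A r l j0) = 0"
        by (simp add: left_diff_distrib sum_subtractf)
    qed
    then show ?thesis by simp
  qed
  have TAr: "(\<Sum>m<n. T k m * power_entry A r m l) = (\<Sum>m<n. power_entry A' r k m * T m l)"
    if k: "k < n" and l: "l < n" for k l r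
    using k
  proof (induction r arbitrary: k)
    case 0
    then show ?case using l by (simp add: power_entry_0[OF A] power_entry_0[OF A'] if_distrib
        if_distribR cong: if_cong)
  next
    case (Suc r)
    have "(\<Sum>m<n. T k m * power_entry A (Suc r) m l) = (\<Sum>h<n. (\<Sum>m<n. T k m * A $$ (m, h)) * power_entry A r h l)"
      using power_entry_Suc[OF A _ l]
      by (simp add: sum_distrib_left sum_distrib_right mult_ac) (rule sum.swap)
    also have "\<dots> = (\<Sum>h<n. (\<Sum>m<n. A' $$ (k, m) * T m h) * power_entry A r h l)"
      using TA[OF Suc.prems] by simp
    also have "\<dots> = (\<Sum>m<n. A' $$ (k, m) * (\<Sum>h<n. T m h * power_entry A r h l))"
      by (simp add: sum_distrib_left sum_distrib_right mult_ac) (rule sum.swap)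
    also have "\<dots> = (\<Sum>m<n. A' $$ (k, m) * (\<Sum>h<n. power_entry A' r m h * T h l))"
      using Suc.IH by simp
    also have "\<dots> = (\<Sum>h<n. power_entry A' (Suc r) k h * T h l)"
      using power_entry_Suc[OF A' Suc.prems]
      by (simp add: sum_distrib_left sum_distrib_right mult_ac) (rule sum.swap)
    finally show ?case .
  qed
  have C: "c' i * T i l = (if l = i then c i else 0)" if i: "i \<in> I" and l: "l < n" for i l
  proof -
    have iN: "i < n" using i i0 by auto
    let ?w = "\<lambda>l. c' i * T i l - (if l = i then c i else 0)"
    have "?w l = 0"
    proof (rule controllability_rowsD[OF A ctr(1) _ l])
      fix r
      have "(\<Sum>l<n. ?w l * power_entry A r l j0) =
          c' i * (\<Sum>l<n. T i l * power_entry A r l j0) - c i * power_entry A r i j0"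
        unfolding sum_minus_delta[OF iN] by (simp add: sum_distrib_left mult.assoc)
      also have "\<dots> = 0"
        using markov[OF i j0(1), of r] ctr(2) unfolding TS[OF iN] S_def by (simp add: field_simps)
      finally show "(\<Sum>l<n. ?w l * power_entry A r l j0) = 0" .
    qed
    then show ?thesis by simp
  qed
  \<comment> \<open>For inputs other than j0 reachability says nothing directly; the identity is
    tested against the rows \<open>e_i0^T A'^r\<close> instead, where \<open>TAr\<close>,
    \<open>C\<close> and the Markov parameters evaluate it.\<close>
  have B: "T k j * b j = (if k = j then b' j else 0)" if j: "j \<in> J" and k: "k < n" for j k
  proof -
    have jN: "j < n" using j j0 by auto
    let ?v = "\<lambda>k. T k j * b j - (if k = j then b' j else 0)"
    have "?v k = 0"
    proof (rule observableD[OF A' obs(1) _ k])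
      fix r
      have "(\<Sum>k<n. power_entry A' r i0 k * ?v k) =
          (\<Sum>k<n. power_entry A' r i0 k * T k j) * b j - b' j * power_entry A' r i0 j"
        using sum_minus_delta[OF jN, of "\<lambda>k. T k j * b j" "b' j" "power_entry A' r i0"]
        by (simp add: mult.commute sum_distrib_left mult.left_commute)
      also have "(\<Sum>k<n. power_entry A' r i0 k * T k j) = (\<Sum>m<n. T i0 m * power_entry A r m j)"
        by (rule TAr[OF i0n jN, symmetric])
      finally have "c' i0 * (\<Sum>k<n. power_entry A' r i0 k * ?v k) =
          (\<Sum>m<n. c' i0 * T i0 m * power_entry A r m j) * b j - c' i0 * b' j * power_entry A' r i0 j"
        by (simp add: right_diff_distrib sum_distrib_left mult_ac)
      also have "(\<Sum>m<n. c' i0 * T i0 m * power_entry A r m j) = (\<Sum>m<n. if m = i0 then c i0 * power_entry A r i0 j else 0)"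
        using C[OF i0(1)] by (intro sum.cong) auto
      also have "\<dots> * b j = c' i0 * b' j * power_entry A' r i0 j"
        using i0n markov[OF i0(1) j, of r] by (simp add: mult_ac)
      finally show "(\<Sum>k<n. power_entry A' r i0 k * ?v k) = 0" using obs(2) by simp
    qed
    then show ?thesis by simp
  qed
  show ?thesis using TA B C by blast
qed

text \<open>One half of the Hautus test. For v in the kernel of the observability matrix,
  \<open>V k r\<close> is coordinate k of \<open>A^r v\<close>; coordinate i vanishes for all r,
  since it does for r < n and obeys the characteristic recurrence. Take q of least degree
  annihilating all these sequences and split off a root c, so that q = (S - c) q1. Then
  \<open>q1(A) v\<close> is a nonzero eigenvector for c, and its coordinate i is a combination of
  zeros.\<close>

lemma unobservable_eigenvector:
  fixes A :: "complex mat"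
  assumes A: "A \<in> carrier_mat n n" and i: "i < n"
    and det: "Determinant.det (observability_mat A i) = 0"
  shows "\<exists>c x. (\<exists>k<n. x k \<noteq> 0) \<and> (\<forall>k<n. (\<Sum>l<n. A $$ (k, l) * x l) = c * x k) \<and> x i = 0"
proof -
  obtain v where v: "\<And>r. r < n \<Longrightarrow> (\<Sum>k<n. observability_mat A i $$ (r, k) * v k) = 0" "\<exists>k<n. v k \<noteq> 0"
    using det det_nonzero_iff[OF observability_mat_carrier[OF A]] by blast
  define V where "V k r = (\<Sum>l<n. power_entry A r k l * v l)" for k r
  have V0: "V k 0 = v k" if "k < n" for k
    using that by (simp add: V_def power_entry_0[OF A] if_distrib if_distribR cong: if_cong)
  have VS: "V k (Suc r) = (\<Sum>l<n. A $$ (k, l) * V l r)" if "k < n" for k r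
    using power_entry_Suc[OF A that] unfolding V_def
    by (simp add: sum_distrib_left sum_distrib_right mult_ac) (rule sum.swap)
  have CH: "shift_op (char_poly A) (V k) r = 0" if "k < n" for k r
    using shift_op_char_poly[OF A, of V "\<lambda>_ _. 0" k r] VS that by simp
  have Vi: "V i r = 0" for r
  proof (rule monic_recurrence_unique[of "char_poly A" n "V i" "\<lambda>_. 0"])
    show "lead_coeff (char_poly A) = 1" "degree (char_poly A) = n"
      using degree_monic_char_poly[OF A] by auto
    show "shift_op (char_poly A) (V i) r = shift_op (char_poly A) (\<lambda>_. 0) r" for r
      using CH[OF i] by simp
    show "V i r = 0" if "r < n" for r
      using v(1)[OF that] that A by (simp add: V_def observability_mat_def)
  qed
  let ?Q = "\<lambda>q. q \<noteq> 0 \<and> (\<forall>k<n. \<forall>r. shift_op q (V k) r = 0)"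
  have "char_poly A \<noteq> 0" using degree_monic_char_poly[OF A] by auto
  then have "?Q (char_poly A)" using CH by blast
  from arg_min_nat_lemma[of ?Q, OF this, of degree]
  obtain q where q: "q \<noteq> 0" "\<And>k r. k < n \<Longrightarrow> shift_op q (V k) r = 0"
    and min: "\<And>q'. ?Q q' \<Longrightarrow> degree q \<le> degree q'" by blast
  have "degree q \<noteq> 0"
  proof
    assume "degree q = 0"
    then obtain c where "q = [:c:]" by (metis degree_eq_zeroE)
    then show False using q(1) q(2)[of _ 0] v(2) V0 by (auto simp: shift_op_pCons)
  qed
  then obtain c where "poly q c = 0" using fundamental_theorem_of_algebra[of q] by (auto simp: constant_degree)
  then obtain q1 where q1: "q = [:- c, 1:] * q1" by (metis dvdE poly_eq_0_iff_dvd)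
  have "q1 \<noteq> 0" using q(1) q1 by auto
  then have "degree q1 < degree q" unfolding q1 by (simp add: degree_mult_eq del: mult_pCons_left)
  then obtain k0 r0 where k0: "k0 < n" "shift_op q1 (V k0) r0 \<noteq> 0" using min[of q1] \<open>q1 \<noteq> 0\<close> by force
  have step: "shift_op q1 (V k) (Suc r) = c * shift_op q1 (V k) r" if "k < n" for k r
    using q(2)[OF that, of r] unfolding q1 shift_op_mult by (simp add: shift_op_pCons)
  have "shift_op q1 (V k) r = c ^ r * shift_op q1 (V k) 0" if "k < n" for k r
    by (induction r) (auto simp: step[OF that])
  from this[OF k0(1), of r0] have "shift_op q1 (V k0) 0 \<noteq> 0" using k0(2) by auto
  moreover have "(\<Sum>l<n. A $$ (k, l) * shift_op q1 (V l) 0) = c * shift_op q1 (V k) 0" if k: "k < n" for k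
  proof -
    have "(\<Sum>l<n. A $$ (k, l) * shift_op q1 (V l) 0) = shift_op q1 (\<lambda>r. V k (r + 1)) 0"
      by (simp add: VS[OF k] shift_op_sum_fun shift_op_scale_fun)
    also have "\<dots> = c * shift_op q1 (V k) 0" unfolding shift_op_Suc using step[OF k, of 0] by simp
    finally show ?thesis .
  qed
  moreover have "shift_op q1 (V i) 0 = 0" by (simp add: shift_op_def Vi)
  ultimately show ?thesis using k0(1) by (intro exI[of _ c] exI[of _ "\<lambda>k. shift_op q1 (V k) 0"]) blast
qed

section \<open>Generic observability and controllability of compartmental matrices\<close>

text \<open>A compartmental matrix with all leaks zero: \<open>a k i\<close> is the rate from i to
  k, and every column sums to zero. To show that a determinant is generically nonzero, one such
  matrix suffices.\<close>

definition flow_matrix :: "nat \<Rightarrow> (nat \<Rightarrow> nat \<Rightarrow> 'a :: comm_ring_1) \<Rightarrow> 'a mat" where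
  "flow_matrix n a = Matrix.mat n n (\<lambda>(k, i). if k = i then - (\<Sum>l\<in>{..<n} - {i}. a l i) else a k i)"

lemma flow_matrix_carrier [simp]: "flow_matrix n a \<in> carrier_mat n n"
  by (simp add: flow_matrix_def)

lemma flow_matrix_apply:
  fixes a :: "nat \<Rightarrow> nat \<Rightarrow> 'a :: comm_ring_1"
  assumes "k < n"
  shows "(\<Sum>i<n. flow_matrix n a $$ (k, i) * x i) =
     (\<Sum>i\<in>{..<n} - {k}. a k i * x i) - (\<Sum>l\<in>{..<n} - {k}. a l k) * x k"
proof -
  have "(\<Sum>i<n. flow_matrix n a $$ (k, i) * x i) =
     flow_matrix n a $$ (k, k) * x k + (\<Sum>i\<in>{..<n} - {k}. flow_matrix n a $$ (k, i) * x i)"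
    using assms by (subst sum.remove[of _ k]) auto
  also have "(\<Sum>i\<in>{..<n} - {k}. flow_matrix n a $$ (k, i) * x i) = (\<Sum>i\<in>{..<n} - {k}. a k i * x i)"
    using assms by (intro sum.cong) (auto simp: flow_matrix_def)
  finally show ?thesis using assms by (simp add: flow_matrix_def)
qed

text \<open>A breadth-first tree: d is the distance to r, and f steps to a neighbour closer to
  r.\<close>

lemma rooted_tree_exists:
  fixes E :: "(nat \<times> nat) set"
  assumes E: "E \<subseteq> {..<n} \<times> {..<n}" and reach: "\<And>v. v < n \<Longrightarrow> (v, r) \<in> E\<^sup>*"
  shows "\<exists>f d. (\<forall>v. d (f v) \<le> (d v :: nat)) \<and>
    (\<forall>v<n. v \<noteq> r \<longrightarrow> (v, f v) \<in> E \<and> f v < n \<and> d (f v) < d v)"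
proof -
  define d where "d v = (LEAST k. (v, r) \<in> E ^^ k)" for v
  have dI: "(v, r) \<in> E ^^ d v" if "v < n" for v
    unfolding d_def using reach[OF that] LeastI_ex[of "\<lambda>k. (v, r) \<in> E ^^ k"] rtrancl_imp_relpow by metis
  have ex: "\<exists>w. (v, w) \<in> E \<and> w < n \<and> d w < d v" if v: "v < n" "v \<noteq> r" for v
  proof -
    have "d v \<noteq> 0" using dI[OF v(1)] v(2) by (intro notI) simp
    then obtain k where k: "d v = Suc k" by (metis not0_implies_Suc)
    then obtain w where w: "(v, w) \<in> E" "(w, r) \<in> E ^^ k"
      using dI[OF v(1)] by (metis relpow_Suc_E2)
    moreover have "d w \<le> k" unfolding d_def using w(2) by (rule Least_le)
    ultimately show ?thesis using E k by auto
  qed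
  \<comment> \<open>The default value v, taken at the root and outside the graph, makes
    \<open>d (f v) \<le> d v\<close> hold for all v, so that it can be iterated freely.\<close>
  define f where "f v = (if v < n \<and> v \<noteq> r then SOME w. (v, w) \<in> E \<and> w < n \<and> d w < d v else v)" for v
  have f: "(v, f v) \<in> E \<and> f v < n \<and> d (f v) < d v" if "v < n" "v \<noteq> r" for v
    using someI_ex[OF ex[OF that]] that by (simp add: f_def)
  moreover have "d (f v) \<le> d v" for v
  proof (cases "v < n \<and> v \<noteq> r")
    case True
    then show ?thesis using f less_imp_le by blast
  qed (simp only: f_def if_False order.refl)
  ultimately show ?thesis by blast
qed

text \<open>
  Only the edges of a spanning tree directed towards the root \<open>r\<close> get a nonzero weight, and these
  weights are distinct. The nonzero coordinates of an eigenvector that vanishes at \<open>r\<close> would be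
  ancestors of a single vertex, namely the one whose weight is the negated eigenvalue.
\<close>

lemma observable_weights_exist:
  assumes E: "E \<subseteq> {..<n} \<times> {..<n}" and r: "r < n" and reach: "\<And>v. v < n \<Longrightarrow> (v, r) \<in> E\<^sup>*"
  shows "\<exists>a :: nat \<Rightarrow> nat \<Rightarrow> complex. (\<forall>k i. a k i \<noteq> 0 \<longrightarrow> (i, k) \<in> E) \<and>
     Determinant.det (observability_mat (flow_matrix n a) r) \<noteq> 0"
proof -
  obtain f and d :: "nat \<Rightarrow> nat" where df: "\<And>v. d (f v) \<le> d v"
    and f: "\<And>v. v < n \<Longrightarrow> v \<noteq> r \<Longrightarrow> (v, f v) \<in> E \<and> f v < n \<and> d (f v) < d v"
    using rooted_tree_exists[OF E reach] by metis
  define a :: "nat \<Rightarrow> nat \<Rightarrow> complex" where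
    "a k i = (if i < n \<and> i \<noteq> r \<and> k = f i then of_nat (Suc i) else 0)" for k i
  have fne: "f v \<noteq> v" if "v < n" "v \<noteq> r" for v using f[OF that] by auto
  have out: "(\<Sum>l\<in>{..<n} - {k}. a l k) = (if k = r then 0 else of_nat (Suc k))" if k: "k < n" for k
  proof (cases "k = r")
    case False
    have "(\<Sum>l\<in>{..<n} - {k}. a l k) = (\<Sum>l\<in>{..<n} - {k}. if l = f k then of_nat (Suc k) else 0)"
      using k False by (intro sum.cong) (auto simp: a_def)
    also have "\<dots> = of_nat (Suc k)" using f[OF k False] fne[OF k False] by (subst sum.delta) auto
    finally show ?thesis using False by simp
  qed (simp add: a_def)
  have "Determinant.det (observability_mat (flow_matrix n a) r) \<noteq> 0"
  proof
    assume "Determinant.det (observability_mat (flow_matrix n a) r) = 0"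
    from unobservable_eigenvector[OF flow_matrix_carrier r this]
    obtain c x where x: "\<exists>k<n. x k \<noteq> 0" "x r = 0"
      and eig: "\<And>k. k < n \<Longrightarrow> (\<Sum>l<n. flow_matrix n a $$ (k, l) * x l) = c * x k" by blast
    have eq: "(\<Sum>i\<in>{..<n} - {k}. a k i * x i) - (\<Sum>l\<in>{..<n} - {k}. a l k) * x k = c * x k" if "k < n" for k
      using eig[OF that] unfolding flow_matrix_apply[OF that] .
    \<comment> \<open>At a vertex of the support with no child in the support nothing flows in, and
      the eigenvalue equation reduces to \<open>- (k + 1) x_k = c x_k\<close>.\<close>
    have leaf: "c = - of_nat (Suc k)"
      if k: "k < n" "x k \<noteq> 0" and ch: "\<And>i. i < n \<Longrightarrow> i \<noteq> r \<Longrightarrow> f i = k \<Longrightarrow> x i = 0" for k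
    proof -
      have "(\<Sum>i\<in>{..<n} - {k}. a k i * x i) = 0"
        using ch by (intro sum.neutral) (auto simp: a_def)
      moreover have "k \<noteq> r" using k x(2) by auto
      ultimately have "- (of_nat (Suc k) * x k) = c * x k" using eq[OF k(1)] out[OF k(1)] by simp
      then have "(c + of_nat (Suc k)) * x k = 0" unfolding distrib_right by (metis add.left_inverse)
      then show ?thesis unfolding eq_neg_iff_add_eq_0 using k(2) by (metis mult_eq_0_iff)
    qed
    define B where "B = Max (d ` {..<n})"
    have dB: "d v \<le> B" if "v < n" for v unfolding B_def using that by (intro Max_ge) auto
    \<comment> \<open>Moving away from the root inside the support, d increases but stays below B,
      so one ends at such a vertex; v lies on its path to the root.\<close>
    have leaf_ex: "\<exists>k. k < n \<and> x k \<noteq> 0 \<and> (\<forall>i<n. i \<noteq> r \<longrightarrow> f i = k \<longrightarrow> x i = 0) \<and> (\<exists>m. v = (f ^^ m) k)"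
      if "v < n" "x v \<noteq> 0" for v
      using that
    proof (induction "B - d v" arbitrary: v rule: less_induct)
      case less
      show ?case
      proof (cases "\<forall>i<n. i \<noteq> r \<longrightarrow> f i = v \<longrightarrow> x i = 0")
        case True
        then show ?thesis using less.prems by (intro exI[of _ v]) (auto intro!: exI[of _ 0])
      next
        case False
        then obtain i where i: "i < n" "i \<noteq> r" "f i = v" "x i \<noteq> 0" by blast
        have "d v < d i" using f[OF i(1,2)] i(3) by simp
        then have "B - d i < B - d v" using dB[OF i(1)] by simp
        from less.hyps[OF this i(1,4)] obtain k m where
          "k < n" "x k \<noteq> 0" "\<forall>i<n. i \<noteq> r \<longrightarrow> f i = k \<longrightarrow> x i = 0" "i = (f ^^ m) k" by blast
        then show ?thesis using i(3) by (intro exI[of _ k]) (auto intro!: exI[of _ "Suc m"])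
      qed
    qed
    obtain k0 where k0: "c = - of_nat (Suc k0)" using leaf leaf_ex x(1) by metis
    have anc: "\<exists>m. v = (f ^^ m) k0" if v: "v < n" "x v \<noteq> 0" for v
    proof -
      obtain k m where k: "k < n" "x k \<noteq> 0" "\<forall>i<n. i \<noteq> r \<longrightarrow> f i = k \<longrightarrow> x i = 0" "v = (f ^^ m) k"
        using leaf_ex[OF v] by blast
      then have "c = - of_nat (Suc k)" using leaf by blast
      then have "k = k0" using k0 by (metis neg_equal_iff_equal of_nat_eq_iff Suc_inject)
      then show ?thesis using k(4) by blast
    qed
    have dpow: "d ((f ^^ m) v) \<le> d v" for m v
      by (induction m) (use df order_trans in auto)
    \<comment> \<open>Two vertices on one path to the root cannot have the same parent: the later
      one would be reached from its own parent, which is strictly closer to the root.\<close>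
    have sib: False if uv: "u = (f ^^ m) k0" "v = (f ^^ m') k0" "m < m'" "f u = f v" "v < n" "v \<noteq> r" for u v m m'
    proof -
      obtain l where l: "m' = Suc (l + m)" using uv(3) by (metis less_iff_Suc_add add.commute)
      have "v = (f ^^ l) (f u)" unfolding uv(1,2) l by (simp add: funpow_add funpow_swap1)
      then have "d v \<le> d (f v)" using dpow[of l "f u"] uv(4) by simp
      then show False using f[OF uv(5,6)] by simp
    qed
    let ?N = "{v. v < n \<and> x v \<noteq> 0}"
    \<comment> \<open>w is a vertex of the support closest to the root, so its parent has coordinate
      zero and the equation there says that the inflow vanishes. By \<open>sib\<close> no sibling of
      w is in the support, so the inflow is the single nonzero term from w.\<close>
    obtain w where w: "w < n" "x w \<noteq> 0" and wmin: "\<And>v. v < n \<Longrightarrow> x v \<noteq> 0 \<Longrightarrow> d w \<le> d v"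
      using x(1) arg_min_nat_lemma[of "\<lambda>v. v < n \<and> x v \<noteq> 0" _ d] by blast
    have wr: "w \<noteq> r" using w x(2) by auto
    note fw = f[OF w(1) wr]
    have xfw: "x (f w) = 0" using fw wmin[of "f w"] by force
    then have s0: "(\<Sum>i\<in>{..<n} - {f w}. a (f w) i * x i) = 0" using eq[of "f w"] fw by simp
    have "(\<Sum>i\<in>{..<n} - {f w}. a (f w) i * x i) = a (f w) w * x w"
    proof (rule sum.remove[THEN trans])
      show "w \<in> {..<n} - {f w}" using w(1) fne[OF w(1) wr] by auto
      have "a (f w) i * x i = 0" if i: "i \<in> {..<n} - {f w} - {w}" for i
      proof (rule ccontr)
        assume "a (f w) i * x i \<noteq> 0"
        then have i': "i < n" "i \<noteq> r" "f i = f w" "x i \<noteq> 0" "i \<noteq> w" using i by (auto simp: a_def split: if_splits)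
        obtain m m' where m: "i = (f ^^ m) k0" "w = (f ^^ m') k0" using anc[OF i'(1,4)] anc[OF w] by blast
        then have "m \<noteq> m'" using i'(5) by auto
        then show False using sib[OF m(1,2)] sib[OF m(2,1)] i' w(1) wr by force
      qed
      then show "a (f w) w * x w + (\<Sum>i\<in>{..<n} - {f w} - {w}. a (f w) i * x i) = a (f w) w * x w"
        by (simp add: sum.neutral)
    qed simp
    moreover have "a (f w) w = of_nat (Suc w)" using w(1) wr by (simp add: a_def)
    ultimately show False using s0 w(2) by (metis mult_eq_0_iff of_nat_neq_0)
  qed
  moreover have "(i, k) \<in> E" if "a k i \<noteq> 0" for k i
    using that f by (auto simp: a_def split: if_splits)
  ultimately show ?thesis by blast
qed

text \<open>Perron-Frobenius in this special case. The matrix is singular; let y be the absolute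
  values of a kernel vector. The triangle inequality gives outflow \<le> inflow at every vertex, and
  both have the same total, so equality holds everywhere. A vertex with y = 0 would have no inflow,
  hence positivity spreads along edges, and strong connectivity carries it to all vertices.\<close>

lemma positive_equilibrium_exists:
  fixes a :: "nat \<Rightarrow> nat \<Rightarrow> real"
  assumes n: "n > 0" and a0: "\<And>k i. a k i \<ge> 0"
    and conn: "\<And>i k. i < n \<Longrightarrow> k < n \<Longrightarrow> (i, k) \<in> E\<^sup>*"
    and E: "\<And>i k. (i, k) \<in> E \<Longrightarrow> i < n \<and> k < n \<and> i \<noteq> k \<and> a k i > 0"
  shows "\<exists>y. (\<forall>k<n. y k > 0) \<and>
     (\<forall>k<n. (\<Sum>i\<in>{..<n} - {k}. a k i * y i) = (\<Sum>l\<in>{..<n} - {k}. a l k) * y k)"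
proof -
  let ?a = "\<lambda>k i. complex_of_real (a k i)"
  let ?A = "flow_matrix n ?a"
  define out where "out k = (\<Sum>l\<in>{..<n} - {k}. a l k)" for k
  \<comment> \<open>The all-ones vector lies in the kernel of the transpose, since columns sum to
    zero.\<close>
  have "(\<Sum>k<n. transpose_mat ?A $$ (i, k) * 1) = 0" if i: "i < n" for i
  proof -
    have "(\<Sum>k<n. transpose_mat ?A $$ (i, k) * 1) = ?A $$ (i, i) + (\<Sum>k\<in>{..<n} - {i}. ?A $$ (k, i))"
      using i by (subst sum.remove[of _ i]) (auto simp: flow_matrix_def)
    also have "(\<Sum>k\<in>{..<n} - {i}. ?A $$ (k, i)) = (\<Sum>k\<in>{..<n} - {i}. ?a k i)"
      using i by (intro sum.cong) (auto simp: flow_matrix_def)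
    finally show ?thesis using i by (simp add: flow_matrix_def)
  qed
  moreover have "transpose_mat ?A \<in> carrier_mat n n" by simp
  ultimately have "\<not> Determinant.det (transpose_mat ?A) \<noteq> 0"
    unfolding det_nonzero_iff[OF \<open>transpose_mat ?A \<in> carrier_mat n n\<close>]
    using n by (intro notI) (drule spec[of _ "\<lambda>_. 1"], simp)
  then have "\<not> Determinant.det ?A \<noteq> 0" using det_transpose[OF flow_matrix_carrier[of n ?a]] by simp
  then obtain x where x: "\<And>k. k < n \<Longrightarrow> (\<Sum>i<n. ?A $$ (k, i) * x i) = 0" "\<exists>k<n. x k \<noteq> 0"
    using det_nonzero_iff[OF flow_matrix_carrier[of n ?a]] by blast
  define y where "y k = cmod (x k)" for k
  have y0: "y k \<ge> 0" for k by (simp add: y_def)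
  have out0: "out k \<ge> 0" for k unfolding out_def by (intro sum_nonneg a0)
  have le: "out k * y k \<le> (\<Sum>i\<in>{..<n} - {k}. a k i * y i)" if k: "k < n" for k
  proof -
    have "(\<Sum>i\<in>{..<n} - {k}. ?a k i * x i) = complex_of_real (out k) * x k"
      using x(1)[OF k] unfolding flow_matrix_apply[OF k] by (simp add: out_def)
    then have "out k * y k = cmod (\<Sum>i\<in>{..<n} - {k}. ?a k i * x i)"
      using out0[of k] by (simp add: norm_mult y_def)
    also have "\<dots> \<le> (\<Sum>i\<in>{..<n} - {k}. cmod (?a k i * x i))" by (rule norm_sum)
    also have "\<dots> = (\<Sum>i\<in>{..<n} - {k}. a k i * y i)" by (simp add: norm_mult y_def a0)
    finally show ?thesis .
  qed
  have "(\<Sum>k<n. \<Sum>i\<in>{..<n} - {k}. a k i * y i) = (\<Sum>k<n. \<Sum>i<n. if i \<noteq> k then a k i * y i else 0)"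
    by (intro sum.cong refl sum.mono_neutral_cong_left) auto
  also have "\<dots> = (\<Sum>i<n. \<Sum>k<n. if i \<noteq> k then a k i * y i else 0)" by (rule sum.swap)
  also have "\<dots> = (\<Sum>i<n. \<Sum>k\<in>{..<n} - {i}. a k i * y i)"
    by (intro sum.cong refl sum.mono_neutral_cong_right) auto
  also have "\<dots> = (\<Sum>i<n. out i * y i)" by (simp add: out_def sum_distrib_right)
  finally have tot: "(\<Sum>k<n. (\<Sum>i\<in>{..<n} - {k}. a k i * y i) - out k * y k) = 0"
    by (simp add: sum_subtractf)
  have "(\<Sum>i\<in>{..<n} - {k}. a k i * y i) - out k * y k = 0" if "k < n" for k
    using iffD1[OF sum_nonneg_eq_0_iff, OF _ _ tot] le that by simp
  then have eq: "(\<Sum>i\<in>{..<n} - {k}. a k i * y i) = out k * y k" if "k < n" for k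
    using that by simp
  have pos_step: "y k > 0" if ik: "(i, k) \<in> E" and i: "y i > 0" for i k
  proof (rule ccontr)
    assume "\<not> y k > 0"
    then have "y k = 0" using y0[of k] by simp
    then have "(\<Sum>i\<in>{..<n} - {k}. a k i * y i) = 0" using eq[of k] E[OF ik] by simp
    moreover have "i \<in> {..<n} - {k}" using E[OF ik] by auto
    moreover have "a k i * y i > 0" using E[OF ik] i by simp
    moreover from \<open>i \<in> {..<n} - {k}\<close> have "a k i * y i \<le> (\<Sum>i\<in>{..<n} - {k}. a k i * y i)"
      by (rule member_le_sum) (auto intro: mult_nonneg_nonneg a0 y0)
    ultimately show False by linarith
  qed
  obtain m where m: "m < n" "y m > 0" using x(2) by (auto simp: y_def)
  have "y k > 0" if "k < n" for k
    using conn[OF m(1) that] m(2) by (induction rule: rtrancl_induct) (use pos_step in auto)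
  then show ?thesis using eq unfolding out_def by blast
qed

text \<open>
  Time reversal of a Markov chain: conjugating the transpose of the reversed system by its
  equilibrium \<open>y\<close> gives a system on the original graph, and exchanges observability with
  controllability.
\<close>

lemma controllable_by_time_reversal:
  fixes a :: "nat \<Rightarrow> nat \<Rightarrow> complex" and y :: "nat \<Rightarrow> complex"
  assumes j: "j < n" and y: "\<And>k. k < n \<Longrightarrow> y k \<noteq> 0"
    and eq: "\<And>k. k < n \<Longrightarrow> (\<Sum>i\<in>{..<n} - {k}. a k i * y i) = (\<Sum>l\<in>{..<n} - {k}. a l k) * y k"
    and obs: "Determinant.det (observability_mat (flow_matrix n a) j) \<noteq> 0"
  shows "Determinant.det (controllability_mat (flow_matrix n (\<lambda>k i. y k * a i k / y i)) j) \<noteq> 0"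
proof -
  let ?b = "\<lambda>k i. y k * a i k / y i"
  let ?A = "flow_matrix n a" and ?B = "flow_matrix n ?b"
  \<comment> \<open>That is, B = Y A^T Y^(-1) with Y = diag(y). Off the diagonal this is the
    definition of the new rates; on the diagonal it is the equilibrium equation.\<close>
  have entry: "?B $$ (k, i) * y i = y k * ?A $$ (i, k)" if "k < n" "i < n" for k i
  proof (cases "k = i")
    case True
    have "(\<Sum>l\<in>{..<n} - {i}. ?b l i) * y i = (\<Sum>l\<in>{..<n} - {i}. a i l * y l)"
      unfolding sum_distrib_right using y[OF that(2)] by (intro sum.cong) (auto simp: field_simps)
    then show ?thesis using True that eq[OF that(2)] by (simp add: flow_matrix_def mult.commute)
  next
    case False
    then show ?thesis using that y[OF that(2)] by (simp add: flow_matrix_def)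
  qed
  have pow: "power_entry ?B r k i * y i = y k * power_entry ?A r i k" if "k < n" "i < n" for k i r
    using that
  proof (induction r arbitrary: k)
    case 0
    then show ?case by (simp add: power_entry_0[OF flow_matrix_carrier])
  next
    case (Suc r)
    have "power_entry ?B (Suc r) k i * y i = (\<Sum>l<n. ?B $$ (k, l) * (power_entry ?B r l i * y i))"
      unfolding power_entry_Suc[OF flow_matrix_carrier Suc.prems] by (simp add: sum_distrib_right mult.assoc)
    also have "\<dots> = (\<Sum>l<n. (?B $$ (k, l) * y l) * power_entry ?A r i l)"
      using Suc.IH Suc.prems by (simp add: mult.assoc)
    also have "\<dots> = y k * (\<Sum>l<n. power_entry ?A r i l * ?A $$ (l, k))"
      using entry Suc.prems by (simp add: sum_distrib_left mult_ac)
    finally show ?case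
      unfolding power_entry_Suc2[OF flow_matrix_carrier[of n a] Suc.prems(2,1), of r] .
  qed
  show ?thesis
    unfolding det_nonzero_iff[OF controllability_mat_carrier[OF flow_matrix_carrier]]
  proof (intro allI impI)
    fix v r assume v: "\<forall>k<n. (\<Sum>r<n. controllability_mat ?B j $$ (k, r) * v r) = 0" and r: "r < n"
    show "v r = 0"
    proof (rule observability_rowsD[OF flow_matrix_carrier obs _ r])
      fix k assume k: "k < n"
      have "0 = (\<Sum>r<n. power_entry ?B r k j * v r) * y j"
        using v k carrier_matD[OF flow_matrix_carrier[of n ?b]] by (simp add: controllability_mat_def)
      also have "\<dots> = (\<Sum>r<n. (power_entry ?B r k j * y j) * v r)"
        by (simp add: sum_distrib_left sum_distrib_right mult_ac)
      also have "\<dots> = y k * (\<Sum>r<n. power_entry ?A r j k * v r)"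
        unfolding pow[OF k j] by (simp add: sum_distrib_left mult.assoc)
      finally show "(\<Sum>r<n. power_entry ?A r j k * v r) = 0" using y[OF k] by simp
    qed
  qed
qed

section \<open>Germs of analytic functions and linear differential equations\<close>

text \<open>Derivatives instead of Taylor coefficients, so that differentiation is exactly the index
  shift, without factors.\<close>

definition jet :: "(complex \<Rightarrow> complex) \<Rightarrow> nat \<Rightarrow> complex" where
  "jet f k = (deriv ^^ k) f 0"

lemma jet_expansion: "f has_fps_expansion F \<Longrightarrow> jet f k = fact k * fps_nth F k"
  by (simp add: jet_def fps_nth_fps_expansion)

lemma germ_eq_expansion:
  assumes "f has_fps_expansion F" "g has_fps_expansion F"
  shows "germ_eq f g"
  using assms unfolding has_fps_expansion_def germ_eq_def by (auto elim: eventually_elim2)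

lemma jet_cong: "germ_eq f g \<Longrightarrow> jet f = jet g"
  unfolding germ_eq_def jet_def by (auto intro!: ext higher_deriv_cong_ev)

lemma germ_eq_jet:
  assumes "f analytic_on {0}" "g analytic_on {0}"
  shows "germ_eq f g \<longleftrightarrow> jet f = jet g"
proof
  assume "jet f = jet g"
  then have "fps_expansion f 0 = fps_expansion g 0"
    by (simp add: fps_expansion_def jet_def fun_eq_iff)
  then show "germ_eq f g"
    using assms analytic_at_imp_has_fps_expansion_0 germ_eq_expansion by metis
qed (rule jet_cong)

lemma jet_deriv: "jet (deriv f) k = jet f (Suc k)"
  by (simp add: jet_def funpow_swap1)

lemma jet_higher_deriv: "jet ((deriv ^^ k) f) r = jet f (r + k)"
  by (simp add: jet_def funpow_add)

lemma analytic_higher_deriv: "f analytic_on {0} \<Longrightarrow> (deriv ^^ k) f analytic_on {0}"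
  by (induction k) (auto intro: analytic_deriv)

lemma jet_linear:
  assumes "\<And>j. j \<in> S \<Longrightarrow> f j analytic_on {0}"
  shows "jet (\<lambda>t. \<Sum>j\<in>S. c j * f j t) k = (\<Sum>j\<in>S. c j * jet (f j) k)"
proof -
  have "(\<lambda>t. \<Sum>j\<in>S. c j * f j t) has_fps_expansion (\<Sum>j\<in>S. fps_const (c j) * fps_expansion (f j) 0)"
    by (intro fps_expansion_intros analytic_at_imp_has_fps_expansion_0 assms)
  from jet_expansion[OF this, of k] have "jet (\<lambda>t. \<Sum>j\<in>S. c j * f j t) k =
      (\<Sum>j\<in>S. c j * (fact k * fps_nth (fps_expansion (f j) 0) k))"
    by (simp add: fps_sum_nth sum_distrib_left mult.left_commute)
  also have "\<dots> = (\<Sum>j\<in>S. c j * jet (f j) k)"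
    by (simp add: fps_expansion_def jet_def)
  finally show ?thesis .
qed

lemma jet_0 [simp]: "jet (\<lambda>t. 0) k = 0"
  using jet_linear[of "{}"] by simp

lemma jet_cmult: "f analytic_on {0} \<Longrightarrow> jet (\<lambda>t. c * f t) k = c * jet f k"
  using jet_linear[of "{()}" "\<lambda>_. f" "\<lambda>_. c" k] by simp

lemma jet_add:
  assumes "f analytic_on {0}" "g analytic_on {0}"
  shows "jet (\<lambda>t. f t + g t) k = jet f k + jet g k"
  using jet_linear[of "{True, False}" "\<lambda>b. if b then f else g" "\<lambda>_. 1" k] assms by simp

lemma jet_diff:
  assumes "f analytic_on {0}" "g analytic_on {0}"
  shows "jet (\<lambda>t. f t - g t) k = jet f k - jet g k"
  using jet_linear[of "{True, False}" "\<lambda>b. if b then f else g" "\<lambda>b. if b then 1 else - 1" k] assms by simp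

section \<open>Geometric bounds on power series and solvability of linear systems\<close>

lemma fps_bound_of_conv_radius:
  fixes F :: "complex fps"
  assumes "fps_conv_radius F > 0"
  shows "\<exists>C s. s > 0 \<and> C \<ge> 0 \<and> (\<forall>k. norm (fps_nth F k) \<le> C * s ^ k)"
proof -
  obtain r where r: "0 < ereal r" "ereal r < fps_conv_radius F"
    using ereal_dense2[OF assms] by (auto simp: zero_ereal_def)
  have "summable (\<lambda>n. fps_nth F n * of_real r ^ n)"
    by (rule summable_fps) (use r in simp)
  then have "(\<lambda>n. fps_nth F n * of_real r ^ n) \<longlonglongrightarrow> 0" by (rule summable_LIMSEQ_zero)
  then have "Bseq (\<lambda>n. fps_nth F n * of_real r ^ n)" by (intro convergent_imp_Bseq) (auto simp: convergent_def)
  then obtain K where K: "K > 0" "\<And>n. norm (fps_nth F n * of_real r ^ n) \<le> K"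
    by (auto elim: BseqE)
  have "norm (fps_nth F k) \<le> K * (1 / r) ^ k" for k
    using K(2)[of k] r by (simp add: norm_mult norm_power power_divide field_simps)
  then show ?thesis using r K(1) by (intro exI[of _ K] exI[of _ "1 / r"]) auto
qed

lemma conv_radius_of_fps_bound:
  fixes F :: "complex fps"
  assumes s: "s > 0" and b: "\<And>k. norm (fps_nth F k) \<le> C * s ^ k"
  shows "fps_conv_radius F > 0"
proof -
  let ?z = "complex_of_real (1 / (2 * s))"
  have "summable (\<lambda>n. fps_nth F n * ?z ^ n)"
  proof (rule summable_comparison_test')
    show "summable (\<lambda>n. C * (1 / 2 :: real) ^ n)" by (intro summable_mult summable_geometric) simp
    show "norm (fps_nth F n * ?z ^ n) \<le> C * (1 / 2) ^ n" if "n \<ge> 0" for n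
    proof -
      have "norm (fps_nth F n * ?z ^ n) = norm (fps_nth F n) * (1 / (2 * s)) ^ n"
        using s by (simp add: norm_mult norm_power norm_divide)
      also have "\<dots> \<le> C * s ^ n * (1 / (2 * s)) ^ n" using b s by (intro mult_right_mono) auto
      also have "\<dots> = C * (1 / 2) ^ n" using s by (simp add: field_simps)
      finally show ?thesis .
    qed
  qed
  from conv_radius_geI[OF this] have "ereal (norm ?z) \<le> fps_conv_radius F" by (simp add: fps_conv_radius_def)
  moreover have "0 < ereal (norm ?z)" using s by simp
  ultimately show ?thesis by (rule less_le_trans[rotated])
qed

lemma uniform_fps_bound:
  fixes F :: "'i \<Rightarrow> complex fps"
  assumes "finite S" "\<And>i. i \<in> S \<Longrightarrow> fps_conv_radius (F i) > 0"
  shows "\<exists>C s. s > 0 \<and> C \<ge> 0 \<and> (\<forall>i\<in>S. \<forall>k. norm (fps_nth (F i) k) \<le> C * s ^ k)"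
  using assms
proof (induction S rule: finite_induct)
  case empty
  then show ?case by (intro exI[of _ 0] exI[of _ 1]) auto
next
  case (insert i S)
  obtain C s where 1: "s > 0" "C \<ge> 0" "\<And>j k. j \<in> S \<Longrightarrow> norm (fps_nth (F j) k) \<le> C * s ^ k"
    using insert.IH insert.prems by auto
  obtain D t where 2: "t > 0" "D \<ge> 0" "\<And>k. norm (fps_nth (F i) k) \<le> D * t ^ k"
    using fps_bound_of_conv_radius insert.prems by blast
  have le: "C * s ^ k \<le> max C D * max s t ^ k" "D * t ^ k \<le> max C D * max s t ^ k" for k
    using 1 2 by (auto intro!: mult_mono power_mono)
  have "norm (fps_nth (F j) k) \<le> max C D * max s t ^ k" if "j \<in> insert i S" for j k
  proof (cases "j = i")
    case True
    then show ?thesis using order_trans[OF 2(3) le(2)] by simp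
  next
    case False
    then show ?thesis using order_trans[OF 1(3) le(1)] that by simp
  qed
  then show ?case using 1 2 by (intro exI[of _ "max C D"] exI[of _ "max s t"]) auto
qed

text \<open>The recursion for the power series coefficients is bounded by
  \<open>D * \<sigma> ^ k\<close>. In \<sigma> = s + \<alpha> + 1, the summand s dominates the
  growth of the inhomogeneity, \<alpha> bounds the action of A, and 1 absorbs the added
  inhomogeneous term; division by k + 1 only helps.\<close>

lemma linear_ode_exists:
  fixes A :: "'i \<Rightarrow> 'i \<Rightarrow> complex"
  assumes S: "finite S" and g: "\<And>i. i \<in> S \<Longrightarrow> g i analytic_on {0}"
  shows "\<exists>x. \<forall>i\<in>S. x i analytic_on {0} \<and> x i 0 = x0 i \<and>
     germ_eq (deriv (x i)) (\<lambda>t. (\<Sum>j\<in>S. A i j * x j t) + g i t)"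
proof -
  define G where "G i = fps_expansion (g i) 0" for i
  have G: "g i has_fps_expansion G i" if "i \<in> S" for i
    unfolding G_def by (intro analytic_at_imp_has_fps_expansion_0 g that)
  obtain C s where Cs: "s > 0" "C \<ge> 0" "\<And>i k. i \<in> S \<Longrightarrow> norm (fps_nth (G i) k) \<le> C * s ^ k"
    using uniform_fps_bound[OF S, of G] G unfolding has_fps_expansion_def by blast
  define a where "a = rec_nat x0 (\<lambda>k c i. ((\<Sum>j\<in>S. A i j * c j) + fps_nth (G i) k) / of_nat (Suc k))"
  have a0: "a 0 = x0" and aS: "a (Suc k) i = ((\<Sum>j\<in>S. A i j * a k j) + fps_nth (G i) k) / of_nat (Suc k)" for k i
    by (simp_all add: a_def)
  define \<alpha> where "\<alpha> = (\<Sum>i\<in>S. \<Sum>j\<in>S. norm (A i j))"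
  define D where "D = C + (\<Sum>i\<in>S. norm (x0 i))"
  define \<sigma> where "\<sigma> = s + \<alpha> + 1"
  have \<alpha>0: "\<alpha> \<ge> 0" unfolding \<alpha>_def by (intro sum_nonneg) auto
  have D0: "D \<ge> C" unfolding D_def by (simp add: sum_nonneg)
  have \<alpha>i: "(\<Sum>j\<in>S. norm (A i j)) \<le> \<alpha>" if "i \<in> S" for i
    unfolding \<alpha>_def by (rule member_le_sum[OF that]) (auto intro: sum_nonneg S)
  have bound: "norm (a k i) \<le> D * \<sigma> ^ k" if "i \<in> S" for k i
    using that
  proof (induction k arbitrary: i)
    case 0
    have "norm (x0 i) \<le> (\<Sum>i\<in>S. norm (x0 i))" by (rule member_le_sum[OF 0]) (auto intro: S)
    then show ?case using Cs by (simp add: a0 D_def)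
  next
    case (Suc k)
    have p: "D * \<sigma> ^ k \<ge> 0" using D0 Cs \<alpha>0 by (simp add: \<sigma>_def)
    have "norm (\<Sum>j\<in>S. A i j * a k j) \<le> (\<Sum>j\<in>S. norm (A i j) * (D * \<sigma> ^ k))"
      by (rule order_trans[OF norm_sum]) (auto simp: norm_mult intro!: sum_mono mult_left_mono Suc.IH)
    also have "\<dots> \<le> \<alpha> * (D * \<sigma> ^ k)"
      unfolding sum_distrib_right[symmetric] using \<alpha>i[OF Suc.prems] p by (rule mult_right_mono)
    finally have 1: "norm (\<Sum>j\<in>S. A i j * a k j) \<le> \<alpha> * (D * \<sigma> ^ k)" .
    have "norm (fps_nth (G i) k) \<le> C * s ^ k" by (rule Cs(3)[OF Suc.prems])
    also have "\<dots> \<le> D * \<sigma> ^ k" using D0 Cs \<alpha>0 by (intro mult_mono power_mono) (auto simp: \<sigma>_def)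
    finally have 2: "norm (fps_nth (G i) k) \<le> D * \<sigma> ^ k" .
    let ?e = "(\<Sum>j\<in>S. A i j * a k j) + fps_nth (G i) k"
    have "norm (a (Suc k) i) = norm ?e / real (Suc k)" unfolding aS norm_divide norm_of_nat ..
    also have "\<dots> \<le> norm ?e" using divide_left_mono[of 1 "real (Suc k)" "norm ?e"] by simp
    also have "\<dots> \<le> (\<alpha> + 1) * (D * \<sigma> ^ k)"
      using norm_triangle_ineq[of "\<Sum>j\<in>S. A i j * a k j" "fps_nth (G i) k"] 1 2 by (simp add: distrib_right)
    also have "\<dots> \<le> \<sigma> * (D * \<sigma> ^ k)" using p Cs by (intro mult_right_mono) (auto simp: \<sigma>_def)
    finally show ?case by (simp add: mult_ac)
  qed
  define F where "F i = Abs_fps (\<lambda>k. a k i)" for i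
  define x where "x i = eval_fps (F i)" for i
  have F: "x i has_fps_expansion F i" if "i \<in> S" for i
    unfolding x_def
  proof (intro eval_fps_has_fps_expansion conv_radius_of_fps_bound)
    show "\<sigma> > 0" using Cs \<alpha>0 by (simp add: \<sigma>_def)
    show "norm (fps_nth (F i) k) \<le> D * \<sigma> ^ k" for k using bound[OF that] by (simp add: F_def)
  qed
  show ?thesis
  proof (intro exI[of _ x] ballI conjI)
    fix i assume i: "i \<in> S"
    show "x i analytic_on {0}" by (rule has_fps_expansion_imp_analytic_0[OF F[OF i]])
    show "x i 0 = x0 i" by (simp add: x_def eval_fps_at_0 F_def a0)
    have 1: "deriv (x i) has_fps_expansion fps_deriv (F i)"
      by (intro fps_expansion_intros F i)
    have 2: "(\<lambda>t. (\<Sum>j\<in>S. A i j * x j t) + g i t) has_fps_expansion (\<Sum>j\<in>S. fps_const (A i j) * F j) + G i"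
      by (intro fps_expansion_intros F G i)
    have "fps_deriv (F i) = (\<Sum>j\<in>S. fps_const (A i j) * F j) + G i"
    proof (rule fps_ext)
      fix k
      have "fps_nth (fps_deriv (F i)) k = of_nat (Suc k) * a (Suc k) i" by (simp add: F_def)
      also have "\<dots> = (\<Sum>j\<in>S. A i j * a k j) + fps_nth (G i) k"
        unfolding aS by (simp del: of_nat_Suc)
      also have "\<dots> = fps_nth ((\<Sum>j\<in>S. fps_const (A i j) * F j) + G i) k"
        by (simp add: fps_sum_nth F_def)
      finally show "fps_nth (fps_deriv (F i)) k = \<dots>" .
    qed
    with 1 2 show "germ_eq (deriv (x i)) (\<lambda>t. (\<Sum>j\<in>S. A i j * x j t) + g i t)"
      using germ_eq_expansion by metis
  qed
qed

section \<open>The model at a parameter value\<close>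

definition compartment_matrix_at :: "compartment_model \<Rightarrow> (nat \<Rightarrow> complex) \<Rightarrow> complex mat" where
  "compartment_matrix_at M \<mu> = Matrix.mat (num_states M) (num_states M)
     (\<lambda>(r, s). rf_eval (params M) (compartment_entry M (Suc r) (Suc s)) \<mu>)"

definition input_coeff_at :: "compartment_model \<Rightarrow> (nat \<Rightarrow> complex) \<Rightarrow> nat \<Rightarrow> complex" where
  "input_coeff_at M \<mu> i = rf_eval (params M) (input_coeff M i) \<mu>"

definition output_coeff_at :: "compartment_model \<Rightarrow> (nat \<Rightarrow> complex) \<Rightarrow> nat \<Rightarrow> complex" where
  "output_coeff_at M \<mu> i = rf_eval (params M) (output_coeff M i) \<mu>"

text \<open>Over the characteristic polynomial, this is the transfer function from input j to output
  i, scaled by both coefficients. The index shift passes from vertices to matrix positions.\<close>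

definition transfer_numerator :: "compartment_model \<Rightarrow> nat \<Rightarrow> nat \<Rightarrow> ratfun poly" where
  "transfer_numerator M i j = Polynomial.smult (output_coeff M i * input_coeff M j)
     (adj_mat (char_poly_matrix (compartment_matrix M)) $$ (i - 1, j - 1))"

definition transfer_numerator_at ::
    "compartment_model \<Rightarrow> (nat \<Rightarrow> complex) \<Rightarrow> nat \<Rightarrow> nat \<Rightarrow> complex poly" where
  "transfer_numerator_at M \<mu> i j = Polynomial.smult (output_coeff_at M \<mu> i * input_coeff_at M \<mu> j)
     (adj_mat (char_poly_matrix (compartment_matrix_at M \<mu>)) $$ (i - 1, j - 1))"

lemma compartment_matrix_carrier [simp]:
  "compartment_matrix M \<in> carrier_mat (num_states M) (num_states M)"
  "compartment_matrix_at M \<mu> \<in> carrier_mat (num_states M) (num_states M)"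
  by (simp_all add: compartment_matrix_def compartment_matrix_at_def)

locale compartment =
  fixes M :: compartment_model
  assumes model: "linear_compartment_model M"
begin

abbreviation "X \<equiv> params M"
abbreviation "n \<equiv> num_states M"

lemma finite_sets: "finite (states M)" "finite (inputs M)" "finite (outputs M)" "finite X"
  and subsets: "inputs M \<subseteq> states M" "outputs M \<subseteq> states M" "leaks M \<subseteq> states M"
  using model finite_subset by (auto simp: states_def outputs_def params_def linear_compartment_model_def)

lemma states_eq: "states M = Suc ` {..<n}"
  by (auto simp: states_def image_def) (metis Suc_pred less_eq_Suc_le lessThan_iff)

lemma sum_states: "(\<Sum>i\<in>states M. f i) = (\<Sum>i<n. f (Suc i))"
  unfolding states_eq by (subst sum.reindex) auto

lemma edge_states: "(i, k) \<in> parcs (graph M) \<Longrightarrow> i \<in> states M \<and> k \<in> states M \<and> i \<noteq> k"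
proof -
  interpret pair_digraph "graph M" using model by (simp add: linear_compartment_model_def)
  assume e: "(i, k) \<in> parcs (graph M)"
  have "pverts (graph M) = states M" using model by (simp add: linear_compartment_model_def)
  then show "i \<in> states M \<and> k \<in> states M \<and> i \<noteq> k"
    using in_arcsD1[OF e] in_arcsD2[OF e] pair_no_loops[OF e] by simp
qed

lemma rate_index_edge: "(i, k) \<in> parcs (graph M) \<Longrightarrow> rate_index M k i \<in> X"
  and rate_index_leak: "i \<in> leaks M \<Longrightarrow> rate_index M 0 i \<in> X"
proof -
  have *: "(\<lambda>(j, i). rate_index M j i) ` rates M \<subseteq> X" using model by (simp add: linear_compartment_model_def)
  have "rate_index M a b \<in> X" if "(a, b) \<in> rates M" for a b
    using subsetD[OF * imageI[OF that]] by simp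
  then show "(i, k) \<in> parcs (graph M) \<Longrightarrow> rate_index M k i \<in> X" "i \<in> leaks M \<Longrightarrow> rate_index M 0 i \<in> X"
    by (simp_all add: rates_def)
qed

definition entry_at :: "(nat \<Rightarrow> complex) \<Rightarrow> nat \<Rightarrow> nat \<Rightarrow> complex" where
  "entry_at \<mu> i j = (if i = j then
        - (if i \<in> leaks M then \<mu> (rate_index M 0 i) else 0)
        - (\<Sum>k | (i, k) \<in> parcs (graph M). \<mu> (rate_index M k i))
      else if (j, i) \<in> parcs (graph M) then \<mu> (rate_index M i j) else 0)"

text \<open>The entries are linear forms in the parameters, so they are defined at every \<mu>; only
  the input and output coefficients restrict the domain.\<close>

lemma rf_value_entry: "rf_value X (compartment_entry M i j) \<mu> (entry_at \<mu> i j)"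
  unfolding compartment_entry_def entry_at_def rate_def
  by (auto intro!: rfv.diff rfv.uminus rfv.sum rfv.zero rf_value_var rate_index_edge rate_index_leak)

lemma rf_eval_entry: "rf_eval X (compartment_entry M i j) \<mu> = entry_at \<mu> i j"
  by (rule rf_eval_eqI[OF rf_value_entry])

lemma compartment_matrix_at_entry:
  "r < n \<Longrightarrow> s < n \<Longrightarrow> compartment_matrix_at M \<mu> $$ (r, s) = entry_at \<mu> (Suc r) (Suc s)"
  by (simp add: compartment_matrix_at_def rf_eval_entry)

lemma rf_value_matrix:
  "r < n \<Longrightarrow> s < n \<Longrightarrow>
   rf_value X (compartment_matrix M $$ (r, s)) \<mu> (compartment_matrix_at M \<mu> $$ (r, s))"
  by (simp add: compartment_matrix_at_def rf_eval_entry compartment_matrix_def rf_value_entry)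

lemmas rf_value_det_observability =
  rfv.det_observability_rel[OF compartment_matrix_carrier rf_value_matrix]

lemmas rf_value_det_controllability =
  rfv.det_controllability_rel[OF compartment_matrix_carrier rf_value_matrix]

lemma char_poly_matrix_at_rel:
  "r < n \<Longrightarrow> s < n \<Longrightarrow> poly_rel (\<lambda>h w. rf_value X h \<mu> w)
     (char_poly_matrix (compartment_matrix M) $$ (r, s))
     (char_poly_matrix (compartment_matrix_at M \<mu>) $$ (r, s))"
  by (rule rfv.char_poly_matrix_rel[OF compartment_matrix_carrier rf_value_matrix])

lemma char_poly_at_rel:
  "poly_rel (\<lambda>h w. rf_value X h \<mu> w) (char_poly (compartment_matrix M)) (char_poly (compartment_matrix_at M \<mu>))"
  unfolding char_poly_def by (rule rfvp.det[of _ n]) (auto intro: char_poly_matrix_at_rel)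

lemma adj_mat_at_rel:
  assumes "r < n" "s < n"
  shows "poly_rel (\<lambda>h w. rf_value X h \<mu> w)
     (adj_mat (char_poly_matrix (compartment_matrix M)) $$ (r, s))
     (adj_mat (char_poly_matrix (compartment_matrix_at M \<mu>)) $$ (r, s))"
proof -
  note c = char_poly_matrix_closed[OF compartment_matrix_carrier(1)[of M]]
    char_poly_matrix_closed[OF compartment_matrix_carrier(2)[of M \<mu>]]
  note [simp] = carrier_matD[OF c(1)] carrier_matD[OF c(2)]
  have "poly_rel (\<lambda>h w. rf_value X h \<mu> w)
     (cofactor (char_poly_matrix (compartment_matrix M)) s r)
     (cofactor (char_poly_matrix (compartment_matrix_at M \<mu>)) s r)"
    unfolding cofactor_def
    by (intro rfvp.mult rfvp.power rfvp.uminus rfvp.one rfvp.det[of _ "n - 1"] mat_delete_carrier c)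
      (use assms in \<open>auto simp: mat_delete_def intro!: char_poly_matrix_at_rel\<close>)
  then show ?thesis using assms by (simp add: adj_mat_def)
qed

lemma param_domainD:
  assumes "\<mu> \<in> param_domain M"
  shows "i \<in> inputs M \<Longrightarrow> rf_value X (input_coeff M i) \<mu> (input_coeff_at M \<mu> i)"
    and "i \<in> outputs M \<Longrightarrow> rf_value X (output_coeff M i) \<mu> (output_coeff_at M \<mu> i)"
  using assms unfolding param_domain_def input_coeff_at_def output_coeff_at_def
  by (auto intro: rf_value_rf_eval)

lemma transfer_numerator_at_rel:
  assumes "\<mu> \<in> param_domain M" "i \<in> outputs M" "j \<in> inputs M"
  shows "poly_rel (\<lambda>h w. rf_value X h \<mu> w) (transfer_numerator M i j) (transfer_numerator_at M \<mu> i j)"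
proof -
  have "i - 1 < n" "j - 1 < n" using assms subsets by (force simp: states_def)+
  from adj_mat_at_rel[OF this, of \<mu>] show ?thesis
    unfolding transfer_numerator_def transfer_numerator_at_def poly_rel_def coeff_smult
    by (intro allI rfv.mult param_domainD[OF assms(1)] assms) auto
qed

subsection \<open>Solutions\<close>

lemma analytic_tuplesD: "u \<in> analytic_tuples I \<Longrightarrow> i \<in> I \<Longrightarrow> u i analytic_on {0}"
  by (auto simp: analytic_tuples_def analytic_at_0_def)

lemma solution_exists:
  assumes u: "u \<in> analytic_tuples (inputs M)"
  shows "\<exists>x. is_solution M x0 \<mu> u x"
proof -
  let ?g = "\<lambda>i t. if i \<in> inputs M then rf_eval X (input_coeff M i) \<mu> * u i t else 0"
  have "?g i analytic_on {0}" if "i \<in> states M" for i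
    by (cases "i \<in> inputs M") (auto intro!: analytic_intros analytic_tuplesD[OF u])
  from linear_ode_exists[OF finite_sets(1), where g = ?g and ?x0.0 = x0
      and A = "\<lambda>i j. rf_eval X (compartment_entry M i j) \<mu>", OF this]
  obtain x where x: "\<And>i. i \<in> states M \<Longrightarrow> x i analytic_on {0} \<and> x i 0 = x0 i \<and>
     germ_eq (deriv (x i)) (\<lambda>t. (\<Sum>j\<in>states M. rf_eval X (compartment_entry M i j) \<mu> * x j t) + ?g i t)"
    by blast
  have "is_solution M x0 \<mu> u (restrict x (states M))"
    unfolding is_solution_def using x
    by (auto simp: analytic_tuples_def analytic_at_0_def cong: sum.cong)
  then show ?thesis by blast
qed

lemma solution_jet:
  assumes sol: "is_solution M x0 \<mu> u x" and u: "u \<in> analytic_tuples (inputs M)" and i: "i < n"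
  shows "jet (x (Suc i)) (Suc r) = (\<Sum>j<n. compartment_matrix_at M \<mu> $$ (i, j) * jet (x (Suc j)) r) +
     (if Suc i \<in> inputs M then input_coeff_at M \<mu> (Suc i) * jet (u (Suc i)) r else 0)"
proof -
  let ?g = "\<lambda>t. if Suc i \<in> inputs M then rf_eval X (input_coeff M (Suc i)) \<mu> * u (Suc i) t else 0"
  have iS: "Suc i \<in> states M" using i by (auto simp: states_def)
  have x: "x j analytic_on {0}" if "j \<in> states M" for j
    using sol that by (auto simp: is_solution_def intro: analytic_tuplesD)
  have g: "?g analytic_on {0}"
    by (cases "Suc i \<in> inputs M") (auto intro!: analytic_intros analytic_tuplesD[OF u])
  have "germ_eq (deriv (x (Suc i)))
      (\<lambda>t. (\<Sum>j\<in>states M. rf_eval X (compartment_entry M (Suc i) j) \<mu> * x j t) + ?g t)"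
    using sol iS by (auto simp: is_solution_def)
  from jet_cong[OF this] have "jet (deriv (x (Suc i))) r =
      jet (\<lambda>t. (\<Sum>j\<in>states M. rf_eval X (compartment_entry M (Suc i) j) \<mu> * x j t) + ?g t) r"
    by (rule fun_cong)
  also have "\<dots> = jet (\<lambda>t. \<Sum>j\<in>states M. rf_eval X (compartment_entry M (Suc i) j) \<mu> * x j t) r + jet ?g r"
    by (rule jet_add[OF _ g]) (intro analytic_intros x)
  also have "jet (\<lambda>t. \<Sum>j\<in>states M. rf_eval X (compartment_entry M (Suc i) j) \<mu> * x j t) r =
      (\<Sum>j\<in>states M. rf_eval X (compartment_entry M (Suc i) j) \<mu> * jet (x j) r)"
    by (rule jet_linear[OF x])
  finally have "jet (deriv (x (Suc i))) r =
      (\<Sum>j\<in>states M. rf_eval X (compartment_entry M (Suc i) j) \<mu> * jet (x j) r) + jet ?g r" .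
  moreover have "jet ?g r = (if Suc i \<in> inputs M then input_coeff_at M \<mu> (Suc i) * jet (u (Suc i)) r else 0)"
  proof (cases "Suc i \<in> inputs M")
    case True
    then show ?thesis using jet_cmult[OF analytic_tuplesD[OF u True]] by (simp add: input_coeff_at_def)
  next
    case False
    then show ?thesis using jet_linear[of "{}"] by simp
  qed
  ultimately show ?thesis
    using i unfolding sum_states jet_deriv by (simp add: compartment_matrix_at_def)
qed

lemma solution_unique:
  assumes sol: "is_solution M x0 \<mu> u x" "is_solution M x0 \<mu> u x'"
    and u: "u \<in> analytic_tuples (inputs M)" and i: "i \<in> states M"
  shows "germ_eq (x i) (x' i)"
proof -
  have x: "x j analytic_on {0}" "x' j analytic_on {0}" "x j 0 = x0 j" "x' j 0 = x0 j" if "j \<in> states M" for j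
    using sol that by (auto simp: is_solution_def intro: analytic_tuplesD)
  have "jet (x (Suc i)) r = jet (x' (Suc i)) r" if "i < n" for i r
    using that
  proof (induction r arbitrary: i)
    case 0
    then have "Suc i \<in> states M" by (auto simp: states_def)
    then show ?case using x by (simp add: jet_def)
  next
    case (Suc r)
    then show ?case by (simp add: solution_jet[OF sol(1) u] solution_jet[OF sol(2) u])
  qed
  then have "jet (x i) = jet (x' i)" using i unfolding states_eq by auto
  then show ?thesis using germ_eq_jet x i by blast
qed

lemma output_analytic:
  assumes "is_solution M x0 \<mu> u x" "i \<in> outputs M"
  shows "output_of M \<mu> x i analytic_on {0}"
proof -
  have "x i analytic_on {0}" using assms subsets by (auto simp: is_solution_def intro: analytic_tuplesD)
  then show ?thesis unfolding output_of_def[abs_def] by (intro analytic_intros)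
qed

lemma jet_output:
  assumes "is_solution M x0 \<mu> u x" "i \<in> outputs M"
  shows "jet (output_of M \<mu> x i) r = output_coeff_at M \<mu> i * jet (x i) r"
proof -
  have "x i analytic_on {0}" using assms subsets by (auto simp: is_solution_def intro: analytic_tuplesD)
  from jet_cmult[OF this] show ?thesis by (simp add: output_of_def[abs_def] output_coeff_at_def)
qed

lemma response_solution:
  assumes u: "u \<in> analytic_tuples (inputs M)"
  shows "\<exists>x. is_solution M x0 \<mu> u x \<and> response M x0 \<mu> u = output_of M \<mu> x"
  using someI_ex[OF solution_exists[OF u]] unfolding response_def by blast

lemma output_jet_equation:
  assumes sol: "is_solution M x0 \<mu> u x" and u: "u \<in> analytic_tuples (inputs M)" and i: "i \<in> outputs M"
  shows "shift_op (char_poly (compartment_matrix_at M \<mu>)) (jet (output_of M \<mu> x i)) r =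
     (\<Sum>j\<in>inputs M. shift_op (transfer_numerator_at M \<mu> i j) (jet (u j)) r)"
proof -
  obtain i' where i': "i = Suc i'" "i' < n" using i subsets unfolding states_eq by auto
  let ?A = "compartment_matrix_at M \<mu>" and ?N = "adj_mat (char_poly_matrix (compartment_matrix_at M \<mu>))"
  let ?W = "\<lambda>j r. if Suc j \<in> inputs M then input_coeff_at M \<mu> (Suc j) * jet (u (Suc j)) r else 0"
  have "shift_op (char_poly ?A) (jet (x (Suc i'))) r = (\<Sum>j<n. shift_op (?N $$ (i', j)) (?W j) r)"
    by (rule shift_op_char_poly[OF compartment_matrix_carrier(2), where V = "\<lambda>i. jet (x (Suc i))" and W = ?W])
      (auto simp: solution_jet[OF sol u] i')
  also have "\<dots> = (\<Sum>j\<in>states M. if j \<in> inputs M then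
      input_coeff_at M \<mu> j * shift_op (?N $$ (i', j - 1)) (jet (u j)) r else 0)"
    unfolding sum_states by (intro sum.cong) (auto simp: shift_op_scale_fun)
  also have "\<dots> = (\<Sum>j\<in>inputs M. input_coeff_at M \<mu> j * shift_op (?N $$ (i', j - 1)) (jet (u j)) r)"
    using subsets finite_sets by (intro sum.mono_neutral_cong_right) auto
  finally have "shift_op (char_poly ?A) (jet (x i)) r = \<dots>" unfolding i' .
  moreover have "jet (output_of M \<mu> x i) = (\<lambda>r. output_coeff_at M \<mu> i * jet (x i) r)"
    using jet_output[OF sol i] by blast
  ultimately show ?thesis
    by (simp add: shift_op_scale_fun transfer_numerator_at_def shift_op_smult sum_distrib_left mult.assoc i')
qed

end

section \<open>The input-output equations\<close>

text \<open>The operator L applied to the indeterminate z, in a form from which the coefficients can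
  be read off.\<close>

definition linear_dp :: "'z \<Rightarrow> 'a :: comm_ring_1 poly \<Rightarrow> ('z, 'a) diffpoly" where
  "linear_dp z L = (\<Sum>k\<le>degree L.
     Poly_Mapping.single (Poly_Mapping.single (z, k) 1) (Polynomial.coeff L k))"

lemma linear_dp_eq_sum: "degree L \<le> N \<Longrightarrow> linear_dp z L =
   (\<Sum>k\<le>N. Poly_Mapping.single (Poly_Mapping.single (z, k) 1) (Polynomial.coeff L k))"
  unfolding linear_dp_def by (intro sum.mono_neutral_left) (auto simp: coeff_eq_0)

lemma single_1_eq_iff:
  "Poly_Mapping.single a (1 :: nat) = Poly_Mapping.single b 1 \<longleftrightarrow> a = b"
  by (metis keys_single singleton_inject zero_neq_one)

lemma lookup_linear_dp:
  "Poly_Mapping.lookup (linear_dp z L) (Poly_Mapping.single (z', k) 1) =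
     (if z = z' then Polynomial.coeff L k else 0)"
proof -
  have eq: "linear_dp z L = (\<Sum>l\<le>max k (degree L).
      Poly_Mapping.single (Poly_Mapping.single (z, l) 1) (Polynomial.coeff L l))"
    by (rule linear_dp_eq_sum) simp
  have "Poly_Mapping.lookup (linear_dp z L) (Poly_Mapping.single (z', k) 1) =
      (\<Sum>l\<le>max k (degree L). if l = k then (if z = z' then Polynomial.coeff L k else 0) else 0)"
    unfolding eq lookup_sum lookup_single when_def single_1_eq_iff by (intro sum.cong) auto
  also have "\<dots> = (if z = z' then Polynomial.coeff L k else 0)" by (subst sum.delta) auto
  finally show ?thesis .
qed

lemma lookup_linear_dp_nonlinear:
  "(\<And>k. m \<noteq> Poly_Mapping.single (z, k) 1) \<Longrightarrow> Poly_Mapping.lookup (linear_dp z L) m = 0"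
  unfolding linear_dp_def lookup_sum lookup_single when_def by (intro sum.neutral) auto

lemma (in ring_rel) lookup_linear_dp_rel:
  assumes "poly_rel R L L'"
  shows "R (Poly_Mapping.lookup (linear_dp z L) m) (Poly_Mapping.lookup (linear_dp z L') m)"
proof (cases "\<exists>k. m = Poly_Mapping.single (z, k) 1")
  case True
  then show ?thesis using assms by (auto simp del: One_nat_def simp: lookup_linear_dp poly_rel_def)
next
  case False
  then show ?thesis using lookup_linear_dp_nonlinear[of m z] zero by metis
qed

lemma dp_deriv_single:
  "dp_deriv (Poly_Mapping.single (Poly_Mapping.single (z, k) 1) c :: ('z, 'a :: comm_ring_1) diffpoly) =
   Poly_Mapping.single (Poly_Mapping.single (z, Suc k) 1) c"
proof (cases "c = 0")
  case True
  then show ?thesis by (simp add: dp_deriv_def)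
next
  case False
  then show ?thesis by (simp add: dp_deriv_def keys_single)
qed

lemma dp_apply_var:
  "dp_apply L (mp_const b * mp_var (z, 0)) = linear_dp z (Polynomial.smult b L)"
proof -
  have v: "mp_const b * mp_var (z, 0) = Poly_Mapping.single (Poly_Mapping.single (z, 0) 1) b"
    by (simp add: mp_const_def mp_var_def mult_single)
  have "(dp_deriv ^^ k) (mp_const b * mp_var (z, 0)) =
      Poly_Mapping.single (Poly_Mapping.single (z, k) 1) b" for k
  proof (induction k)
    case (Suc k)
    then show ?case by (simp only: funpow.simps comp_apply dp_deriv_single)
  qed (simp only: v funpow.simps id_apply)
  then have "dp_apply L (mp_const b * mp_var (z, 0)) = (\<Sum>k\<le>degree L.
      Poly_Mapping.single (Poly_Mapping.single (z, k) 1) (Polynomial.coeff (Polynomial.smult b L) k))"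
    unfolding dp_apply_def
    by (intro sum.cong refl) (simp add: mp_const_def mult_single mult.commute)
  also have "\<dots> = linear_dp z (Polynomial.smult b L)"
    by (rule linear_dp_eq_sum[symmetric]) (rule degree_smult_le)
  finally show ?thesis .
qed

lemma mp_const_times_linear_dp:
  "mp_const c * linear_dp z L = linear_dp z (Polynomial.smult c L)"
proof -
  have "linear_dp z (Polynomial.smult c L) = (\<Sum>k\<le>degree L.
      Poly_Mapping.single (Poly_Mapping.single (z, k) 1) (Polynomial.coeff (Polynomial.smult c L) k))"
    by (rule linear_dp_eq_sum) (rule degree_smult_le)
  then show ?thesis
    by (simp add: linear_dp_def sum_distrib_left mp_const_def mult_single)
qed

lemma dp_eval_linear_dp:
  "dp_eval f (linear_dp z L) t = (\<Sum>k\<le>degree L. Polynomial.coeff L k * (deriv ^^ k) (f z) t)"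
  by (simp add: dp_eval_def linear_dp_def mp_eval_single keys_single)

lemma dp_eval_diff: "dp_eval f (p - q) t = dp_eval f p t - dp_eval f q t"
  and dp_eval_sum: "dp_eval f (\<Sum>x\<in>S. P x) t = (\<Sum>x\<in>S. dp_eval f (P x) t)"
  by (simp_all add: dp_eval_def)

lemma minus_one_power_mult:
  "(- 1) ^ k * (p :: 'a :: comm_ring_1 poly) = Polynomial.smult ((- 1) ^ k) p"
  "(- 1) ^ k * (q :: ('v, 'a) mpoly) = mp_const ((- 1) ^ k) * q"
proof -
  show "(- 1) ^ k * p = Polynomial.smult ((- 1) ^ k) p" by (induction k) auto
  have "(- 1) ^ k = (mp_const ((- 1) ^ k) :: ('v, 'a) mpoly)"
    by (cases "even k") (auto simp: mp_const_def single_uminus)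
  then show "(- 1) ^ k * q = mp_const ((- 1) ^ k) * q" by simp
qed

lemma jet_shift_op:
  assumes "f analytic_on {0}"
  shows "jet (\<lambda>t. \<Sum>k\<le>degree L. Polynomial.coeff L k * (deriv ^^ k) f t) r = shift_op L (jet f) r"
  by (subst jet_linear) (auto intro: analytic_higher_deriv assms simp: jet_higher_deriv shift_op_def)

context compartment
begin

definition io_equation_at :: "(nat \<Rightarrow> complex) \<Rightarrow> nat \<Rightarrow> (nat + nat, complex) diffpoly" where
  "io_equation_at \<mu> i = linear_dp (Inl i) (char_poly (compartment_matrix_at M \<mu>)) -
     (\<Sum>j\<in>inputs M. linear_dp (Inr j) (transfer_numerator_at M \<mu> i j))"

text \<open>Vertices i and j sit at positions i - 1 and j - 1, which changes i + j by 2, so the sign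
  is the cofactor sign; the transposition in the adjugate turns the minor for (j, i) into entry (i,
  j).\<close>

lemma io_equation_linear:
  assumes "i \<in> outputs M"
  shows "io_equation M i = linear_dp (Inl i) (char_poly (compartment_matrix M)) -
     (\<Sum>j\<in>inputs M. linear_dp (Inr j) (transfer_numerator M i j))"
proof -
  let ?C = "char_poly_matrix (compartment_matrix M)"
  have y: "dp_apply (Determinant.det ?C) (mp_var (Inl i, 0)) =
      (linear_dp (Inl i) (char_poly (compartment_matrix M)) :: (nat + nat, ratfun) diffpoly)"
    using dp_apply_var[of "Determinant.det ?C" 1 "Inl i"] by (simp add: char_poly_def mp_const_def)
  have "mp_const (output_coeff M i) * ((- 1) ^ (i + j) * dp_apply (Determinant.det (io_minor M j i))
        (mp_const (input_coeff M j) * mp_var (Inr j, 0))) =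
      (linear_dp (Inr j) (transfer_numerator M i j) :: (nat + nat, ratfun) diffpoly)"
    if j: "j \<in> inputs M" for j
  proof -
    obtain i' j' where ij: "i = Suc i'" "j = Suc j'" "i' < n" "j' < n"
      using j assms subsets unfolding states_eq by blast
    have "transfer_numerator M i j =
        Polynomial.smult (output_coeff M i * input_coeff M j) (cofactor ?C j' i')"
      using ij carrier_matD[OF char_poly_matrix_closed[OF compartment_matrix_carrier(1)[of M]]]
      by (simp add: transfer_numerator_def adj_mat_def)
    also have "cofactor ?C j' i' = Polynomial.smult ((- 1) ^ (i + j)) (Determinant.det (io_minor M j i))"
      unfolding cofactor_def minus_one_power_mult(1) io_minor_def ij by (simp add: add.commute)
    finally show ?thesis
      unfolding dp_apply_var minus_one_power_mult(2) mp_const_times_linear_dp by (simp add: mult_ac)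
  qed
  then show ?thesis unfolding io_equation_def y sum_distrib_left by simp
qed

lemma io_coefficient_value:
  assumes \<mu>: "\<mu> \<in> param_domain M" and i: "i \<in> outputs M"
  shows "rf_value X (Poly_Mapping.lookup (io_equation M i) m) \<mu> (Poly_Mapping.lookup (io_equation_at \<mu> i) m)"
  unfolding io_equation_linear[OF i] io_equation_at_def lookup_minus lookup_sum
  by (intro rfv.diff rfv.sum rfv.lookup_linear_dp_rel char_poly_at_rel transfer_numerator_at_rel \<mu> i)

lemma specialize_io_equation:
  assumes "\<mu> \<in> param_domain M" "i \<in> outputs M"
  shows "specialize M \<mu> (io_equation M i) = io_equation_at \<mu> i"
proof (rule poly_mapping_eqI)
  fix m
  have "Poly_Mapping.lookup (specialize M \<mu> (io_equation M i)) m =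
      rf_eval X (Poly_Mapping.lookup (io_equation M i) m) \<mu>"
    by (simp add: specialize_def Poly_Mapping.map.rep_eq when_def)
  then show "Poly_Mapping.lookup (specialize M \<mu> (io_equation M i)) m = Poly_Mapping.lookup (io_equation_at \<mu> i) m"
    using rf_eval_eqI[OF io_coefficient_value[OF assms]] by simp
qed

text \<open>The evaluated equation is analytic at 0, so it vanishes near 0 once all its derivatives
  at 0 do, and these are \<open>output_jet_equation\<close>.\<close>

lemma io_equation_vanishes:
  assumes i: "i \<in> outputs M"
  shows "vanishes_on_solutions M (io_equation M i)"
  unfolding vanishes_on_solutions_def
proof (intro ballI allI impI)
  fix x0 \<mu> u x
  assume \<mu>: "\<mu> \<in> param_domain M" and u: "u \<in> analytic_tuples (inputs M)" and sol: "is_solution M x0 \<mu> u x"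
  let ?y = "output_of M \<mu> x i" and ?p = "char_poly (compartment_matrix_at M \<mu>)"
  let ?op = "\<lambda>L f t. \<Sum>k\<le>degree L. Polynomial.coeff L k * (deriv ^^ k) f t"
  let ?f = "\<lambda>t. \<Sum>j\<in>inputs M. ?op (transfer_numerator_at M \<mu> i j) (u j) t"
  have y: "?y analytic_on {0}" by (rule output_analytic[OF sol i])
  have uj: "u j analytic_on {0}" if "j \<in> inputs M" for j by (rule analytic_tuplesD[OF u that])
  have op: "?op L f analytic_on {0}" if "f analytic_on {0}" for L f
    by (intro analytic_intros analytic_higher_deriv that)
  have fa: "?f analytic_on {0}" by (intro analytic_intros analytic_higher_deriv uj)
  have "dp_eval (case_sum (output_of M \<mu> x) u) (specialize M \<mu> (io_equation M i)) =
      (\<lambda>t. ?op ?p ?y t - ?f t)"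
    unfolding specialize_io_equation[OF \<mu> i] io_equation_at_def
    by (rule ext) (simp add: dp_eval_diff dp_eval_sum dp_eval_linear_dp)
  moreover have "germ_eq (\<lambda>t. ?op ?p ?y t - ?f t) (\<lambda>_. 0)"
  proof (subst germ_eq_jet)
    show "(\<lambda>t. ?op ?p ?y t - ?f t) analytic_on {0}" by (rule analytic_on_diff[OF op[OF y] fa])
    show "jet (\<lambda>t. ?op ?p ?y t - ?f t) = jet (\<lambda>_. 0)"
    proof
      fix r
      have "jet (\<lambda>t. ?op ?p ?y t - ?f t) r = jet (?op ?p ?y) r - jet ?f r"
        by (rule jet_diff[OF op[OF y] fa])
      also have "jet ?f r = (\<Sum>j\<in>inputs M. jet (?op (transfer_numerator_at M \<mu> i j) (u j)) r)"
        using jet_linear[of "inputs M" "\<lambda>j. ?op (transfer_numerator_at M \<mu> i j) (u j)" "\<lambda>_. 1" r] op uj by simp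
      also have "\<dots> = (\<Sum>j\<in>inputs M. shift_op (transfer_numerator_at M \<mu> i j) (jet (u j)) r)"
        by (intro sum.cong refl jet_shift_op uj)
      also have "jet (?op ?p ?y) r = \<dots>"
        unfolding jet_shift_op[OF y] by (rule output_jet_equation[OF sol u i])
      finally show "jet (\<lambda>t. ?op ?p ?y t - ?f t) r = jet (\<lambda>_. 0) r"
        using jet_linear[of "{}"] by simp
    qed
  qed auto
  ultimately show "germ_eq (dp_eval (case_sum (output_of M \<mu> x) u) (specialize M \<mu> (io_equation M i))) (\<lambda>_. 0)"
    by simp
qed

text \<open>Agreement of all input-output equations, phrased with operators;
  \<open>same_io_iff\<close> translates it into values of the coefficients.\<close>

definition same_io :: "(nat \<Rightarrow> complex) \<Rightarrow> (nat \<Rightarrow> complex) \<Rightarrow> bool" where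
  "same_io \<mu> \<mu>' \<longleftrightarrow> char_poly (compartment_matrix_at M \<mu>) = char_poly (compartment_matrix_at M \<mu>') \<and>
     (\<forall>i\<in>outputs M. \<forall>j\<in>inputs M. transfer_numerator_at M \<mu> i j = transfer_numerator_at M \<mu>' i j)"

lemma io_coefficientsE:
  assumes "h \<in> io_coefficients M"
  obtains i m where "i \<in> outputs M" "h = Poly_Mapping.lookup (io_equation M i) m"
  using assms by (auto simp: io_coefficients_def dp_coeffs_def)

lemma io_coefficient_defined:
  "\<mu> \<in> param_domain M \<Longrightarrow> h \<in> io_coefficients M \<Longrightarrow> rf_defined X h \<mu>"
  by (elim io_coefficientsE) (auto simp: rf_defined_def intro: io_coefficient_value)

lemma same_io_iff:
  assumes \<mu>: "\<mu> \<in> param_domain M" "\<mu>' \<in> param_domain M"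
  shows "same_io \<mu> \<mu>' \<longleftrightarrow> (\<forall>h\<in>io_coefficients M. rf_eval X h \<mu> = rf_eval X h \<mu>')"
proof
  assume s: "same_io \<mu> \<mu>'"
  show "\<forall>h\<in>io_coefficients M. rf_eval X h \<mu> = rf_eval X h \<mu>'"
  proof
    fix h assume "h \<in> io_coefficients M"
    then obtain i m where i: "i \<in> outputs M" "h = Poly_Mapping.lookup (io_equation M i) m"
      by (rule io_coefficientsE)
    have "io_equation_at \<mu> i = io_equation_at \<mu>' i"
      using s i(1) unfolding io_equation_at_def same_io_def by simp
    then show "rf_eval X h \<mu> = rf_eval X h \<mu>'"
      unfolding i(2) rf_eval_eqI[OF io_coefficient_value[OF \<mu>(1) i(1)]]
        rf_eval_eqI[OF io_coefficient_value[OF \<mu>(2) i(1)]] by simp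
  qed
next
  assume eq: "\<forall>h\<in>io_coefficients M. rf_eval X h \<mu> = rf_eval X h \<mu>'"
  have io: "io_equation_at \<mu> i = io_equation_at \<mu>' i" if i: "i \<in> outputs M" for i
  proof (rule poly_mapping_eqI)
    fix m
    let ?h = "Poly_Mapping.lookup (io_equation M i) m"
    have "rf_eval X ?h \<mu> = rf_eval X ?h \<mu>'"
    \<comment> \<open>\<open>io_coefficients\<close> collects only coefficients of monomials that
      occur, so zero coefficients are treated apart.\<close>
    proof (cases "?h = 0")
      case False
      then have "?h \<in> dp_coeffs (io_equation M i)" unfolding dp_coeffs_def by (intro imageI) (simp add: in_keys_iff)
      then have "?h \<in> io_coefficients M" using i by (auto simp: io_coefficients_def)
      then show ?thesis using eq by blast
    qed simp
    then show "Poly_Mapping.lookup (io_equation_at \<mu> i) m = Poly_Mapping.lookup (io_equation_at \<mu>' i) m"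
      unfolding rf_eval_eqI[OF io_coefficient_value[OF \<mu>(1) i]] rf_eval_eqI[OF io_coefficient_value[OF \<mu>(2) i]] .
  qed
  \<comment> \<open>The parts in \<open>y_i\<close> and in each \<open>u_j\<close> use different
    monomials, so both kinds of operators can be recovered. The characteristic polynomial is taken
    from output 1, which every model has.\<close>
  have ly: "Poly_Mapping.lookup (io_equation_at \<nu> i) (Poly_Mapping.single (Inl i, k) 1) =
      Polynomial.coeff (char_poly (compartment_matrix_at M \<nu>)) k" for \<nu> i k
    unfolding io_equation_at_def lookup_minus lookup_sum lookup_linear_dp by simp
  have lu: "Poly_Mapping.lookup (io_equation_at \<nu> i) (Poly_Mapping.single (Inr j, k) 1) =
      - Polynomial.coeff (transfer_numerator_at M \<nu> i j) k" if "j \<in> inputs M" for \<nu> i j k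
    unfolding io_equation_at_def lookup_minus lookup_sum lookup_linear_dp using that finite_sets(2) by simp
  have "1 \<in> outputs M" using model by (auto simp: linear_compartment_model_def outputs_def)
  from io[OF this] have "char_poly (compartment_matrix_at M \<mu>) = char_poly (compartment_matrix_at M \<mu>')"
    using ly[of \<mu> 1] ly[of \<mu>' 1] by (intro poly_eqI) metis
  moreover have "transfer_numerator_at M \<mu> i j = transfer_numerator_at M \<mu>' i j"
    if "i \<in> outputs M" "j \<in> inputs M" for i j
    using lu[OF that(2), of \<mu> i] lu[OF that(2), of \<mu>' i] io[OF that(1)]
    by (intro poly_eqI) (metis neg_equal_iff_equal)
  ultimately show "same_io \<mu> \<mu>'" unfolding same_io_def by blast
qed

end

section \<open>Generic parameters and inputs\<close>

locale connected_compartment = compartment +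
  assumes connected: "strongly_connected (with_proj (graph M))"
begin

definition edges :: "(nat \<times> nat) set" where
  "edges = {(i, k). (Suc i, Suc k) \<in> parcs (graph M)}"

lemma edges_bounded: "edges \<subseteq> {..<n} \<times> {..<n}"
  using edge_states by (fastforce simp: edges_def states_def)

lemma edges_irrefl: "(i, i) \<notin> edges"
  using edge_states by (auto simp: edges_def)

lemma edges_connected:
  assumes "i < n" "k < n" shows "(i, k) \<in> edges\<^sup>*"
proof -
  have V: "verts (with_proj (graph M)) = states M" "arcs_ends (with_proj (graph M)) = parcs (graph M)"
    using model by (auto simp: linear_compartment_model_def arcs_ends_def arc_to_ends_def image_def)
  have "Suc i \<in> states M" "Suc k \<in> states M" using assms by (auto simp: states_def)
  then have "(Suc i, Suc k) \<in> rtrancl_on (states M) (parcs (graph M))"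
    using connected unfolding strongly_connected_def reachable_def V by blast
  \<comment> \<open>Writing the end point as \<open>Suc k - 1\<close> lets the induction replace
    each vertex v by v - 1.\<close>
  then have "(i, Suc k - 1) \<in> edges\<^sup>*"
  proof (induction rule: rtrancl_on_induct)
    case (step u v)
    then have "(u, v) \<in> parcs (graph M)" by simp
    then have "(u - 1, v - 1) \<in> edges"
      using edge_states by (force simp: edges_def states_def)
    then show ?case using step.IH by (rule rtrancl_into_rtrancl[rotated])
  qed simp
  then show ?thesis by simp
qed

text \<open>Rates are distinct indeterminates, because \<open>rate_index\<close> is injective on
  \<open>rates\<close>; so edge weights can be prescribed freely and all leaks set to zero.\<close>

lemma weights_realized:
  fixes a :: "nat \<Rightarrow> nat \<Rightarrow> complex"
  assumes a: "\<And>k i. a k i \<noteq> 0 \<Longrightarrow> (i, k) \<in> edges"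
  shows "\<exists>\<mu>. compartment_matrix_at M \<mu> = flow_matrix n a"
proof -
  let ?f = "\<lambda>(j, i). rate_index M j i"
  have inj: "inj_on ?f (rates M)" using model by (simp add: linear_compartment_model_def)
  define g where "g p = (if fst p = 0 then 0 else a (fst p - 1) (snd p - 1))" for p :: "nat \<times> nat"
  define \<mu> where "\<mu> v = g (the_inv_into (rates M) ?f v)" for v
  have \<mu>: "\<mu> (rate_index M j i) = g (j, i)" if "(j, i) \<in> rates M" for j i
    using the_inv_into_f_f[OF inj that] by (simp add: \<mu>_def)
  have edge: "\<mu> (rate_index M (Suc k) (Suc i)) = a k i" if "(i, k) \<in> edges" for i k
    using that by (subst \<mu>) (auto simp: rates_def edges_def g_def)
  have leak: "\<mu> (rate_index M 0 i) = 0" if "i \<in> leaks M" for i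
    using that by (subst \<mu>) (auto simp: rates_def g_def)
  have out: "{k. (Suc i, k) \<in> parcs (graph M)} = Suc ` {k. (i, k) \<in> edges}" for i
    using edge_states by (fastforce simp: edges_def states_eq)
  have fin: "finite {k. (i, k) \<in> edges}" for i
    by (rule finite_subset[of _ "{..<n}"]) (use edges_bounded in auto)
  have sum: "(\<Sum>k | (Suc i, k) \<in> parcs (graph M). \<mu> (rate_index M k (Suc i))) = (\<Sum>l\<in>{..<n} - {i}. a l i)" for i
  proof -
    have "(\<Sum>k | (Suc i, k) \<in> parcs (graph M). \<mu> (rate_index M k (Suc i))) = (\<Sum>k | (i, k) \<in> edges. a k i)"
      unfolding out by (subst sum.reindex) (auto simp: edge)
    also have "\<dots> = (\<Sum>l\<in>{..<n} - {i}. a l i)"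
      by (rule sum.mono_neutral_left) (use edges_bounded edges_irrefl a in auto)
    finally show ?thesis .
  qed
  have "compartment_matrix_at M \<mu> $$ (r, s) = flow_matrix n a $$ (r, s)" if "r < n" "s < n" for r s
  proof (cases "r = s")
    case True
    then show ?thesis using that leak sum[of s]
      by (auto simp: compartment_matrix_at_entry entry_at_def flow_matrix_def)
  next
    case False
    have "entry_at \<mu> (Suc r) (Suc s) = a r s"
      using False edge[of s r] a[of r s] by (auto simp: entry_at_def edges_def)
    then show ?thesis using that False by (simp add: compartment_matrix_at_entry flow_matrix_def)
  qed
  then show ?thesis
    by (intro exI[of _ \<mu>] eq_matI) (auto simp: compartment_matrix_at_def flow_matrix_def)
qed

lemma rational_function_nonzeroI:
  assumes "rf_value X h \<mu> w" "w \<noteq> 0" shows "h \<noteq> 0" "h \<in> rational_functions X"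
  using assms rf_value_unique[OF rfv.zero] rf_defined_rational_function rf_defined_def by blast+

text \<open>The determinant has a nonzero value at the parameter realizing the tree weights, hence
  is not the zero function.\<close>

lemma observability_det_nonzero:
  assumes i: "i < n"
  shows "Determinant.det (observability_mat (compartment_matrix M) i) \<in> rational_functions X - {0}"
proof -
  obtain a :: "nat \<Rightarrow> nat \<Rightarrow> complex" where a: "\<And>k i. a k i \<noteq> 0 \<Longrightarrow> (i, k) \<in> edges"
      "Determinant.det (observability_mat (flow_matrix n a) i) \<noteq> 0"
    using observable_weights_exist[OF edges_bounded i edges_connected[OF _ i]] by blast
  obtain \<mu> where \<mu>: "compartment_matrix_at M \<mu> = flow_matrix n a" using weights_realized[of a] a(1) by blast
  show ?thesis
    using rational_function_nonzeroI[OF rf_value_det_observability[OF _ _ i, of \<mu>]] a(2) unfolding \<mu> by blast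
qed

lemma controllable_weights_exist:
  assumes j: "j < n"
  shows "\<exists>a :: nat \<Rightarrow> nat \<Rightarrow> complex. (\<forall>k i. a k i \<noteq> 0 \<longrightarrow> (i, k) \<in> edges) \<and>
     Determinant.det (controllability_mat (flow_matrix n a) j) \<noteq> 0"
proof -
  let ?E = "edges\<inverse>"
  have conn: "(i, k) \<in> ?E\<^sup>*" if "i < n" "k < n" for i k
    using edges_connected[OF that(2,1)] by (simp add: rtrancl_converse)
  have "?E \<subseteq> {..<n} \<times> {..<n}" using edges_bounded by auto
  then obtain a0 :: "nat \<Rightarrow> nat \<Rightarrow> complex" where a0: "\<And>k i. a0 k i \<noteq> 0 \<Longrightarrow> (i, k) \<in> ?E"
      "Determinant.det (observability_mat (flow_matrix n a0) j) \<noteq> 0"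
    using observable_weights_exist[of ?E n j] j conn by blast
  define B :: "(nat \<times> nat, complex) mpoly mat" where
    "B = flow_matrix n (\<lambda>k i. if (i, k) \<in> ?E then mp_var (k, i) else 0)"
  define A where "A z = flow_matrix n (\<lambda>k i. if (i, k) \<in> ?E then z (k, i) else (0 :: complex))" for z
  have carr: "B \<in> carrier_mat n n" "A z \<in> carrier_mat n n" for z by (simp_all add: A_def B_def)
  interpret E: ring_rel "\<lambda>f w. w = mp_eval z (f :: (nat \<times> nat, complex) mpoly)" for z
    by (rule ring_rel_mp_eval)
  have "A z $$ (k, i) = mp_eval z (B $$ (k, i))" if "k < n" "i < n" for k i z
    using that by (simp add: A_def B_def flow_matrix_def if_distrib[of "mp_eval z"] cong: if_cong)
  then have det: "Determinant.det (observability_mat (A z) j) = mp_eval z (Determinant.det (observability_mat B j))" for z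
    by (intro E.det_observability_rel[OF carr _ j]) auto
  have "(if (i, k) \<in> ?E then a0 k i else 0) = a0 k i" for k i
    using a0(1)[of k i] by (cases "a0 k i = 0") auto
  then have "A (\<lambda>(k, i). a0 k i) = flow_matrix n a0"
    unfolding A_def by (simp only: case_prod_conv)
  then have "Determinant.det (observability_mat B j) \<noteq> 0"
    using det[of "\<lambda>(k, i). a0 k i"] a0(2) by auto
  from mp_eval_nonzero_at_positive[OF this] obtain z :: "nat \<times> nat \<Rightarrow> real" where
    z: "\<And>v. z v > 0" "Determinant.det (observability_mat (A (\<lambda>v. of_real (z v))) j) \<noteq> 0"
    unfolding det by blast
  define a where "a k i = (if (i, k) \<in> ?E then z (k, i) else 0)" for k i
  have "\<exists>y. (\<forall>k<n. y k > 0) \<and>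
     (\<forall>k<n. (\<Sum>i\<in>{..<n} - {k}. a k i * y i) = (\<Sum>l\<in>{..<n} - {k}. a l k) * y k)"
  proof (rule positive_equilibrium_exists)
    show "n > 0" using j by simp
    show "a k i \<ge> 0" for k i using z(1)[of "(k, i)"] by (simp add: a_def)
    show "(i, k) \<in> ?E\<^sup>*" if "i < n" "k < n" for i k using conn that by blast
    show "i < n \<and> k < n \<and> i \<noteq> k \<and> a k i > 0" if "(i, k) \<in> ?E" for i k
      using that z(1) edges_bounded edges_irrefl by (auto simp: a_def)
  qed
  then obtain y where y: "\<And>k. k < n \<Longrightarrow> y k > 0"
     "\<And>k. k < n \<Longrightarrow> (\<Sum>i\<in>{..<n} - {k}. a k i * y i) = (\<Sum>l\<in>{..<n} - {k}. a l k) * y k" by blast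
  have A: "A (\<lambda>v. of_real (z v)) = flow_matrix n (\<lambda>k i. complex_of_real (a k i))"
    unfolding A_def a_def by (intro arg_cong[where f = "flow_matrix n"] ext) simp
  have "Determinant.det (controllability_mat (flow_matrix n
      (\<lambda>k i. complex_of_real (y k) * complex_of_real (a i k) / complex_of_real (y i))) j) \<noteq> 0"
  proof (rule controllable_by_time_reversal[OF j])
    show "complex_of_real (y k) \<noteq> 0" if "k < n" for k using y(1)[OF that] by simp
    show "(\<Sum>i\<in>{..<n} - {k}. complex_of_real (a k i) * complex_of_real (y i)) =
        (\<Sum>l\<in>{..<n} - {k}. complex_of_real (a l k)) * complex_of_real (y k)" if "k < n" for k
      using arg_cong[OF y(2)[OF that], of complex_of_real] by simp
    show "Determinant.det (observability_mat (flow_matrix n (\<lambda>k i. complex_of_real (a k i))) j) \<noteq> 0"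
      using z(2) unfolding A .
  qed
  moreover have "(i, k) \<in> edges" if "complex_of_real (y k) * complex_of_real (a i k) / complex_of_real (y i) \<noteq> 0" for i k
    using that by (auto simp: a_def split: if_splits)
  ultimately show ?thesis
    by (intro exI[of _ "\<lambda>k i. complex_of_real (y k) * complex_of_real (a i k) / complex_of_real (y i)"]) simp
qed

lemma controllability_det_nonzero:
  assumes j: "j < n"
  shows "Determinant.det (controllability_mat (compartment_matrix M) j) \<in> rational_functions X - {0}"
proof -
  obtain a :: "nat \<Rightarrow> nat \<Rightarrow> complex" where a: "\<And>k i. a k i \<noteq> 0 \<Longrightarrow> (i, k) \<in> edges"
      "Determinant.det (controllability_mat (flow_matrix n a) j) \<noteq> 0"
    using controllable_weights_exist[OF j] by blast
  obtain \<mu> where \<mu>: "compartment_matrix_at M \<mu> = flow_matrix n a" using weights_realized[of a] a(1) by blast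
  show ?thesis
    using rational_function_nonzeroI[OF rf_value_det_controllability[OF _ _ j, of \<mu>]] a(2) unfolding \<mu> by blast
qed

definition minimal_at :: "nat \<Rightarrow> (nat \<Rightarrow> complex) \<Rightarrow> bool" where
  "minimal_at j \<mu> \<longleftrightarrow>
     (\<forall>i\<in>outputs M. Determinant.det (observability_mat (compartment_matrix_at M \<mu>) (i - 1)) \<noteq> 0 \<and>
        output_coeff_at M \<mu> i \<noteq> 0) \<and>
     Determinant.det (controllability_mat (compartment_matrix_at M \<mu>) (j - 1)) \<noteq> 0 \<and>
     input_coeff_at M \<mu> j \<noteq> 0"

lemma generic_minimal:
  assumes j: "j \<in> inputs M"
  shows "\<exists>P. P \<noteq> 0 \<and> mp_vars P \<subseteq> X \<and> (\<forall>\<mu>\<in>param_domain M. mp_eval \<mu> P \<noteq> 0 \<longrightarrow> minimal_at j \<mu>)"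
proof -
  let ?O = "\<lambda>i. Determinant.det (observability_mat (compartment_matrix M) (i - 1))"
  let ?C = "Determinant.det (controllability_mat (compartment_matrix M) (j - 1))"
  let ?D = "?O ` outputs M \<union> output_coeff M ` outputs M \<union> {?C, input_coeff M j}"
  have io: "i - 1 < n" if "i \<in> outputs M" for i using that subsets by (force simp: states_def)
  have jn: "j - 1 < n" using j subsets by (force simp: states_def)
  have "?O ` outputs M \<subseteq> rational_functions X - {0}"
    using observability_det_nonzero[OF io] by (rule image_subsetI)
  moreover have "output_coeff M ` outputs M \<subseteq> rational_functions X - {0}"
      "input_coeff M j \<in> rational_functions X - {0}"
    using model j by (auto simp: linear_compartment_model_def)
  moreover note controllability_det_nonzero[OF jn]
  ultimately have "?D \<subseteq> rational_functions X - {0}" by (simp only: Un_subset_iff insert_subset) simp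
  moreover have "finite ?D" using finite_sets by simp
  ultimately obtain P where P: "P \<noteq> 0" "mp_vars P \<subseteq> X"
     "\<And>h \<mu> w. h \<in> ?D \<Longrightarrow> mp_eval \<mu> P \<noteq> 0 \<Longrightarrow> rf_value X h \<mu> w \<Longrightarrow> w \<noteq> 0"
    using rf_nonzero_numerators[of ?D X] by blast
  have "minimal_at j \<mu>" if \<mu>: "\<mu> \<in> param_domain M" and nz: "mp_eval \<mu> P \<noteq> 0" for \<mu>
    unfolding minimal_at_def
  proof (intro conjI ballI)
    fix i assume i: "i \<in> outputs M"
    show "Determinant.det (observability_mat (compartment_matrix_at M \<mu>) (i - 1)) \<noteq> 0"
      using P(3)[OF _ nz rf_value_det_observability[OF _ _ io[OF i]]] i by blast
    show "output_coeff_at M \<mu> i \<noteq> 0"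
      using P(3)[OF _ nz param_domainD(2)[OF \<mu> i]] i by blast
  next
    show "Determinant.det (controllability_mat (compartment_matrix_at M \<mu>) (j - 1)) \<noteq> 0"
      using P(3)[OF _ nz rf_value_det_controllability[OF _ _ jn]] by blast
    show "input_coeff_at M \<mu> j \<noteq> 0"
      using P(3)[OF _ nz param_domainD(1)[OF \<mu> j]] by blast
  qed
  then show ?thesis using P(1,2) by blast
qed

end

section \<open>Inputs with independent derivatives\<close>

lemma jet_monomial: "jet (\<lambda>t. t ^ s) k = (if k = s then fact s else 0)"
proof -
  have "(\<lambda>t :: complex. t ^ s) has_fps_expansion fps_X ^ s" by (rule has_fps_expansion_fps_X_power)
  from jet_expansion[OF this, of k] show ?thesis by (simp add: fps_X_power_iff)
qed

text \<open>Pairs of an input number b and a derivative order k < N are coded as b * N + k.\<close>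

lemma sum_div_mod:
  fixes f :: "nat \<Rightarrow> nat \<Rightarrow> 'a :: comm_monoid_add"
  assumes "N > 0"
  shows "(\<Sum>a<c * N. f (a div N) (a mod N)) = (\<Sum>b<c. \<Sum>k<N. f b k)"
proof -
  have "(\<Sum>a\<in>{b * N..<b * N + N}. f (a div N) (a mod N)) = (\<Sum>k<N. f b k)" for b
  proof -
    have "(\<Sum>a\<in>{b * N..<b * N + N}. f (a div N) (a mod N)) =
        (\<Sum>k\<in>{0..<N}. f ((k + b * N) div N) ((k + b * N) mod N))"
      using sum.shift_bounds_nat_ivl[of "\<lambda>a. f (a div N) (a mod N)" 0 "b * N" N] by (simp add: add.commute)
    also have "\<dots> = (\<Sum>k<N. f b k)" using assms by (intro sum.cong) auto
    finally show ?thesis .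
  qed
  then show ?thesis by (simp flip: sum.nat_group)
qed

text \<open>
  The Wronskian-like determinant of the derivatives of order less than \<open>N\<close> of all inputs is a
  differential polynomial in the inputs alone; monomials of degree \<open>b * N + N - 1\<close> turn it into a
  permutation matrix.
\<close>

lemma generic_inputs:
  fixes J :: "nat set"
  assumes J: "finite J" and N: "N > 0"
  shows "\<exists>U. zariski_open_analytic J U \<and> U \<noteq> {} \<and>
    (\<forall>u\<in>U. \<forall>D. (\<forall>j\<in>J. degree (D j) < N) \<longrightarrow>
       (\<forall>r. (\<Sum>j\<in>J. shift_op (D j) (jet (u j)) r) = 0) \<longrightarrow> (\<forall>j\<in>J. D j = 0))"
proof -
  define c where "c = card J"
  obtain e where e: "bij_betw e {0..<c} J" unfolding c_def using ex_bij_betw_nat_finite[OF J] by blast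
  define K where "K = c * N"
  have eJ: "e (a div N) \<in> J" if "a < K" for a
    using that e N by (auto simp: K_def bij_betw_def less_mult_imp_div_less)
  define W :: "(nat \<times> nat, complex) mpoly mat" where
    "W = Matrix.mat K K (\<lambda>(a, r). mp_var (e (a div N), a mod N + r))"
  define Wu where "Wu u = Matrix.mat K K (\<lambda>(a, r). jet (u (e (a div N))) (a mod N + r))"
    for u :: "nat \<Rightarrow> complex \<Rightarrow> complex"
  have carr: "W \<in> carrier_mat K K" "Wu u \<in> carrier_mat K K" for u by (auto simp: W_def Wu_def)
  define P where "P = Determinant.det W"
  interpret E: ring_rel "\<lambda>f w. w = mp_eval z (f :: (nat \<times> nat, complex) mpoly)" for z
    by (rule ring_rel_mp_eval)
  interpret V: ring_rel "\<lambda>f g. mp_vars (f :: (nat \<times> nat, complex) mpoly) \<subseteq> J \<times> UNIV \<and> f = g"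
    by (rule ring_rel_mp_vars)
  have Peval: "dp_eval u P 0 = Determinant.det (Wu u)" for u
    unfolding dp_eval_def P_def
    by (intro E.det[OF carr, symmetric]) (auto simp: W_def Wu_def jet_def)
  have Pvars: "mp_vars P \<subseteq> J \<times> UNIV"
    using V.det[OF carr(1) carr(1)] eJ unfolding P_def by (auto simp: W_def)
  define U where "U = {z \<in> analytic_tuples J. dp_eval z P 0 \<noteq> 0}"
  define u where "u = restrict (\<lambda>j t. t ^ (the_inv_into {0..<c} e j * N + N - 1) :: complex) J"
  have "u \<in> U"
  proof -
    have "(\<lambda>t :: complex. t ^ s) analytic_on {0}" for s by (intro analytic_intros)
    then have "u \<in> analytic_tuples J" by (auto simp: u_def analytic_tuples_def analytic_at_0_def)
    moreover have "Determinant.det (Wu u) \<noteq> 0"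
      unfolding det_nonzero_iff[OF carr(2)]
    proof (intro allI impI)
      fix v r assume v: "\<forall>a<K. (\<Sum>s<K. Wu u $$ (a, s) * v s) = 0" and r: "r < K"
      define b where "b = r div N"
      \<comment> \<open>The row whose only nonzero entry is in column r: row b * N + k has its entry
        where k + s equals the exponent b * N + N - 1, so block b is antidiagonal with a factorial
        as entry.\<close>
      define a where "a = b * N + (N - 1 - r mod N)"
      have b: "b < c" using r N by (simp add: b_def K_def less_mult_imp_div_less)
      have small: "N - 1 - r mod N < N" using N by simp
      have adiv: "a div N = b" and amod: "a mod N = N - 1 - r mod N"
        unfolding a_def using N small by simp_all
      have "b * N + N \<le> c * N" using b by (metis Suc_leI mult_Suc add.commute mult_le_mono1)
      then have aK: "a < K" unfolding a_def K_def using small by linarith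
      have ub: "u (e b) = (\<lambda>t. t ^ (b * N + N - 1))"
        using the_inv_into_f_f[of e "{0..<c}" b] e b by (auto simp: u_def bij_betw_def)
      have rb: "r = b * N + r mod N" by (simp add: b_def)
      have rm: "r mod N < N" using N by simp
      have "Wu u $$ (a, s) * v s = (if s = r then fact (b * N + N - 1) * v r else 0)" if "s < K" for s
      proof -
        have "a mod N + s = b * N + N - 1 \<longleftrightarrow> s = r" unfolding amod using rb rm by linarith
        then have "jet (u (e b)) (a mod N + s) = (if s = r then fact (b * N + N - 1) else 0)"
          unfolding ub jet_monomial by simp
        then show ?thesis using that aK by (simp add: Wu_def adiv)
      qed
      then have "(\<Sum>s<K. Wu u $$ (a, s) * v s) = fact (b * N + N - 1) * v r" using r by simp
      then show "v r = 0" using v aK by simp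
    qed
    ultimately show ?thesis by (simp add: U_def Peval)
  qed
  moreover have "zariski_open_analytic J U" unfolding zariski_open_analytic_def U_def using Pvars by blast
  moreover have "\<forall>j\<in>J. D j = 0" if u: "u \<in> U" and deg: "\<forall>j\<in>J. degree (D j) < N"
    and zero: "\<forall>r. (\<Sum>j\<in>J. shift_op (D j) (jet (u j)) r) = 0" for u D
  proof -
    have det: "Determinant.det (transpose_mat (Wu u)) \<noteq> 0"
      using u by (simp add: U_def Peval det_transpose[OF carr(2)])
    \<comment> \<open>The coefficients of all operators \<open>D j\<close> in one vector; the
      relations with r < K say that the transpose of \<open>Wu u\<close> annihilates it.\<close>
    define v where "v a = Polynomial.coeff (D (e (a div N))) (a mod N)" for a
    have "(\<Sum>a<K. transpose_mat (Wu u) $$ (r, a) * v a) = 0" if r: "r < K" for r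
    proof -
      have "(\<Sum>a<K. transpose_mat (Wu u) $$ (r, a) * v a) =
          (\<Sum>a<c * N. jet (u (e (a div N))) (a mod N + r) * Polynomial.coeff (D (e (a div N))) (a mod N))"
        using r by (intro sum.cong) (auto simp: Wu_def v_def K_def)
      also have "\<dots> = (\<Sum>b<c. \<Sum>k<N. jet (u (e b)) (k + r) * Polynomial.coeff (D (e b)) k)"
        by (rule sum_div_mod[OF N])
      also have "\<dots> = (\<Sum>b\<in>{0..<c}. \<Sum>k<N. jet (u (e b)) (k + r) * Polynomial.coeff (D (e b)) k)"
        by (simp add: lessThan_atLeast0)
      also have "\<dots> = (\<Sum>j\<in>J. \<Sum>k<N. jet (u j) (k + r) * Polynomial.coeff (D j) k)"
        by (rule sum.reindex_bij_betw[OF e])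
      also have "\<dots> = (\<Sum>j\<in>J. shift_op (D j) (jet (u j)) r)"
      proof (intro sum.cong refl)
        fix j assume "j \<in> J"
        then have d: "degree (D j) < N" using deg by blast
        have "shift_op (D j) (jet (u j)) r = (\<Sum>k<N. Polynomial.coeff (D j) k * jet (u j) (r + k))"
          unfolding shift_op_def using d by (intro sum.mono_neutral_left) (auto simp: coeff_eq_0)
        then show "(\<Sum>k<N. jet (u j) (k + r) * Polynomial.coeff (D j) k) = shift_op (D j) (jet (u j)) r"
          by (simp add: mult.commute add.commute)
      qed
      finally show ?thesis using zero by simp
    qed
    then have v0: "v a = 0" if "a < K" for a
      using that iffD1[OF det_nonzero_iff[of "transpose_mat (Wu u)" K] det, rule_format, of v a] carr(2) by simp
    have "Polynomial.coeff (D j) k = 0" if j: "j \<in> J" for j k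
    proof (cases "k < N")
      case True
      obtain b where b: "b < c" "j = e b" using j e by (auto simp: bij_betw_def image_iff)
      have "b * N + N \<le> c * N" using b by (metis Suc_leI mult_Suc add.commute mult_le_mono1)
      then have "b * N + k < K" using True unfolding K_def by linarith
      from v0[OF this] show ?thesis using True by (simp add: v_def b(2))
    next
      case False
      then show ?thesis using deg j by (intro coeff_eq_0) auto
    qed
    then show ?thesis by (simp add: poly_eq_iff)
  qed
  ultimately show ?thesis by blast
qed

section \<open>Equal transfer functions give equal responses\<close>

lemma germ_eq_sym: "germ_eq f g \<Longrightarrow> germ_eq g f"
  by (auto simp: germ_eq_def elim: eventually_mono)

context compartment
begin

lemma response_eq_output:
  assumes u: "u \<in> analytic_tuples (inputs M)" and sol: "is_solution M x0 \<mu> u x" and i: "i \<in> outputs M"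
  shows "germ_eq (response M x0 \<mu> u i) (output_of M \<mu> x i)"
proof -
  obtain x' where x': "is_solution M x0 \<mu> u x'" "response M x0 \<mu> u = output_of M \<mu> x'"
    using response_solution[OF u] by blast
  have "germ_eq (x' i) (x i)" using solution_unique[OF x'(1) sol u] i subsets by blast
  then have "germ_eq (output_of M \<mu> x' i) (output_of M \<mu> x i)"
    unfolding germ_eq_def output_of_def by (auto elim: eventually_mono)
  then show ?thesis by (simp add: x'(2))
qed

text \<open>The similarity T maps the solution x to a solution T x of the second model with initial
  value T x0: it intertwines the matrices and carries the input vectors to those of the second
  model. Its compatibility with the output rows makes the outputs equal.\<close>

lemma same_io_imp_same_response:
  assumes io: "same_io \<mu> \<mu>'" and j0: "j0 \<in> inputs M" and i0: "i0 \<in> outputs M"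
    and ctr: "Determinant.det (controllability_mat (compartment_matrix_at M \<mu>) (j0 - 1)) \<noteq> 0"
      "input_coeff_at M \<mu> j0 \<noteq> 0"
    and obs: "Determinant.det (observability_mat (compartment_matrix_at M \<mu>') (i0 - 1)) \<noteq> 0"
      "output_coeff_at M \<mu>' i0 \<noteq> 0"
    and u: "u \<in> analytic_tuples (inputs M)"
  shows "\<exists>x0'\<in>cspace (states M). \<forall>i\<in>outputs M. germ_eq (response M x0 \<mu> u i) (response M x0' \<mu>' u i)"
proof -
  let ?A = "compartment_matrix_at M \<mu>" and ?A' = "compartment_matrix_at M \<mu>'"
  let ?b = "\<lambda>j. input_coeff_at M \<mu> (Suc j)" and ?b' = "\<lambda>j. input_coeff_at M \<mu>' (Suc j)"
  let ?c = "\<lambda>i. output_coeff_at M \<mu> (Suc i)" and ?c' = "\<lambda>i. output_coeff_at M \<mu>' (Suc i)"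
  let ?I = "{i. Suc i \<in> outputs M}" and ?J = "{j. Suc j \<in> inputs M}"
  have pos: "Suc (i0 - 1) = i0" "Suc (j0 - 1) = j0"
    using i0 j0 subsets by (force simp: states_def)+
  have IJ: "?I \<subseteq> {..<n}" "?J \<subseteq> {..<n}" using subsets by (auto simp: states_def)
  have "\<exists>T. (\<forall>k<n. \<forall>l<n. (\<Sum>m<n. T k m * ?A $$ (m, l)) = (\<Sum>m<n. ?A' $$ (k, m) * T m l)) \<and>
     (\<forall>j\<in>?J. \<forall>k<n. T k j * ?b j = (if k = j then ?b' j else 0)) \<and>
     (\<forall>i\<in>?I. \<forall>l<n. ?c' i * T i l = (if l = i then ?c i else 0))"
  proof (rule realizations_similar[OF compartment_matrix_carrier(2,2) _ IJ(1) _ IJ(2) ctr(1) _ obs(1)])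
    show "char_poly ?A = char_poly ?A'" using io by (simp add: same_io_def)
    show "Polynomial.smult (?c i * ?b j) (adj_mat (char_poly_matrix ?A) $$ (i, j)) =
       Polynomial.smult (?c' i * ?b' j) (adj_mat (char_poly_matrix ?A') $$ (i, j))"
      if "i \<in> ?I" "j \<in> ?J" for i j
      using io that unfolding same_io_def transfer_numerator_at_def by force
  qed (use i0 j0 ctr(2) obs(2) in \<open>simp_all add: pos[unfolded One_nat_def]\<close>)
  then obtain T where
    TA: "\<And>k l. k < n \<Longrightarrow> l < n \<Longrightarrow> (\<Sum>m<n. T k m * ?A $$ (m, l)) = (\<Sum>m<n. ?A' $$ (k, m) * T m l)" and
    TB: "\<And>j k. Suc j \<in> inputs M \<Longrightarrow> k < n \<Longrightarrow> T k j * ?b j = (if k = j then ?b' j else 0)" and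
    TC: "\<And>i l. Suc i \<in> outputs M \<Longrightarrow> l < n \<Longrightarrow> ?c' i * T i l = (if l = i then ?c i else 0)" by blast
  obtain x where x: "is_solution M x0 \<mu> u x" "response M x0 \<mu> u = output_of M \<mu> x"
    using response_solution[OF u] by blast
  have xa: "x (Suc l) analytic_on {0}" if "l < n" for l
    using x(1) that by (auto simp: is_solution_def states_def intro: analytic_tuplesD)
  define x' where "x' = restrict (\<lambda>k t. \<Sum>l<n. T (k - 1) l * x (Suc l) t) (states M)"
  define x0' where "x0' = restrict (\<lambda>k. x' k 0) (states M)"
  have x'_eq: "x' (Suc k) = (\<lambda>t. \<Sum>l<n. T k l * x (Suc l) t)" if "k < n" for k
    using that by (simp add: x'_def states_def)
  have x'a: "x' (Suc k) analytic_on {0}" if "k < n" for k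
    unfolding x'_eq[OF that] by (intro analytic_intros xa) auto
  have x'j: "jet (x' (Suc k)) r = (\<Sum>l<n. T k l * jet (x (Suc l)) r)" if "k < n" for k r
    unfolding x'_eq[OF that] by (rule jet_linear) (use xa in auto)
  have sol: "is_solution M x0' \<mu>' u x'"
    unfolding is_solution_def
  proof (intro conjI ballI)
    show "x' \<in> analytic_tuples (states M)"
      using x'a unfolding analytic_tuples_def analytic_at_0_def states_eq by (auto simp: x'_def states_eq)
    fix i assume i: "i \<in> states M"
    then show "x' i 0 = x0' i" by (simp add: x0'_def)
    obtain k where k: "i = Suc k" "k < n" using i unfolding states_eq by blast
    let ?g = "\<lambda>t. if i \<in> inputs M then rf_eval X (input_coeff M i) \<mu>' * u i t else 0"
    let ?s = "\<lambda>t. \<Sum>l<n. ?A' $$ (k, l) * x' (Suc l) t"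
    have g: "?g analytic_on {0}"
      by (cases "i \<in> inputs M") (auto intro!: analytic_intros analytic_tuplesD[OF u])
    have s: "?s analytic_on {0}" by (intro analytic_intros x'a) auto
    have gj: "jet ?g r = (if i \<in> inputs M then ?b' k * jet (u i) r else 0)" for r
    proof (cases "i \<in> inputs M")
      case True
      then show ?thesis using jet_cmult[OF analytic_tuplesD[OF u True]] by (simp add: input_coeff_at_def k)
    qed (use jet_linear[of "{}"] in simp)
    have "germ_eq (deriv (x' i)) (\<lambda>t. ?s t + ?g t)"
    proof (subst germ_eq_jet)
      show "deriv (x' i) analytic_on {0}" using x'a[OF k(2)] by (auto simp: k intro: analytic_deriv)
      show "(\<lambda>t. ?s t + ?g t) analytic_on {0}" by (intro analytic_on_add s g)
      show "jet (deriv (x' i)) = jet (\<lambda>t. ?s t + ?g t)"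
      proof
        fix r
        let ?w = "\<lambda>l. if Suc l \<in> inputs M then ?b l * jet (u (Suc l)) r else 0"
        have "jet (deriv (x' i)) r = (\<Sum>l<n. T k l * jet (x (Suc l)) (Suc r))"
          by (simp add: jet_deriv k x'j)
        also have "\<dots> = (\<Sum>l<n. T k l * (\<Sum>m<n. ?A $$ (l, m) * jet (x (Suc m)) r)) + (\<Sum>l<n. T k l * ?w l)"
          using solution_jet[OF x(1) u] by (simp add: distrib_left sum.distrib)
        also have "(\<Sum>l<n. T k l * (\<Sum>m<n. ?A $$ (l, m) * jet (x (Suc m)) r)) =
            (\<Sum>m<n. (\<Sum>l<n. T k l * ?A $$ (l, m)) * jet (x (Suc m)) r)"
          by (simp add: sum_distrib_left sum_distrib_right mult_ac) (rule sum.swap)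
        also have "\<dots> = (\<Sum>m<n. (\<Sum>l<n. ?A' $$ (k, l) * T l m) * jet (x (Suc m)) r)"
          using TA[OF k(2)] by simp
        also have "\<dots> = (\<Sum>l<n. ?A' $$ (k, l) * (\<Sum>m<n. T l m * jet (x (Suc m)) r))"
          by (simp add: sum_distrib_left sum_distrib_right mult_ac) (rule sum.swap)
        also have "\<dots> = (\<Sum>l<n. ?A' $$ (k, l) * jet (x' (Suc l)) r)" by (simp add: x'j)
        also have "\<dots> = jet ?s r" by (rule jet_linear[symmetric]) (use x'a in auto)
        also have "(\<Sum>l<n. T k l * ?w l) = (\<Sum>l<n. if l = k then jet ?g r else 0)"
        proof (intro sum.cong refl)
          fix l assume "l \<in> {..<n}"
          show "T k l * ?w l = (if l = k then jet ?g r else 0)"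
          proof (cases "Suc l \<in> inputs M")
            case True
            have "T k l * ?w l = (T k l * ?b l) * jet (u (Suc l)) r" using True by simp
            then show ?thesis using True unfolding TB[OF True k(2)] gj by (auto simp: k)
          qed (auto simp: gj k)
        qed
        also have "\<dots> = jet ?g r" using k(2) by simp
        also have "jet ?s r + jet ?g r = jet (\<lambda>t. ?s t + ?g t) r" by (rule jet_add[OF s g, symmetric])
        finally show "jet (deriv (x' i)) r = jet (\<lambda>t. ?s t + ?g t) r" .
      qed
    qed
    moreover have "?s t = (\<Sum>j\<in>states M. rf_eval X (compartment_entry M i j) \<mu>' * x' j t)" for t
      unfolding sum_states using k by (simp add: compartment_matrix_at_def)
    ultimately show "germ_eq (deriv (x' i)) (\<lambda>t. (\<Sum>j\<in>states M. rf_eval X (compartment_entry M i j) \<mu>' * x' j t) + ?g t)"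
      by (simp only:)
  qed
  have "germ_eq (response M x0 \<mu> u i) (response M x0' \<mu>' u i)" if i: "i \<in> outputs M" for i
  proof -
    obtain k where k: "i = Suc k" "k < n" using i subsets unfolding states_eq by blast
    have "output_of M \<mu>' x' i t = output_of M \<mu> x i t" for t
    proof -
      have "output_of M \<mu>' x' i t = (\<Sum>l<n. (?c' k * T k l) * x (Suc l) t)"
        by (simp add: output_of_def k x'_eq sum_distrib_left mult.assoc output_coeff_at_def)
      also have "\<dots> = (\<Sum>l<n. if l = k then ?c k * x (Suc k) t else 0)"
        using TC[of k] i by (intro sum.cong) (auto simp: k)
      also have "\<dots> = output_of M \<mu> x i t" using k by (simp add: output_of_def output_coeff_at_def)
      finally show ?thesis .
    qed
    then have "output_of M \<mu>' x' i = response M x0 \<mu> u i" by (simp add: x(2) fun_eq_iff)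
    then show ?thesis using germ_eq_sym[OF response_eq_output[OF u sol i]] by simp
  qed
  moreover have "x0' \<in> cspace (states M)" by (simp add: x0'_def cspace_def)
  ultimately show ?thesis by blast
qed

section \<open>Nonvanishing inside the parameter domain\<close>

lemma denominators_polynomial:
  "\<exists>Q. Q \<noteq> 0 \<and> mp_vars Q \<subseteq> X \<and> (\<forall>\<mu>\<in>cspace X. mp_eval \<mu> Q \<noteq> 0 \<longrightarrow> \<mu> \<in> param_domain M)"
proof -
  let ?D = "input_coeff M ` inputs M \<union> output_coeff M ` outputs M"
  have D: "?D \<subseteq> rational_functions X" using model by (auto simp: linear_compartment_model_def)
  have "\<exists>p q. mp_vars p \<subseteq> X \<and> mp_vars q \<subseteq> X \<and> q \<noteq> 0 \<and> h = Fract p q" if "h \<in> ?D" for h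
    using subsetD[OF D that] by (elim rational_functionsE) blast
  then obtain num den where nd: "\<And>h. h \<in> ?D \<Longrightarrow> mp_vars (num h) \<subseteq> X \<and> mp_vars (den h) \<subseteq> X \<and> den h \<noteq> 0 \<and>
      h = Fract (num h) (den h)" by metis
  define Q where "Q = (\<Prod>h\<in>?D. den h)"
  interpret V: ring_rel "\<lambda>f g. mp_vars (f :: (nat, complex) mpoly) \<subseteq> X \<and> f = g" by (rule ring_rel_mp_vars)
  have fin: "finite ?D" using finite_sets by simp
  have "Q \<noteq> 0" unfolding Q_def using nd fin by simp
  moreover have "mp_vars Q \<subseteq> X" unfolding Q_def using V.prod[of ?D den den] nd by blast
  moreover have "\<mu> \<in> param_domain M" if \<mu>: "\<mu> \<in> cspace X" "mp_eval \<mu> Q \<noteq> 0" for \<mu>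
  proof -
    have "rf_defined X h \<mu>" if h: "h \<in> ?D" for h
    proof -
      have "mp_eval \<mu> (den h) \<noteq> 0" using \<mu>(2) h fin by (auto simp: Q_def)
      then show ?thesis using rf_value_FractI[of "num h" X "den h" \<mu>] nd[OF h] unfolding rf_defined_def by metis
    qed
    then show ?thesis using \<mu>(1) rf_value_entry unfolding param_domain_def rf_defined_def by blast
  qed
  ultimately show ?thesis by blast
qed

lemma nonzero_in_cspace:
  assumes "Q \<noteq> 0" "mp_vars (Q :: (nat, complex) mpoly) \<subseteq> X"
  shows "\<exists>\<mu>\<in>cspace X. mp_eval \<mu> Q \<noteq> 0"
proof -
  obtain z :: "nat \<Rightarrow> real" where z: "mp_eval (\<lambda>v. complex_of_real (z v)) Q \<noteq> 0"
    using mp_eval_nonzero_at_positive[OF assms(1)] by blast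
  have "mp_eval (restrict (\<lambda>v. complex_of_real (z v)) X) Q = mp_eval (\<lambda>v. complex_of_real (z v)) Q"
    using assms(2) by (intro mp_eval_cong) auto
  then show ?thesis using z by (intro bexI[of _ "restrict (\<lambda>v. complex_of_real (z v)) X"]) (auto simp: cspace_def)
qed

section \<open>The coefficients are identifiable\<close>

text \<open>Functions that are defined on the whole domain and whose value depends only on the
  input-output equations. They form a ring but not a field, since an inverse may fail to be defined
  somewhere.\<close>

definition determined_functions :: "ratfun set" where
  "determined_functions = {g. (\<forall>\<mu>\<in>param_domain M. rf_defined X g \<mu>) \<and>
     (\<forall>\<mu>\<in>param_domain M. \<forall>\<mu>'\<in>param_domain M. same_io \<mu> \<mu>' \<longrightarrow> rf_eval X g \<mu> = rf_eval X g \<mu>')}"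

lemma determinedI:
  assumes "\<And>\<mu>. \<mu> \<in> param_domain M \<Longrightarrow> rf_value X g \<mu> (f \<mu>)"
    and "\<And>\<mu> \<mu>'. \<mu> \<in> param_domain M \<Longrightarrow> \<mu>' \<in> param_domain M \<Longrightarrow> same_io \<mu> \<mu>' \<Longrightarrow> f \<mu> = f \<mu>'"
  shows "g \<in> determined_functions"
proof -
  have "rf_eval X g \<mu> = f \<mu>" "rf_defined X g \<mu>" if "\<mu> \<in> param_domain M" for \<mu>
    using rf_eval_eqI[OF assms(1)[OF that]] assms(1)[OF that] unfolding rf_defined_def by blast+
  then show ?thesis using assms(2) by (simp add: determined_functions_def)
qed

lemma determinedD:
  assumes "g \<in> determined_functions" "\<mu> \<in> param_domain M"
  shows "rf_value X g \<mu> (rf_eval X g \<mu>)"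
    and "\<mu>' \<in> param_domain M \<Longrightarrow> same_io \<mu> \<mu>' \<Longrightarrow> rf_eval X g \<mu> = rf_eval X g \<mu>'"
  using assms rf_value_rf_eval unfolding determined_functions_def by blast+

lemma determined_ring:
  assumes "g \<in> determined_functions" "h \<in> determined_functions"
  shows "g + h \<in> determined_functions" "g * h \<in> determined_functions" "- g \<in> determined_functions"
proof -
  note g = determinedD[OF assms(1)] and h = determinedD[OF assms(2)]
  show "g + h \<in> determined_functions"
    by (rule determinedI[OF rfv.add[OF g(1) h(1)]]) (use g(2) h(2) in metis)+
  show "g * h \<in> determined_functions"
    by (rule determinedI[OF rfv.mult[OF g(1) h(1)]]) (use g(2) h(2) in metis)+
  show "- g \<in> determined_functions"
    by (rule determinedI[OF rfv.uminus[OF g(1)]]) (use g(2) in metis)+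
qed

lemma determined_const: "rf_const c \<in> determined_functions"
  by (rule determinedI[OF rf_value_const]) simp

lemma determined_one: "1 \<in> determined_functions"
  by (rule determinedI[OF rfv.one]) simp

lemma determined_io_coefficient: "h \<in> io_coefficients M \<Longrightarrow> h \<in> determined_functions"
  using io_coefficient_defined same_io_iff unfolding determined_functions_def by blast

text \<open>Quotients of determined functions form a field containing the constants and the
  coefficients. The relation \<open>h * D = N\<close> can be evaluated wherever h is defined,
  including points where D vanishes.\<close>

lemma generated_field_quotients:
  assumes "h \<in> generated_field (io_coefficients M)"
  shows "\<exists>N\<in>determined_functions. \<exists>D\<in>determined_functions. D \<noteq> 0 \<and> h * D = N"
proof -
  let ?T = "{h. \<exists>N\<in>determined_functions. \<exists>D\<in>determined_functions. D \<noteq> 0 \<and> h * D = N}"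
  have sub: "g \<in> ?T" if "g \<in> determined_functions" for g
    using that determined_one by (intro CollectI bexI[of _ g] bexI[of _ 1]) auto
  have "field_closed ?T"
    unfolding field_closed_def
  proof (intro conjI ballI)
    show "1 \<in> ?T" by (rule sub[OF determined_one])
    fix a assume "a \<in> ?T"
    then obtain N D where a: "N \<in> determined_functions" "D \<in> determined_functions" "D \<noteq> 0" "a * D = N" by blast
    show "- a \<in> ?T"
      using a determined_ring(3)[OF a(1,1)] by (intro CollectI bexI[of _ "- N"] bexI[of _ D]) auto
    show "inverse a \<in> ?T"
    proof (cases "a = 0")
      case True
      then show ?thesis using \<open>a \<in> ?T\<close> by simp
    next
      case False
      then have "N \<noteq> 0" "inverse a * N = D" using a by (auto simp: field_simps)
      then show ?thesis using a by blast
    qed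
    fix b assume "b \<in> ?T"
    then obtain N' D' where b: "N' \<in> determined_functions" "D' \<in> determined_functions" "D' \<noteq> 0" "b * D' = N'" by blast
    have "(a + b) * (D * D') = N * D' + N' * D" "(a * b) * (D * D') = N * N'"
      using a(4) b(4) by (auto simp: algebra_simps)
    moreover have "D * D' \<in> determined_functions" "N * D' + N' * D \<in> determined_functions" "N * N' \<in> determined_functions"
      using a b by (auto intro: determined_ring)
    moreover have "D * D' \<noteq> 0" using a b by simp
    ultimately show "a + b \<in> ?T" "a * b \<in> ?T" by blast+
  qed
  moreover have "range rf_const \<subseteq> ?T" by (rule image_subsetI) (rule sub[OF determined_const])
  moreover have "io_coefficients M \<subseteq> ?T" by (rule subsetI) (rule sub[OF determined_io_coefficient])
  ultimately have "generated_field (io_coefficients M) \<subseteq> ?T" by (rule generated_field_minimal)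
  then have "h \<in> ?T" using assms by (rule subsetD)
  then show ?thesis by (rule CollectD)
qed

end

text \<open>Renames variables, so that a condition on parameters becomes a condition on pairs of
  initial value and parameter.\<close>

lemma embed_mpoly:
  fixes G :: "('v, 'a :: comm_ring_1) mpoly" and inj :: "'v \<Rightarrow> 'w"
  shows "\<exists>G'. mp_vars G' \<subseteq> inj ` mp_vars G \<and> (\<forall>z. mp_eval z G' = mp_eval (\<lambda>v. z (inj v)) G)"
proof -
  let ?G = "\<Sum>m\<in>Poly_Mapping.keys G. mp_const (Poly_Mapping.lookup G m) *
      (\<Prod>v\<in>Poly_Mapping.keys m. mp_var (inj v) ^ Poly_Mapping.lookup m v) :: ('w, 'a) mpoly"
  interpret V: ring_rel "\<lambda>f g. mp_vars (f :: ('w, 'a) mpoly) \<subseteq> inj ` mp_vars G \<and> f = g" by (rule ring_rel_mp_vars)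
  have "mp_vars ?G \<subseteq> inj ` mp_vars G \<and> ?G = ?G"
    by (intro V.sum V.mult V.prod V.power) (auto simp: mp_vars_def[of G])
  moreover have "mp_eval z ?G = mp_eval (\<lambda>v. z (inj v)) G" for z
    by (simp add: mp_eval_def[of _ G])
  ultimately show ?thesis by blast
qed

context connected_compartment
begin

text \<open>The common output satisfies the equations of both parameters. Minimality is assumed at
  \<mu> only, because the competing \<mu>' ranges over the whole domain; coprimality at \<mu> is
  enough for \<open>io_equation_determined\<close>.\<close>

lemma same_response_imp_same_io:
  assumes \<mu>: "\<mu> \<in> param_domain M" "\<mu>' \<in> param_domain M" and j0: "j0 \<in> inputs M"
    and min: "minimal_at j0 \<mu>" and u: "u \<in> analytic_tuples (inputs M)"
    and indep: "\<And>D. (\<forall>j\<in>inputs M. degree (D j) < 2 * n) \<Longrightarrow>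
       (\<forall>r. (\<Sum>j\<in>inputs M. shift_op (D j) (jet (u j)) r) = 0) \<Longrightarrow> \<forall>j\<in>inputs M. D j = 0"
    and resp: "\<And>i. i \<in> outputs M \<Longrightarrow> germ_eq (response M x0 \<mu> u i) (response M x0' \<mu>' u i)"
  shows "same_io \<mu> \<mu>'"
proof -
  obtain x where x: "is_solution M x0 \<mu> u x" "response M x0 \<mu> u = output_of M \<mu> x"
    using response_solution[OF u] by blast
  obtain x' where x': "is_solution M x0' \<mu>' u x'" "response M x0' \<mu>' u = output_of M \<mu>' x'"
    using response_solution[OF u] by blast
  have jm: "j - 1 < n" if "j \<in> inputs M" for j using that subsets by (force simp: states_def)
  have "char_poly (compartment_matrix_at M \<mu>) = char_poly (compartment_matrix_at M \<mu>') \<and>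
     (\<forall>j\<in>inputs M. transfer_numerator_at M \<mu> i j = transfer_numerator_at M \<mu>' i j)"
    if i: "i \<in> outputs M" for i
  proof (rule io_equation_determined[of n "inputs M" j0])
    have im: "i - 1 < n" using i subsets by (force simp: states_def)
    then show "n > 0" by simp
    have "degree (transfer_numerator_at M \<nu> i j) < n" if "j \<in> inputs M" for j \<nu>
      unfolding transfer_numerator_at_def
      by (rule le_less_trans[OF degree_smult_le])
        (rule degree_adj_char_poly_matrix[OF compartment_matrix_carrier(2) im jm[OF that]])
    then show "degree (transfer_numerator_at M \<mu> i j) < n"
      "degree (transfer_numerator_at M \<mu>' i j) < n" if "j \<in> inputs M" for j using that by blast+
    show "L = 0" if L: "degree L < n"
      "char_poly (compartment_matrix_at M \<mu>) dvd L * transfer_numerator_at M \<mu> i j0" for L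
    proof (rule char_poly_dvd_imp_zero[OF compartment_matrix_carrier(2) im jm[OF j0] _ _ L(1)])
      show "Determinant.det (observability_mat (compartment_matrix_at M \<mu>) (i - 1)) \<noteq> 0"
        "Determinant.det (controllability_mat (compartment_matrix_at M \<mu>) (j0 - 1)) \<noteq> 0"
        using min i by (auto simp: minimal_at_def)
      have "output_coeff_at M \<mu> i * input_coeff_at M \<mu> j0 \<noteq> 0" using min i by (auto simp: minimal_at_def)
      then show "char_poly (compartment_matrix_at M \<mu>) dvd
          L * adj_mat (char_poly_matrix (compartment_matrix_at M \<mu>)) $$ (i - 1, j0 - 1)"
        using L(2) unfolding transfer_numerator_at_def by (simp add: dvd_smult_iff)
    qed
    have "lead_coeff (char_poly (compartment_matrix_at M \<nu>)) = 1"
      "degree (char_poly (compartment_matrix_at M \<nu>)) = n" for \<nu>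
      using degree_monic_char_poly[OF compartment_matrix_carrier(2)[of M \<nu>]] by auto
    then show "lead_coeff (char_poly (compartment_matrix_at M \<mu>)) = 1"
      "degree (char_poly (compartment_matrix_at M \<mu>)) = n"
      "lead_coeff (char_poly (compartment_matrix_at M \<mu>')) = 1"
      "degree (char_poly (compartment_matrix_at M \<mu>')) = n" by blast+
    show "shift_op (char_poly (compartment_matrix_at M \<mu>)) (jet (response M x0 \<mu> u i)) r =
       (\<Sum>j\<in>inputs M. shift_op (transfer_numerator_at M \<mu> i j) (jet (u j)) r)" for r
      unfolding x(2) by (rule output_jet_equation[OF x(1) u i])
    show "shift_op (char_poly (compartment_matrix_at M \<mu>')) (jet (response M x0 \<mu> u i)) r =
       (\<Sum>j\<in>inputs M. shift_op (transfer_numerator_at M \<mu>' i j) (jet (u j)) r)" for r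
      unfolding jet_cong[OF resp[OF i]] x'(2) by (rule output_jet_equation[OF x'(1) u i])
  qed (use indep j0 finite_sets in auto)
  moreover have "1 \<in> outputs M" using model by (auto simp: linear_compartment_model_def outputs_def)
  ultimately show ?thesis unfolding same_io_def by blast
qed

text \<open>With h = N/D for determined N and D, the set \<Theta> asks that \<mu> be minimal and D
  nonzero there; U asks for independent input derivatives.\<close>

lemma generated_field_identifiable:
  assumes j0: "j0 \<in> inputs M" and h: "h \<in> generated_field (io_coefficients M)"
  shows "h \<in> identifiable_functions M"
proof -
  obtain N D where ND: "N \<in> determined_functions" "D \<in> determined_functions" "D \<noteq> 0" "h * D = N"
    using generated_field_quotients[OF h] by blast
  obtain Q where Q: "Q \<noteq> 0" "mp_vars Q \<subseteq> X" "\<forall>\<mu>\<in>cspace X. mp_eval \<mu> Q \<noteq> 0 \<longrightarrow> \<mu> \<in> param_domain M"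
    using denominators_polynomial by blast
  then obtain \<mu>0 where "\<mu>0 \<in> param_domain M" using nonzero_in_cspace[OF Q(1,2)] by blast
  then have rat: "g \<in> rational_functions X" if "g \<in> determined_functions" for g
    using that rf_defined_rational_function unfolding determined_functions_def by blast
  have "h = N * inverse D" using ND(3,4) by (simp add: field_simps)
  then have hr: "h \<in> rational_functions X"
    using field_closed_rational_functions rat[OF ND(1)] rat[OF ND(2)] unfolding field_closed_def by blast
  obtain P1 where P1: "P1 \<noteq> 0" "mp_vars P1 \<subseteq> X" "\<forall>\<mu>\<in>param_domain M. mp_eval \<mu> P1 \<noteq> 0 \<longrightarrow> minimal_at j0 \<mu>"
    using generic_minimal[OF j0] by blast
  obtain P2 where P2: "P2 \<noteq> 0" "mp_vars P2 \<subseteq> X" "\<forall>\<mu> w. mp_eval \<mu> P2 \<noteq> 0 \<longrightarrow> rf_value X D \<mu> w \<longrightarrow> w \<noteq> 0"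
    using rf_nonzero_numerator[OF rat[OF ND(2)] ND(3)] by blast
  define P where "P = P1 * P2"
  have P: "P \<noteq> 0" "mp_vars P \<subseteq> X"
    unfolding P_def using P1 P2 mp_vars_mult_subset[of P1 P2] by auto
  obtain P' :: "(nat + nat, complex) mpoly" where P': "mp_vars P' \<subseteq> Inr ` mp_vars P"
     "\<And>z. mp_eval z P' = mp_eval (\<lambda>v. z (Inr v)) P"
    using embed_mpoly[where inj = Inr and G = P] by blast
  define \<Theta> where "\<Theta> = {z \<in> cspace (states M <+> X). mp_eval z P' \<noteq> 0}"
  have \<Theta>_open: "zariski_open (states M <+> X) \<Theta>"
    unfolding zariski_open_def \<Theta>_def using P' P(2) by (intro exI[of _ P']) auto
  have \<Theta>_ne: "\<Theta> \<noteq> {}"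
  proof -
    obtain \<mu> where \<mu>: "\<mu> \<in> cspace X" "mp_eval \<mu> P \<noteq> 0" using nonzero_in_cspace[OF P] by blast
    let ?z = "case_sum (restrict (\<lambda>_. 0) (states M)) \<mu>"
    have "?z \<in> cspace (states M <+> X)"
      using \<mu>(1) unfolding cspace_def by (auto simp: PiE_iff extensional_def split: sum.splits)
    then have "?z \<in> \<Theta>" using \<mu>(2) by (simp add: \<Theta>_def P'(2))
    then show ?thesis by blast
  qed
  have n0: "2 * n > 0" using j0 subsets by (force simp: states_def)
  obtain U where U: "zariski_open_analytic (inputs M) U" "U \<noteq> {}"
    "\<forall>u\<in>U. \<forall>D. (\<forall>j\<in>inputs M. degree (D j) < 2 * n) \<longrightarrow>
       (\<forall>r. (\<Sum>j\<in>inputs M. shift_op (D j) (jet (u j)) r) = 0) \<longrightarrow> (\<forall>j\<in>inputs M. D j = 0)"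
    using generic_inputs[OF finite_sets(2) n0] by (elim exE conjE) (rule that)
  have card: "card (indistinguishable_values M h x0 \<mu> u) = 1"
    if adm: "(x0, \<mu>, u) \<in> admissible M h" and \<Theta>: "case_sum x0 \<mu> \<in> \<Theta>" and uU: "u \<in> U" for x0 \<mu> u
  proof -
    have \<mu>: "\<mu> \<in> param_domain M" "rf_defined X h \<mu>" and u: "u \<in> analytic_tuples (inputs M)"
      using adm by (auto simp: admissible_def)
    have "mp_eval \<mu> P \<noteq> 0" using \<Theta> by (simp add: \<Theta>_def P'(2))
    then have nz: "mp_eval \<mu> P1 \<noteq> 0" "mp_eval \<mu> P2 \<noteq> 0" by (auto simp: P_def)
    have min: "minimal_at j0 \<mu>" using P1(3) \<mu>(1) nz(1) by blast
    have D0: "rf_eval X D \<mu> \<noteq> 0" using P2(3) nz(2) determinedD(1)[OF ND(2) \<mu>(1)] by blast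
    have val: "rf_eval X h \<nu> * rf_eval X D \<nu> = rf_eval X N \<nu>"
      if "\<nu> \<in> param_domain M" "rf_defined X h \<nu>" for \<nu>
      using rf_eval_eqI[OF rfv.mult[OF rf_value_rf_eval[OF that(2)] determinedD(1)[OF ND(2) that(1)]]]
      unfolding ND(4) by simp
    have "rf_eval X h \<mu>' = rf_eval X h \<mu>"
      if \<mu>': "(x0', \<mu>', u) \<in> admissible M h"
        and resp: "\<forall>i\<in>outputs M. germ_eq (response M x0 \<mu> u i) (response M x0' \<mu>' u i)" for x0' \<mu>'
    proof -
      have m: "\<mu>' \<in> param_domain M" "rf_defined X h \<mu>'" using \<mu>' by (auto simp: admissible_def)
      have io: "same_io \<mu> \<mu>'"
        by (rule same_response_imp_same_io[OF \<mu>(1) m(1) j0 min u U(3)[THEN bspec, OF uU, THEN spec, THEN mp, THEN mp]]) (use resp in auto)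
      \<comment> \<open>D takes the same nonzero value at both parameters, so it can be cancelled
        although \<mu>' may be outside \<Theta>.\<close>
      have "rf_eval X h \<mu>' * rf_eval X D \<mu> = rf_eval X h \<mu> * rf_eval X D \<mu>"
        using val[OF \<mu>] val[OF m] determinedD(2)[OF ND(1) \<mu>(1) m(1) io] determinedD(2)[OF ND(2) \<mu>(1) m(1) io]
        by simp
      then show ?thesis using D0 by simp
    qed
    moreover have "rf_eval X h \<mu> \<in> indistinguishable_values M h x0 \<mu> u"
      unfolding indistinguishable_values_def
      by (intro CollectI exI[of _ x0] exI[of _ \<mu>]) (use adm in \<open>auto simp: germ_eq_def\<close>)
    ultimately have "indistinguishable_values M h x0 \<mu> u = {rf_eval X h \<mu>}"
      unfolding indistinguishable_values_def by blast
    then show ?thesis by simp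
  qed
  have "identifiable M h"
    unfolding identifiable_def
    by (intro exI[of _ \<Theta>] exI[of _ U] conjI \<Theta>_open \<Theta>_ne U(1,2)) (use card in auto)
  then show ?thesis using hr by (simp add: identifiable_functions_def)
qed

end

section \<open>Identifiable functions are generated by the coefficients\<close>

inductive_set ring_closure :: "'a :: comm_ring_1 set \<Rightarrow> 'a set" for S where
  gen: "a \<in> S \<Longrightarrow> a \<in> ring_closure S"
| one: "1 \<in> ring_closure S"
| uminus: "a \<in> ring_closure S \<Longrightarrow> - a \<in> ring_closure S"
| add: "a \<in> ring_closure S \<Longrightarrow> b \<in> ring_closure S \<Longrightarrow> a + b \<in> ring_closure S"
| mult: "a \<in> ring_closure S \<Longrightarrow> b \<in> ring_closure S \<Longrightarrow> a * b \<in> ring_closure S"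

lemma ring_closure_zero: "0 \<in> ring_closure S"
  using ring_closure.add[OF ring_closure.one ring_closure.uminus[OF ring_closure.one]] by simp

lemma ring_rel_ring_closure: "ring_rel (\<lambda>f g. f \<in> ring_closure S \<and> f = g)"
  by unfold_locales (auto intro: ring_closure_zero ring_closure.intros)

lemma countable_ring_closure:
  assumes "countable S" shows "countable (ring_closure S)"
proof -
  define step where "step T = T \<union> uminus ` T \<union> (\<lambda>(a, b). a + b) ` (T \<times> T) \<union> (\<lambda>(a, b). a * b) ` (T \<times> T)"
    for T :: "'a set"
  define K where "K k = (step ^^ k) (insert 1 S)" for k
  have K0: "K 0 = insert 1 S" and KS: "K (Suc k) = step (K k)" for k by (simp_all add: K_def)
  have "countable (K k)" for k
  proof (induction k)
    case 0
    then show ?case using assms by (simp add: K0)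
  next
    case (Suc k)
    then show ?case unfolding KS step_def by (intro countable_Un countable_image countable_SIGMA)
  qed
  then have "countable (\<Union>k. K k)" by (intro countable_UN) auto
  moreover have mono: "K k \<subseteq> K (k + l)" for k l
    by (induction l) (auto simp: KS step_def)
  have "a \<in> (\<Union>k. K k)" if "a \<in> ring_closure S" for a
    using that
  proof (induction rule: ring_closure.induct)
    case (gen a)
    then show ?case by (auto intro!: exI[of _ 0] simp: K0)
  next
    case one
    then show ?case by (auto intro!: exI[of _ 0] simp: K0)
  next
    case (uminus a)
    then obtain k where "a \<in> K k" by blast
    then have "- a \<in> K (Suc k)" by (auto simp: KS step_def)
    then show ?case by blast
  next
    case (add a b)
    then obtain k l where "a \<in> K k" "b \<in> K l" by blast
    then have "a \<in> K (k + l)" "b \<in> K (k + l)" using mono[of k l] mono[of l k] by (auto simp: add.commute)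
    then have "a + b \<in> K (Suc (k + l))" by (force simp: KS step_def)
    then show ?case by blast
  next
    case (mult a b)
    then obtain k l where "a \<in> K k" "b \<in> K l" by blast
    then have "a \<in> K (k + l)" "b \<in> K (k + l)" using mono[of k l] mono[of l k] by (auto simp: add.commute)
    then have "a * b \<in> K (Suc (k + l))" by (force simp: KS step_def)
    then show ?case by blast
  qed
  ultimately show ?thesis using countable_subset by (metis subsetI)
qed

lemma mpoly_in_ring_closure:
  fixes p :: "('v, 'a :: comm_ring_1) mpoly"
  assumes "Poly_Mapping.lookup p ` Poly_Mapping.keys p \<subseteq> C" "mp_vars p \<subseteq> X"
  shows "p \<in> ring_closure (mp_const ` C \<union> mp_var ` X)"
proof -
  let ?S = "mp_const ` C \<union> mp_var ` X :: ('v, 'a) mpoly set"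
  interpret R: ring_rel "\<lambda>f g. f \<in> ring_closure ?S \<and> f = g" by (rule ring_rel_ring_closure)
  let ?s = "\<Sum>m\<in>Poly_Mapping.keys p. mp_const (Poly_Mapping.lookup p m) *
      (\<Prod>v\<in>Poly_Mapping.keys m. mp_var v ^ Poly_Mapping.lookup m v)"
  have "?s \<in> ring_closure ?S \<and> ?s = ?s"
  proof (intro R.sum R.mult R.prod R.power conjI refl)
    fix m assume m: "m \<in> Poly_Mapping.keys p"
    show "mp_const (Poly_Mapping.lookup p m) \<in> ring_closure ?S"
      using m assms(1) by (intro ring_closure.gen) blast
    fix v assume "v \<in> Poly_Mapping.keys m"
    then show "mp_var v \<in> ring_closure ?S"
      using m assms(2) by (intro ring_closure.gen) (auto simp: mp_vars_def)
  qed
  then show ?thesis by (simp flip: mp_eq_sum_monomials)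
qed

text \<open>
  The values at \<open>\<mu>\<close> of the elements of \<open>F\<close> that are fractions over \<open>R\<close> form a countable field; \<open>w\<close> is the
  image of \<open>\<mu>\<close> under an isomorphism that fixes this field and moves the value of \<open>Fract p q\<close>.
\<close>

lemma moving_specialization:
  fixes R :: "(nat, complex) mpoly set" and C :: "complex set" and X :: "nat set"
  defines "R \<equiv> ring_closure (mp_const ` C \<union> mp_var ` X)"
  assumes C: "countable C" and X: "finite X"
    and F: "field_closed F" "range rf_const \<subseteq> F"
    and gen: "\<And>f. f \<in> R \<Longrightarrow> f \<noteq> 0 \<Longrightarrow> mp_eval \<mu> f \<noteq> 0"
    and h: "p \<in> R" "q \<in> R" "q \<noteq> 0" "Fract p q \<notin> F"
  shows "\<exists>w. (\<forall>f\<in>R. mp_eval w f = 0 \<longrightarrow> f = 0) \<and>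
     mp_eval w p / mp_eval w q \<noteq> mp_eval \<mu> p / mp_eval \<mu> q \<and>
     (\<forall>a\<in>R. \<forall>b\<in>R. b \<noteq> 0 \<longrightarrow> Fract a b \<in> F \<longrightarrow> mp_eval w a / mp_eval w b = mp_eval \<mu> a / mp_eval \<mu> b)"
proof -
  define L where "L = {mp_eval \<mu> a / mp_eval \<mu> b | a b. a \<in> R \<and> b \<in> R \<and> b \<noteq> 0 \<and> Fract a b \<in> F}"
  have LI: "mp_eval \<mu> a / mp_eval \<mu> b \<in> L" if "a \<in> R" "b \<in> R" "b \<noteq> 0" "Fract a b \<in> F" for a b
    using that unfolding L_def by blast
  have R: "0 \<in> R" "1 \<in> R" "\<And>a b. a \<in> R \<Longrightarrow> b \<in> R \<Longrightarrow> a + b \<in> R" "\<And>a b. a \<in> R \<Longrightarrow> b \<in> R \<Longrightarrow> a * b \<in> R"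
    "\<And>a. a \<in> R \<Longrightarrow> - a \<in> R"
    unfolding R_def by (auto intro: ring_closure.intros ring_closure_zero)
  have Fc: "0 \<in> F" "1 \<in> F" "\<And>a b. a \<in> F \<Longrightarrow> b \<in> F \<Longrightarrow> a + b \<in> F" "\<And>a b. a \<in> F \<Longrightarrow> b \<in> F \<Longrightarrow> a * b \<in> F"
    "\<And>a. a \<in> F \<Longrightarrow> - a \<in> F" "\<And>a. a \<in> F \<Longrightarrow> inverse a \<in> F"
    using F(1) field_closed_zero[OF F(1)] by (auto simp: field_closed_def)
  have "countable (mp_const ` C \<union> mp_var ` X :: (nat, complex) mpoly set)"
    using C X by (simp add: countable_finite)
  then have "countable (R \<times> R)" unfolding R_def by (intro countable_SIGMA countable_ring_closure)
  moreover have "L \<subseteq> (\<lambda>(a, b). mp_eval \<mu> a / mp_eval \<mu> b) ` (R \<times> R)" unfolding L_def by auto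
  ultimately have Lc: "countable L" using countable_subset countable_image by metis
  have Lf: "field_closed L"
    unfolding field_closed_def
  proof (intro conjI ballI)
    show "1 \<in> L" using LI[of 1 1] R Fc by (simp add: One_fract_def)
    fix x assume "x \<in> L"
    then obtain a b where x: "a \<in> R" "b \<in> R" "b \<noteq> 0" "Fract a b \<in> F" "x = mp_eval \<mu> a / mp_eval \<mu> b"
      unfolding L_def by blast
    have b0: "mp_eval \<mu> b \<noteq> 0" using gen x by blast
    show "- x \<in> L" using LI[of "- a" b] x R(5) Fc(5)[OF x(4)] by simp
    show "inverse x \<in> L"
    proof (cases "a = 0")
      case True
      then show ?thesis using LI[of 0 1] R Fc x(5) by (simp add: fract_collapse)
    next
      case False
      then show ?thesis using LI[of b a] x Fc(6)[OF x(4)] by simp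
    qed
    fix y assume "y \<in> L"
    then obtain a' b' where y: "a' \<in> R" "b' \<in> R" "b' \<noteq> 0" "Fract a' b' \<in> F" "y = mp_eval \<mu> a' / mp_eval \<mu> b'"
      unfolding L_def by blast
    have b0': "mp_eval \<mu> b' \<noteq> 0" using gen y by blast
    show "x + y \<in> L"
      using LI[of "a * b' + a' * b" "b * b'"] x y b0 b0' R(3,4) Fc(3)[OF x(4) y(4)] by (simp add: add_frac_eq)
    show "x * y \<in> L"
      using LI[of "a * a'" "b * b'"] x y R(4) Fc(4)[OF x(4) y(4)] by simp
  qed
  define v where "v = mp_eval \<mu> p / mp_eval \<mu> q"
  have q0: "mp_eval \<mu> q \<noteq> 0" using gen h by blast
  \<comment> \<open>At the generic point \<mu>, equality of values is equality of fractions: the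
    cross difference lies in R, where only zero vanishes at \<mu>.\<close>
  have "v \<notin> L"
  proof
    assume "v \<in> L"
    then obtain a b where x: "a \<in> R" "b \<in> R" "b \<noteq> 0" "Fract a b \<in> F" "v = mp_eval \<mu> a / mp_eval \<mu> b"
      unfolding L_def by blast
    have "mp_eval \<mu> (p * b + - (a * q)) = 0"
      using x(5) gen[OF x(2,3)] q0 unfolding v_def by (simp add: field_simps)
    moreover have "p * b + - (a * q) \<in> R" by (intro R(3,4,5) x(1,2) h(1,2))
    ultimately have "p * b + - (a * q) = 0" using gen[of "p * b + - (a * q)"] by metis
    then have "Fract p q = Fract a b" using h(3) x(3) by (simp add: eq_fract)
    then show False using h(4) x(4) by simp
  qed
  from extend_moving[OF Lf Lc this] obtain G1 b where
    G1: "countable_corr G1" "\<forall>x\<in>L. G1 x x" "G1 v b" "b \<noteq> v" by blast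
  from extend_finite[OF X G1(1), of \<mu>] obtain G w where
    G: "countable_corr G" "\<forall>x y. G1 x y \<longrightarrow> G x y" "\<forall>i\<in>X. G (\<mu> i) (w i)" by blast
  interpret G: countable_corr G by (rule G(1))
  have rel: "G (mp_eval \<mu> f) (mp_eval w f)" if "f \<in> R" for f
    using that unfolding R_def
  proof (induction rule: ring_closure.induct)
    case (gen f)
    then consider c where "f = mp_const c" "c \<in> C" | i where "i \<in> X" "f = mp_var i" by blast
    then show ?case
    proof cases
      case 1
      \<comment> \<open>Constants of C are fractions over R that lie in F, so they belong to L and
        the isomorphism fixes them. Hence it carries the value of any f in R at \<mu> to the value
        of the same f at w.\<close>
      have "mp_const c \<in> R" unfolding R_def using 1(2) by (intro ring_closure.gen) blast
      moreover have "Fract (mp_const c) 1 \<in> F" using F(2) by (auto simp: rf_const_def)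
      ultimately have "c \<in> L" using LI[of "mp_const c" 1] R(2) by simp
      then show ?thesis using G1(2) G(2) 1(1) by simp
    next
      case 2
      then show ?thesis using G(3) by simp
    qed
  qed (auto intro: G.one G.uminus G.add G.mult)
  have rel2: "G (mp_eval \<mu> a / mp_eval \<mu> b) (mp_eval w a / mp_eval w b)" if "a \<in> R" "b \<in> R" for a b
    using that by (intro G.divide rel)
  have "f = 0" if "f \<in> R" "mp_eval w f = 0" for f
    using G.zero_iff[OF rel[OF that(1)]] that(2) gen[OF that(1)] by blast
  moreover have "mp_eval w p / mp_eval w q \<noteq> mp_eval \<mu> p / mp_eval \<mu> q"
    using G.functional[OF rel2[OF h(1,2)], of b] G1(3,4) G(2) unfolding v_def by blast
  moreover have "mp_eval w a / mp_eval w b = mp_eval \<mu> a / mp_eval \<mu> b"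
    if "a \<in> R" "b \<in> R" "b \<noteq> 0" "Fract a b \<in> F" for a b
    using G.functional[OF rel2[OF that(1,2)]] LI[OF that] G1(2) G(2) by blast
  ultimately show ?thesis by blast
qed

context connected_compartment
begin

lemma identifiable_generated_field:
  assumes j0: "j0 \<in> inputs M" and h: "h \<in> identifiable_functions M"
  shows "h \<in> generated_field (io_coefficients M)"
proof (rule ccontr)
  let ?F = "generated_field (io_coefficients M)"
  assume hF: "h \<notin> ?F"
  have hr: "h \<in> rational_functions X" and hi: "identifiable M h" using h by (auto simp: identifiable_functions_def)
  obtain \<Theta> U where \<Theta>: "zariski_open (states M <+> X) \<Theta>" "\<Theta> \<noteq> {}"
    and U: "zariski_open_analytic (inputs M) U" "U \<noteq> {}"
    and card: "\<And>x0 \<mu> u. (x0, \<mu>, u) \<in> admissible M h \<Longrightarrow> case_sum x0 \<mu> \<in> \<Theta> \<Longrightarrow> u \<in> U \<Longrightarrow>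
        card (indistinguishable_values M h x0 \<mu> u) = 1"
    using hi unfolding identifiable_def by fast
  obtain P where P: "\<Theta> = {z \<in> cspace (states M <+> X). mp_eval z P \<noteq> 0}"
    using \<Theta>(1) unfolding zariski_open_def by blast
  obtain z where z: "z \<in> cspace (states M <+> X)" "mp_eval z P \<noteq> 0" using \<Theta>(2) P by blast
  \<comment> \<open>The initial value is taken from a point of \<Theta>, so that some parameter
    still satisfies the condition of \<Theta> with this x0.\<close>
  define x0 where "x0 = (\<lambda>i. z (Inl i))"
  have x0: "x0 \<in> cspace (states M)"
    using z(1) unfolding cspace_def x0_def by (auto simp: PiE_iff extensional_def)
  obtain u where u: "u \<in> U" using U(2) by blast
  then have ua: "u \<in> analytic_tuples (inputs M)" using U(1) unfolding zariski_open_analytic_def by blast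
  obtain Pm where Pm: "Pm \<noteq> 0" "mp_vars Pm \<subseteq> X" "\<forall>\<mu>\<in>param_domain M. mp_eval \<mu> Pm \<noteq> 0 \<longrightarrow> minimal_at j0 \<mu>"
    using generic_minimal[OF j0] by blast
  obtain Q where Q: "Q \<noteq> 0" "mp_vars Q \<subseteq> X" "\<forall>\<mu>\<in>cspace X. mp_eval \<mu> Q \<noteq> 0 \<longrightarrow> \<mu> \<in> param_domain M"
    using denominators_polynomial by blast
  obtain \<mu>0 where \<mu>0: "\<mu>0 \<in> param_domain M" using nonzero_in_cspace[OF Q(1,2)] Q(3) by blast
  let ?H = "insert h (io_coefficients M)"
  have "countable (io_coefficients M)"
    unfolding io_coefficients_def dp_coeffs_def using finite_sets by (intro countable_finite) auto
  then have cH: "countable ?H" by simp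
  have "\<exists>p q. mp_vars p \<subseteq> X \<and> mp_vars q \<subseteq> X \<and> q \<noteq> 0 \<and> g = Fract p q" if "g \<in> ?H" for g
  proof -
    have "g \<in> rational_functions X"
      using that hr rf_defined_rational_function[OF io_coefficient_defined[OF \<mu>0]] by blast
    then show ?thesis by (elim rational_functionsE) blast
  qed
  then obtain num den where nd: "\<And>g. g \<in> ?H \<Longrightarrow> mp_vars (num g) \<subseteq> X \<and> mp_vars (den g) \<subseteq> X \<and> den g \<noteq> 0 \<and>
      g = Fract (num g) (den g)" by metis
  \<comment> \<open>Everything that must have a controlled value at the new parameter: fractions for
    h and the coefficients, and the two polynomials guaranteeing minimality and membership in the
    domain. The constants C are their coefficients.\<close>
  let ?polys = "num ` ?H \<union> den ` ?H \<union> {Pm, Q}"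
  define C where "C = (\<Union>f\<in>?polys. Poly_Mapping.lookup f ` Poly_Mapping.keys f)"
  have "countable {Pm, Q}" by simp
  then have "countable ?polys" by (intro countable_Un countable_image cH)
  then have C: "countable C" unfolding C_def by (rule countable_UN) (simp add: countable_finite)
  define R where "R = ring_closure (mp_const ` C \<union> mp_var ` X :: (nat, complex) mpoly set)"
  have RI: "f \<in> R" if "f \<in> ?polys" for f
    unfolding R_def
  proof (rule mpoly_in_ring_closure)
    show "Poly_Mapping.lookup f ` Poly_Mapping.keys f \<subseteq> C" unfolding C_def using that by blast
    show "mp_vars f \<subseteq> X" using that nd Pm(2) Q(2) by blast
  qed
  interpret V: ring_rel "\<lambda>f g. mp_vars (f :: (nat, complex) mpoly) \<subseteq> X \<and> f = g" by (rule ring_rel_mp_vars)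
  have Rvars: "mp_vars f \<subseteq> X" if "f \<in> R" for f
    using that unfolding R_def
  proof (induction rule: ring_closure.induct)
    case (add a b)
    then show ?case using V.add[of a a b b] by blast
  next
    case (mult a b)
    then show ?case using V.mult[of a a b b] by blast
  qed auto
  \<comment> \<open>The polynomial P of \<Theta> stays outside R and is added as one more function,
    since only \<mu> has to satisfy it. Off X the value is \<open>undefined\<close>, as
    \<open>cspace X\<close> requires.\<close>
  have "\<exists>\<mu>. (\<forall>v. v \<notin> X \<longrightarrow> \<mu> v = undefined) \<and>
     (\<forall>f\<in>insert (\<lambda>\<mu>. mp_eval (case_sum x0 \<mu>) P) ((\<lambda>f \<mu>. mp_eval \<mu> f) ` (R - {0})). f \<mu> \<noteq> 0)"
  proof (rule common_nonzero_point)
    have "countable (mp_const ` C \<union> mp_var ` X :: (nat, complex) mpoly set)"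
      using C finite_sets(4) by (simp add: countable_finite)
    then have "countable R" unfolding R_def by (rule countable_ring_closure)
    then show "countable (insert (\<lambda>\<mu>. mp_eval (case_sum x0 \<mu>) P) ((\<lambda>f \<mu>. mp_eval \<mu> f) ` (R - {0})))"
      by (intro countable_insert countable_image countable_Diff)
    show "finite X" by (rule finite_sets(4))
    fix f assume f: "f \<in> insert (\<lambda>\<mu>. mp_eval (case_sum x0 \<mu>) P) ((\<lambda>f \<mu>. mp_eval \<mu> f) ` (R - {0}))"
    show "\<exists>Q. \<forall>t. f (z(v := t)) = poly Q t" for z v
    proof -
      have "case_sum x0 (z(v := t)) = (case_sum x0 z)(Inr v := t)" for t
        by (auto simp: fun_eq_iff split: sum.splits)
      then show ?thesis
        using f mp_eval_line[where p = P and z = "case_sum x0 z" and v = "Inr v"]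
          mp_eval_line[where z = z and v = v] by auto
    qed
    show "\<exists>z. (\<forall>v. v \<notin> X \<longrightarrow> z v = undefined) \<and> f z \<noteq> 0"
    proof (cases "f = (\<lambda>\<mu>. mp_eval (case_sum x0 \<mu>) P)")
      case True
      have "case_sum x0 (\<lambda>v. z (Inr v)) = z" by (auto simp: x0_def fun_eq_iff split: sum.splits)
      moreover have "z (Inr v) = undefined" if "v \<notin> X" for v
        using z(1) that unfolding cspace_def by (auto simp: PiE_iff extensional_def)
      ultimately show ?thesis using z(2) True by (intro exI[of _ "\<lambda>v. z (Inr v)"]) simp
    next
      case False
      then obtain g where g: "g \<in> R" "g \<noteq> 0" "f = (\<lambda>\<mu>. mp_eval \<mu> g)" using f by blast
      obtain \<mu> where "\<mu> \<in> cspace X" "mp_eval \<mu> g \<noteq> 0" using nonzero_in_cspace[OF g(2) Rvars[OF g(1)]] by blast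
      then show ?thesis using g(3) by (intro exI[of _ \<mu>]) (auto simp: cspace_def PiE_iff extensional_def)
    qed
  qed
  then obtain \<mu> where \<mu>X: "\<forall>v. v \<notin> X \<longrightarrow> \<mu> v = undefined" and
    \<mu>F: "\<forall>f\<in>insert (\<lambda>\<mu>. mp_eval (case_sum x0 \<mu>) P) ((\<lambda>f \<mu>. mp_eval \<mu> f) ` (R - {0})). f \<mu> \<noteq> 0"
    by (elim exE conjE) (rule that)
  have \<mu>P: "mp_eval (case_sum x0 \<mu>) P \<noteq> 0" using bspec[OF \<mu>F insertI1] .
  have \<mu>R: "mp_eval \<mu> f \<noteq> 0" if "f \<in> R" "f \<noteq> 0" for f
    using that by (intro bspec[OF \<mu>F insertI2, of "\<lambda>\<mu>. mp_eval \<mu> f"] imageI) simp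
  have hnd: "num h \<in> R" "den h \<in> R" "den h \<noteq> 0" "h = Fract (num h) (den h)"
    using RI[of "num h"] RI[of "den h"] nd[of h] by simp_all
  have "range rf_const \<subseteq> ?F" using generated_field_const by blast
  from moving_specialization[OF C finite_sets(4) field_closed_generated_field this, folded R_def,
      OF \<mu>R hnd(1-3)] hF hnd(4)
  obtain w where w: "\<And>f. f \<in> R \<Longrightarrow> mp_eval w f = 0 \<Longrightarrow> f = 0"
    "mp_eval w (num h) / mp_eval w (den h) \<noteq> mp_eval \<mu> (num h) / mp_eval \<mu> (den h)"
    "\<And>a b. a \<in> R \<Longrightarrow> b \<in> R \<Longrightarrow> b \<noteq> 0 \<Longrightarrow> Fract a b \<in> ?F \<Longrightarrow>
       mp_eval w a / mp_eval w b = mp_eval \<mu> a / mp_eval \<mu> b"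
    by metis
  \<comment> \<open>w is arbitrary off X; the restriction lies in \<open>cspace X\<close> and gives
    the same values to R, whose elements involve only variables of X.\<close>
  define \<nu> where "\<nu> = restrict w X"
  have \<nu>: "mp_eval \<nu> f = mp_eval w f" if "f \<in> R" for f
    using Rvars[OF that] by (intro mp_eval_cong) (auto simp: \<nu>_def)
  have cs: "\<mu> \<in> cspace X" "\<nu> \<in> cspace X"
    using \<mu>X by (auto simp: cspace_def \<nu>_def PiE_iff extensional_def)
  have QR: "Q \<in> R" "Pm \<in> R" using RI by blast+
  have dom: "\<mu> \<in> param_domain M" "\<nu> \<in> param_domain M"
    using Q(1,3) cs \<mu>R[OF QR(1)] w(1)[OF QR(1)] \<nu>[OF QR(1)] by auto
  have min: "minimal_at j0 \<mu>" "minimal_at j0 \<nu>"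
    using Pm(1,3) dom \<mu>R[OF QR(2)] w(1)[OF QR(2)] \<nu>[OF QR(2)] by auto
  have val: "rf_value X g \<mu> (mp_eval \<mu> (num g) / mp_eval \<mu> (den g))"
    "rf_value X g \<nu> (mp_eval w (num g) / mp_eval w (den g))" if g: "g \<in> ?H" for g
  proof -
    have gR: "num g \<in> R" "den g \<in> R" using RI g by blast+
    note ndg = nd[OF g]
    have "mp_eval \<mu> (den g) \<noteq> 0" "mp_eval \<nu> (den g) \<noteq> 0"
      using \<mu>R[OF gR(2)] w(1)[OF gR(2)] \<nu>[OF gR(2)] ndg by auto
    then show "rf_value X g \<mu> (mp_eval \<mu> (num g) / mp_eval \<mu> (den g))"
      "rf_value X g \<nu> (mp_eval w (num g) / mp_eval w (den g))"
      using rf_value_FractI[of "num g" X "den g"] ndg \<nu>[OF gR(1)] \<nu>[OF gR(2)] by metis+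
  qed
  have "rf_eval X g \<mu> = rf_eval X g \<nu>" if g: "g \<in> io_coefficients M" for g
  proof -
    have gH: "g \<in> ?H" using g by blast
    have "Fract (num g) (den g) \<in> ?F" using generated_field_gen[OF g] nd[OF gH] by simp
    moreover have "num g \<in> R" "den g \<in> R" using RI gH by blast+
    moreover have "den g \<noteq> 0" using nd[OF gH] by simp
    ultimately have "mp_eval w (num g) / mp_eval w (den g) = mp_eval \<mu> (num g) / mp_eval \<mu> (den g)"
      by (intro w(3))
    then show ?thesis using rf_eval_eqI[OF val(1)[OF gH]] rf_eval_eqI[OF val(2)[OF gH]] by simp
  qed
  then have io: "same_io \<mu> \<nu>" using same_io_iff[OF dom] by blast
  have i1: "1 \<in> outputs M" using model by (auto simp: linear_compartment_model_def outputs_def)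
  obtain x0' where x0': "x0' \<in> cspace (states M)"
    "\<forall>i\<in>outputs M. germ_eq (response M x0 \<mu> u i) (response M x0' \<nu> u i)"
    using same_io_imp_same_response[OF io j0 i1 _ _ _ _ ua, of x0] min i1 unfolding minimal_at_def by blast
  have def: "rf_defined X h \<mu>" "rf_defined X h \<nu>" using val[of h] unfolding rf_defined_def by blast+
  have adm: "(x0, \<mu>, u) \<in> admissible M h" "(x0', \<nu>, u) \<in> admissible M h"
    using x0 x0'(1) dom def ua by (auto simp: admissible_def)
  have "case_sum x0 \<mu> \<in> cspace (states M <+> X)"
    using x0 cs(1) unfolding cspace_def by (auto simp: PiE_iff extensional_def split: sum.splits)
  then have "case_sum x0 \<mu> \<in> \<Theta>" using \<mu>P P by simp
  from card[OF adm(1) this u] obtain c where c: "indistinguishable_values M h x0 \<mu> u = {c}"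
    by (auto simp: card_1_singleton_iff)
  have "rf_eval X h \<mu> \<in> indistinguishable_values M h x0 \<mu> u"
    unfolding indistinguishable_values_def
    by (intro CollectI exI[of _ x0] exI[of _ \<mu>]) (use adm in \<open>auto simp: germ_eq_def\<close>)
  moreover have "rf_eval X h \<nu> \<in> indistinguishable_values M h x0 \<mu> u"
    unfolding indistinguishable_values_def
    by (intro CollectI exI[of _ x0'] exI[of _ \<nu>]) (use adm x0' in auto)
  ultimately have "rf_eval X h \<mu> = rf_eval X h \<nu>" unfolding c by simp
  then show False using w(2) rf_eval_eqI[OF val(1)[of h]] rf_eval_eqI[OF val(2)[of h]] by simp
qed

end

theorem mainTheorem3:
  fixes M :: compartment_model
  assumes "linear_compartment_model M"
    and "strongly_connected (with_proj (graph M))"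
    and "inputs M \<noteq> {}"
  shows "(\<forall>i\<in>outputs M. vanishes_on_solutions M (io_equation M i)) \<and>
         generated_field (io_coefficients M) = identifiable_functions M"
proof -
  interpret connected_compartment M
    using assms by unfold_locales
  obtain j0 where "j0 \<in> inputs M" using assms(3) by blast
  then show ?thesis
    using io_equation_vanishes generated_field_identifiable identifiable_generated_field by blast
qed

end
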